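(* Let $p,q$ be coprime positive integers, $P={}^t(p,q)$, and let $d\ge 1$, $r>0$ be integers. For any link $L\in\mathcal L(P;dpq,r)$, $r$ pairs of link components with opposite orientations can be eliminated successively to arrive at a positive link $L'\in\mathcal L(P;dpq,0)$; that is, there are links $L=L_r,L_{r-1},\dots,L_0=L'$ with $L_j\in\mathcal L(P;dpq,j)$ such that for each $j=r,\dots,1$ there is a smooth elimination family of a pair of links (as defined in the context) starting at $L_j$ and ending at $L_{j-1}$. Moreover $L'$ is isomorphic (as an oriented link in $S^3$) to the holomorphic torus link defined by $z_1^{qd}-z_2^{pd}=0$.
   Context: Let $S^3=\{(z_1,z_2)\in\mathbb C^2 : |z_1|^2+|z_2|^2=1\}$ and let $S^1=\{\rho\in\mathbb C:|\rho|=1\}$ act on $S^3$ by $\rho\circ(z_1,z_2)=(z_1\rho^p,z_2\rho^q)$. The orbits $z_1=0$ and $z_2=0$ are called singular; all other orbits are regular, and each orbit has a canonical (positive) orientation induced by the action. A mixed polynomial $f(\mathbf z,\bar{\mathbf z})=\sum_{\nu,\mu} c_{\nu,\mu}\mathbf z^\nu\bar{\mathbf z}^\mu$ in $\mathbf z=(z_1,z_2)$ is strongly polar weighted homogeneous with weight vector $P={}^t(p,q)$, radial degree $d_r$ and polar degree $d_p$ if $p(\nu_1+\mu_1)+q(\nu_2+\mu_2)=d_r$ and $p(\nu_1-\mu_1)+q(\nu_2-\mu_2)=d_p$ whenever $c_{\nu,\mu}\neq 0$. It is convenient if for each $j=1,2$ it contains, with nonzero coefficient, a monomial $z_j^{a_j}\bar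 z_j^{b_j}$ in $z_j,\bar z_j$ only; it is non-degenerate if the real differential of $f:(\mathbb C^* )^2\to\mathbb C\cong\mathbb R^2$ has rank 2 at every zero of $f$ in $(\mathbb C^* )^2$. $\mathcal L(P;d_p)$ is the set of oriented links $f^{-1}(0)\cap S^3$ with $f$ a convenient non-degenerate strongly polar weighted homogeneous mixed polynomial with weight $P$ and polar degree $d_p$ (the radial degree is arbitrary); the orientation is that of the transverse zero set of $f|_{S^3}:S^3\to\mathbb C$. Such a link is a finite union of regular orbits, each carrying either its positive orientation or the reversed (negative) one. For $j\ge0$, $\mathcal L(P;dpq,j)$ is the subspace of links in $\mathcal L(P;dpq)$ having $d+2j$ components, of which exactly $j$ are negatively oriented. A link in $\mathcal L(P;dpq,0)$ is called positive. For $j\ge1$, a smooth elimination family of a pair of links, starting at $L_j\in\mathcal L(P;dpq,j)$ and ending at $L_{j-1}\in\mathcal L(P;dpq,j-1)$, is a smooth family $L(t)$, $0\le t\le 1$, of strongly polar weighted homogeneous links of weight $P$ and polar degree $dpq$ (that is, $L(t)=f_t^{-1}(0)\cap S^3$ with $f_t$ strongly polar weighted homogeneous of weight $P$ and polar degree $dpq$ and depending smoothly on $t$) with $L(0)=L_j$, $L(1)=L_{j-1}$ such that: (1) $W=\{(\mathbf z,t)\in S^3\times[0,1] : \mathbf z\in L(t)\}$ is smooth of codimension two in $S^3\times[0,1]$; (2) there exists $t_0$ with $0<t_0<1$ such that $L(t)\in\mathcal L(P;dpq,j)$ for $t<t_0$ and $L(t)\in\mathcal L(P;dpq,j-1)$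 for $t>t_0$; the link $L(t_0)$ is singular, one of its components being the limit of two components of $L(t)$ with opposite orientations. *)

theory Defs
  imports "HOL-Analysis.Analysis" "HOL-Library.Poly_Mapping"
begin

type_synonym c2 = "complex \<times> complex"

abbreviation S3 :: "c2 set" where
  "S3 \<equiv> sphere 0 1"

subsection \<open>Smooth maps\<close>

text \<open>On an open subset of a finite-dimensional space, \<open>Ck_on k f U\<close> is the usual notion
  of a \<open>k\<close> times continuously differentiable map.\<close>

primrec Ck_on ::
    "nat \<Rightarrow> ('a::real_normed_vector \<Rightarrow> 'b::real_normed_vector) \<Rightarrow> 'a set \<Rightarrow> bool" where
  "Ck_on 0 f U \<longleftrightarrow> continuous_on U f"
| "Ck_on (Suc k) f U \<longleftrightarrow>
     (\<forall>x\<in>U. f differentiable (at x)) \<and> (\<forall>v. Ck_on k (\<lambda>x. frechet_derivative f (at x) v) U)"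

definition smooth_on_open ::
    "('a::real_normed_vector \<Rightarrow> 'b::real_normed_vector) \<Rightarrow> 'a set \<Rightarrow> bool" where
  "smooth_on_open f U \<longleftrightarrow> open U \<and> (\<forall>k. Ck_on k f U)"

definition smooth_on_set ::
    "('a::real_normed_vector \<Rightarrow> 'b::real_normed_vector) \<Rightarrow> 'a set \<Rightarrow> bool" where
  "smooth_on_set f S \<longleftrightarrow>
     (\<exists>U g. S \<subseteq> U \<and> smooth_on_open g U \<and> (\<forall>x\<in>S. g x = f x))"

subsection \<open>Mixed polynomials\<close>

text \<open>The key \<open>((\<nu>\<^sub>1, \<nu>\<^sub>2), (\<mu>\<^sub>1, \<mu>\<^sub>2))\<close> stands for the monomial
  with exponents \<open>\<nu>\<close> in \<open>z\<close> and \<open>\<mu>\<close> in the conjugate of \<open>z\<close>.\<close>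

type_synonym mixed_poly = "((nat \<times> nat) \<times> (nat \<times> nat)) \<Rightarrow>\<^sub>0 complex"

definition mixed_eval :: "mixed_poly \<Rightarrow> c2 \<Rightarrow> complex" where
  "mixed_eval f z =
     (\<Sum>((n1, n2), (m1, m2)) \<in> Poly_Mapping.keys f.
        Poly_Mapping.lookup f ((n1, n2), (m1, m2))
        * fst z ^ n1 * snd z ^ n2 * cnj (fst z) ^ m1 * cnj (snd z) ^ m2)"

definition strongly_polar_wh :: "nat \<Rightarrow> nat \<Rightarrow> int \<Rightarrow> int \<Rightarrow> mixed_poly \<Rightarrow> bool" where
  "strongly_polar_wh p q dr dp f \<longleftrightarrow>
     (\<forall>n1 n2 m1 m2. ((n1, n2), (m1, m2)) \<in> Poly_Mapping.keys f \<longrightarrow>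
        int p * (int n1 + int m1) + int q * (int n2 + int m2) = dr \<and>
        int p * (int n1 - int m1) + int q * (int n2 - int m2) = dp)"

definition convenient :: "mixed_poly \<Rightarrow> bool" where
  "convenient f \<longleftrightarrow>
     (\<exists>a b. ((a, 0), (b, 0)) \<in> Poly_Mapping.keys f) \<and>
     (\<exists>a b. ((0, a), (0, b)) \<in> Poly_Mapping.keys f)"

definition non_degenerate :: "mixed_poly \<Rightarrow> bool" where
  "non_degenerate f \<longleftrightarrow>
     (\<forall>z. fst z \<noteq> 0 \<and> snd z \<noteq> 0 \<and> mixed_eval f z = 0 \<longrightarrow>
        dim (range (frechet_derivative (mixed_eval f) (at z))) = 2)"

subsection \<open>Oriented links in the three-sphere\<close>

text \<open>An oriented link is encoded as the set of all pairs \<open>(z, v)\<close> with \<open>z\<close> on the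
  link and \<open>v\<close> a (nonzero) positively oriented tangent vector at \<open>z\<close>; the underlying
  point set is the image under \<^const>\<open>fst\<close>.\<close>

type_synonym oriented_link = "(c2 \<times> c2) set"

definition real_coords :: "c2 \<Rightarrow> real ^ 4" where
  "real_coords z = vector [Re (fst z), Im (fst z), Re (snd z), Im (snd z)]"

definition frame_det :: "c2 \<Rightarrow> c2 \<Rightarrow> c2 \<Rightarrow> c2 \<Rightarrow> real" where
  "frame_det a b c d =
     det (vector [real_coords a, real_coords b, real_coords c, real_coords d] :: real ^ 4 ^ 4)"

text \<open>The sphere is oriented as the boundary of the ball: \<open>(u, v, w)\<close> is a positive tangent
  frame at \<open>z\<close> when \<open>(z, u, v, w)\<close> is a positive frame of \<^typ>\<open>c2\<close> as a real vector space.\<close>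

definition positive_S3_frame :: "c2 \<Rightarrow> c2 \<Rightarrow> c2 \<Rightarrow> c2 \<Rightarrow> bool" where
  "positive_S3_frame z u v w \<longleftrightarrow>
     z \<bullet> u = 0 \<and> z \<bullet> v = 0 \<and> z \<bullet> w = 0 \<and> frame_det z u v w > 0"

definition sphere_zeros :: "(c2 \<Rightarrow> complex) \<Rightarrow> c2 set" where
  "sphere_zeros g = {z \<in> S3. g z = 0}"

definition transverse_on_S3 :: "(c2 \<Rightarrow> complex) \<Rightarrow> bool" where
  "transverse_on_S3 g \<longleftrightarrow>
     (\<forall>z \<in> sphere_zeros g. frechet_derivative g (at z) ` {w. z \<bullet> w = 0} = UNIV)"

text \<open>The orientation of a transverse zero set: the tangent direction followed by a lift of
  the positive basis \<open>(1, \<i>)\<close> of the target is a positive frame of the sphere. Since the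
  codimension is even, putting the lifted basis first gives the same orientation. Zeros at which
  transversality fails carry no tangent vector, so this represents the whole zero set only for
  \<open>g\<close> with \<^const>\<open>transverse_on_S3\<close>.\<close>

definition oriented_zero_link :: "(c2 \<Rightarrow> complex) \<Rightarrow> oriented_link" where
  "oriented_zero_link g =
     {(z, v). z \<in> sphere_zeros g \<and> frechet_derivative g (at z) v = 0 \<and>
        (\<exists>w1 w2. frechet_derivative g (at z) w1 = 1 \<and> frechet_derivative g (at z) w2 = \<i> \<and>
                 positive_S3_frame z v w1 w2)}"

definition circle_action :: "nat \<Rightarrow> nat \<Rightarrow> complex \<Rightarrow> c2 \<Rightarrow> c2" where
  "circle_action p q \<rho> z = (fst z * \<rho> ^ p, snd z * \<rho> ^ q)"

definition orbit_velocity :: "nat \<Rightarrow> nat \<Rightarrow> c2 \<Rightarrow> c2" where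
  "orbit_velocity p q z = vector_derivative (\<lambda>\<theta>. circle_action p q (cis \<theta>) z) (at 0)"

definition positively_oriented :: "nat \<Rightarrow> nat \<Rightarrow> oriented_link \<Rightarrow> c2 set \<Rightarrow> bool" where
  "positively_oriented p q L C \<longleftrightarrow> (\<forall>z\<in>C. (z, orbit_velocity p q z) \<in> L)"

definition negatively_oriented :: "nat \<Rightarrow> nat \<Rightarrow> oriented_link \<Rightarrow> c2 set \<Rightarrow> bool" where
  "negatively_oriented p q L C \<longleftrightarrow> (\<forall>z\<in>C. (z, - orbit_velocity p q z) \<in> L)"

definition polar_links :: "nat \<Rightarrow> nat \<Rightarrow> int \<Rightarrow> oriented_link set" where
  "polar_links p q dp =
     {oriented_zero_link (mixed_eval f) | f.
        (\<exists>dr. strongly_polar_wh p q dr dp f) \<and> convenient f \<and> non_degenerate f}"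

definition polar_links_neg :: "nat \<Rightarrow> nat \<Rightarrow> nat \<Rightarrow> nat \<Rightarrow> oriented_link set" where
  "polar_links_neg p q d j =
     {L \<in> polar_links p q (int (d * p * q)).
        finite (components (fst ` L)) \<and>
        card (components (fst ` L)) = d + 2 * j \<and>
        card {C \<in> components (fst ` L). negatively_oriented p q L C} = j}"

subsection \<open>Elimination families\<close>

text \<open>Submanifolds of codimension two of the manifold with boundary \<open>S3 \<times> {0..1}\<close>. As usual for
  submanifolds of a manifold with boundary, the local defining map is required to be a submersion
  on the boundary as well: at times 0 and 1 only tangent vectors to the boundary are used.\<close>

definition smooth_codim2 :: "(c2 \<times> real) set \<Rightarrow> bool" where
  "smooth_codim2 W \<longleftrightarrow> W \<subseteq> S3 \<times> {0..1} \<and>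
     (\<forall>x\<in>W. \<exists>U (g :: c2 \<times> real \<Rightarrow> complex). x \<in> U \<and> smooth_on_open g U \<and>
        W \<inter> U = {y \<in> (S3 \<times> {0..1}) \<inter> U. g y = 0} \<and>
        (\<forall>(z, t) \<in> W \<inter> U.
           frechet_derivative g (at (z, t)) `
             {(w, s). z \<bullet> w = 0 \<and> (t \<in> {0, 1} \<longrightarrow> s = 0)} = UNIV))"

text \<open>Convergence of sets in the Hausdorff metric.\<close>

definition sets_tendto :: "('t \<Rightarrow> 'a::metric_space set) \<Rightarrow> 'a set \<Rightarrow> 't filter \<Rightarrow> bool" where
  "sets_tendto A C F \<longleftrightarrow>
     (\<forall>e>0. \<forall>\<^sub>F t in F. (\<forall>x\<in>A t. \<exists>y\<in>C. dist x y < e) \<and> (\<forall>y\<in>C. \<exists>x\<in>A t. dist x y < e))"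

definition smooth_poly_family :: "(real \<Rightarrow> mixed_poly) \<Rightarrow> bool" where
  "smooth_poly_family F \<longleftrightarrow>
     finite (\<Union>t\<in>{0..1}. Poly_Mapping.keys (F t)) \<and>
     (\<forall>k. smooth_on_set (\<lambda>t. Poly_Mapping.lookup (F t) k) {0..1})"

definition elimination_family ::
    "nat \<Rightarrow> nat \<Rightarrow> nat \<Rightarrow> nat \<Rightarrow> oriented_link \<Rightarrow> oriented_link \<Rightarrow> (real \<Rightarrow> mixed_poly) \<Rightarrow> bool" where
  "elimination_family p q d j L L' F \<longleftrightarrow>
     (let K = (\<lambda>t. sphere_zeros (mixed_eval (F t)));
          Lk = (\<lambda>t. oriented_zero_link (mixed_eval (F t)))
      in
        j \<ge> 1 \<and> L \<in> polar_links_neg p q d j \<and> L' \<in> polar_links_neg p q d (j - 1) \<and>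
        smooth_poly_family F \<and>
        (\<forall>t\<in>{0..1}. \<exists>dr. strongly_polar_wh p q dr (int (d * p * q)) (F t)) \<and>
        Lk 0 = L \<and> Lk 1 = L' \<and>
        smooth_codim2 {(z, t). t \<in> {0..1} \<and> z \<in> K t} \<and>
        (\<exists>t0. 0 < t0 \<and> t0 < 1 \<and>
           (\<forall>t\<in>{0..<t0}. transverse_on_S3 (mixed_eval (F t)) \<and> Lk t \<in> polar_links_neg p q d j) \<and>
           (\<forall>t\<in>{t0<..1}. transverse_on_S3 (mixed_eval (F t)) \<and>
                         Lk t \<in> polar_links_neg p q d (j - 1)) \<and>
           \<not> transverse_on_S3 (mixed_eval (F t0)) \<and>
           (\<exists>C \<in> components (K t0). \<exists>A B.
              (\<forall>t\<in>{0..<t0}.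
                 A t \<in> components (K t) \<and> positively_oriented p q (Lk t) (A t) \<and>
                 B t \<in> components (K t) \<and> negatively_oriented p q (Lk t) (B t)) \<and>
              sets_tendto A C (at_left t0) \<and> sets_tendto B C (at_left t0))))"

subsection \<open>Isomorphism of oriented links\<close>

text \<open>An orientation-preserving diffeomorphism of the sphere, given by a smooth map \<open>\<phi>\<close> on a
  neighbourhood, whose derivative carries the positive tangent vectors of the first link onto
  those of the second.\<close>

definition link_isomorphic :: "oriented_link \<Rightarrow> oriented_link \<Rightarrow> bool" where
  "link_isomorphic L L' \<longleftrightarrow>
     (\<exists>U \<phi>. S3 \<subseteq> U \<and> smooth_on_open \<phi> U \<and> bij_betw \<phi> S3 S3 \<and>
        smooth_on_set (inv_into S3 \<phi>) S3 \<and>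
        (\<forall>z\<in>S3. \<forall>u v w. positive_S3_frame z u v w \<longrightarrow>
           positive_S3_frame (\<phi> z) (frechet_derivative \<phi> (at z) u)
             (frechet_derivative \<phi> (at z) v) (frechet_derivative \<phi> (at z) w)) \<and>
        (\<lambda>(z, v). (\<phi> z, frechet_derivative \<phi> (at z) v)) ` L = L')"

end

theory Submission
  imports Defs "HOL-Computational_Algebra.Fundamental_Theorem_Algebra"
begin

text \<open>
  A polynomial in the class is \<open>f(z) = z\<^sub>2\<^bsup>pn\<^esup> cnj z\<^sub>2\<^bsup>pm\<^esup> \<phi>(z\<^sub>1\<^sup>q / z\<^sub>2\<^sup>p)\<close> with \<open>n - m = d\<close> and \<open>\<phi>\<close> a mixed
  polynomial in one variable of bidegree \<open>(n, m)\<close>. The fibres of \<open>z\<^sub>1\<^sup>q / z\<^sub>2\<^sup>p\<close> on the sphere are the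
  orbits, so the oriented link records just the zeros of \<open>\<phi>\<close> together with the signs of its Jacobian
  there. Hence a link with positive zeros \<open>P\<close> and negative zeros \<open>N\<close> may be represented by
  \<open>(\<Prod>a\<in>P. w - a) cnj (\<Prod>b\<in>N. w - b)\<close>. A positive zero \<open>a\<close> and a negative zero \<open>b\<close> are cancelled
  by replacing the factor \<open>(w - a) cnj (w - b)\<close> by \<open>(w - a) cnj (w - b) + t \<gamma>\<close> for a suitable complex
  number \<open>\<gamma>\<close>. While the last pair is eliminated, the other positive zeros are moved to the
  \<open>d\<close>-th roots of unity along a path in a pencil of polynomials that avoids the discriminant; so the
  positive link reached is the torus link itself and no further isotopy is needed.
\<close>

subsection \<open>Smooth maps\<close>

text \<open>The singular orbits lie over 0 and infinity, and convenience keeps both from being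
  zeros. At a zero the differential factors through that of the quotient \<open>z1^q / z2^p\<close>,
  so transversality, non-degeneracy and orientation depend only on the moduli of the two Wirtinger
  derivatives: equal moduli mean degeneracy, and otherwise the larger one gives the sign. The
  obstacle is that several zeros move at once and must not meet each other, 0 or infinity, apart
  from the one intended collision. Monic factors take care of infinity. For the rest, each free
  parameter (the bend of the path in the pencil, the argument of \<gamma>) has only finitely many
  bad values, and the speed of the cancellation can be chosen last because the curve swept by the
  pair does not depend on it. At the merging orbit the spatial derivative has rank one; the total
  space is smooth there because \<gamma> lies outside its image. Consecutive families agree as
  links, not as polynomials: once its zeros are gone the pair factor is dropped, so the radial
  degree falls from one family to the next.\<close>

lemma Ck_on_Suc_imp: "Ck_on (Suc k) f U \<Longrightarrow> Ck_on k f U"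
proof (induction k arbitrary: f)
  case 0
  then show ?case
    by (auto intro!: differentiable_imp_continuous_on differentiable_at_imp_differentiable_on)
next
  case (Suc k)
  then show ?case
    by (metis Ck_on.simps(2))
qed

lemma Ck_on_const: "Ck_on k (\<lambda>x. c) U"
proof (induction k arbitrary: c)
  case (Suc k)
  have "frechet_derivative (\<lambda>x::'a. c) (at x) = (\<lambda>_. 0)" for x
    by (rule frechet_derivative_const)
  then show ?case
    using Suc[of 0] by simp
qed simp

lemma Ck_on_add:
  assumes "Ck_on k f UNIV" "Ck_on k g UNIV"
  shows "Ck_on k (\<lambda>x. f x + g x) UNIV"
  using assms
proof (induction k arbitrary: f g)
  case 0
  then show ?case by (auto intro: continuous_on_add)
next
  case (Suc k)
  have "frechet_derivative (\<lambda>x. f x + g x) (at x)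
      = (\<lambda>v. frechet_derivative f (at x) v + frechet_derivative g (at x) v)" for x
    using Suc.prems by (intro frechet_derivative_at[symmetric] has_derivative_add)
      (auto simp: frechet_derivative_works[symmetric])
  then show ?case
    using Suc by (auto intro: differentiable_add)
qed

lemma Ck_on_mult:
  fixes f g :: "'a::real_normed_vector \<Rightarrow> 'b::real_normed_algebra"
  assumes "Ck_on k f UNIV" "Ck_on k g UNIV"
  shows "Ck_on k (\<lambda>x. f x * g x) UNIV"
  using assms
proof (induction k arbitrary: f g)
  case 0
  then show ?case by (auto intro: continuous_on_mult)
next
  case (Suc k)
  have eq: "frechet_derivative (\<lambda>x. f x * g x) (at x)
      = (\<lambda>v. f x * frechet_derivative g (at x) v + frechet_derivative f (at x) v * g x)" for x
    using Suc.prems by (intro frechet_derivative_at[symmetric] has_derivative_mult)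
      (auto simp: frechet_derivative_works[symmetric])
  \<comment> \<open>The product rule keeps undifferentiated factors, so \<open>f\<close> and
    \<open>g\<close> themselves are needed at level \<open>k\<close>.\<close>
  have "Ck_on k f UNIV" "Ck_on k g UNIV"
    using Suc.prems Ck_on_Suc_imp by blast+
  then show ?case
    using Suc unfolding Ck_on.simps eq
    by (auto intro!: differentiable_mult Ck_on_add Suc.IH)
qed

lemma Ck_on_linear:
  assumes "bounded_linear f"
  shows "Ck_on k f UNIV"
proof (cases k)
  case 0
  then show ?thesis
    using assms by (simp add: linear_continuous_on)
next
  case (Suc n)
  have "(f has_derivative f) (at x)" for x
    by (rule bounded_linear_imp_has_derivative[OF assms])
  then have "frechet_derivative f (at x) = f" "f differentiable (at x)" for x
    by (auto simp: frechet_derivative_at[symmetric] differentiable_def)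
  then show ?thesis
    using Suc Ck_on_const by auto
qed

lemma Ck_on_power:
  fixes f :: "'a::real_normed_vector \<Rightarrow> 'b::real_normed_algebra_1"
  shows "Ck_on k f UNIV \<Longrightarrow> Ck_on k (\<lambda>x. f x ^ n) UNIV"
  by (induction n) (auto intro: Ck_on_const Ck_on_mult)

lemma Ck_on_sum:
  assumes "\<And>i. i \<in> I \<Longrightarrow> Ck_on k (f i) UNIV"
  shows "Ck_on k (\<lambda>x. \<Sum>i\<in>I. f i x) UNIV"
  using assms by (induction I rule: infinite_finite_induct) (auto intro: Ck_on_const Ck_on_add)

lemmas Ck_on_intros = Ck_on_const Ck_on_add Ck_on_mult Ck_on_power Ck_on_sum

lemma smooth_on_set_UNIV: "(\<And>k. Ck_on k f UNIV) \<Longrightarrow> smooth_on_set f S"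
  unfolding smooth_on_set_def smooth_on_open_def by (intro exI[of _ UNIV] exI[of _ f]) auto

lemma link_isomorphic_refl: "link_isomorphic L L"
proof -
  have inv: "inv_into S3 (\<lambda>z. z) z = z" if "z \<in> S3" for z :: c2
    using inv_into_f_f[of "\<lambda>z. z" S3 z] that by (simp add: inj_on_def)
  have id: "Ck_on k (\<lambda>z :: c2. z) UNIV" for k
    by (rule Ck_on_linear) simp
  have d: "frechet_derivative (\<lambda>z :: c2. z) (at z) = (\<lambda>v. v)" for z
    by (rule frechet_derivative_at[symmetric]) simp
  have s: "smooth_on_open (\<lambda>z :: c2. z) UNIV"
    using id by (simp add: smooth_on_open_def)
  have "smooth_on_set (inv_into S3 (\<lambda>z. z :: c2)) S3"
    unfolding smooth_on_set_def using inv s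
    by (intro exI[of _ UNIV] exI[of _ "\<lambda>z. z"]) simp
  then show ?thesis
    unfolding link_isomorphic_def using s
    by (intro exI[of _ UNIV] exI[of _ "\<lambda>z. z"]) (simp add: d bij_betw_def)
qed

subsection \<open>Frames\<close>

lemma det_4:
  "det (A :: 'a::comm_ring_1^4^4) =
     A$1$1 * (A$2$2 * A$3$3 * A$4$4 + A$2$3 * A$3$4 * A$4$2 + A$2$4 * A$3$2 * A$4$3
       - A$2$2 * A$3$4 * A$4$3 - A$2$3 * A$3$2 * A$4$4 - A$2$4 * A$3$3 * A$4$2)
   - A$1$2 * (A$2$1 * A$3$3 * A$4$4 + A$2$3 * A$3$4 * A$4$1 + A$2$4 * A$3$1 * A$4$3
       - A$2$1 * A$3$4 * A$4$3 - A$2$3 * A$3$1 * A$4$4 - A$2$4 * A$3$3 * A$4$1)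
   + A$1$3 * (A$2$1 * A$3$2 * A$4$4 + A$2$2 * A$3$4 * A$4$1 + A$2$4 * A$3$1 * A$4$2
       - A$2$1 * A$3$4 * A$4$2 - A$2$2 * A$3$1 * A$4$4 - A$2$4 * A$3$2 * A$4$1)
   - A$1$4 * (A$2$1 * A$3$2 * A$4$3 + A$2$2 * A$3$3 * A$4$1 + A$2$3 * A$3$1 * A$4$2
       - A$2$1 * A$3$3 * A$4$2 - A$2$2 * A$3$1 * A$4$3 - A$2$3 * A$3$2 * A$4$1)"
proof -
  have f: "finite {2::4, 3, 4}" "1 \<notin> {2::4, 3, 4}" "finite {3::4, 4}" "2 \<notin> {3::4, 4}"
    "finite {4::4}" "3 \<notin> {4::4}"
    by auto
  show ?thesis
    unfolding det_def UNIV_4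
    unfolding sum_over_permutations_insert[OF f(1,2)]
    unfolding sum_over_permutations_insert[OF f(3,4)]
    unfolding sum_over_permutations_insert[OF f(5,6)]
    unfolding permutes_sing
    by (simp add: sign_swap_id permutation_swap_id sign_compose sign_id permutation_compose
        swap_id_eq algebra_simps)
qed

lemma vector_4 [simp]:
  "(vector [x, y, z, w] :: 'a::zero^4) $ 1 = x"
  "(vector [x, y, z, w] :: 'a::zero^4) $ 2 = y"
  "(vector [x, y, z, w] :: 'a::zero^4) $ 3 = z"
  "(vector [x, y, z, w] :: 'a::zero^4) $ 4 = w"
  unfolding vector_def by simp_all

lemmas frame_det_expand = frame_det_def det_4 real_coords_def vector_4

lemma frame_det_combine:
  "frame_det (s *\<^sub>R a + t *\<^sub>R a') b c d = s * frame_det a b c d + t * frame_det a' b c d"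
  unfolding frame_det_expand by (simp add: algebra_simps)

lemma frame_det_scaleR2:
  "frame_det a (s *\<^sub>R b) c d = s * frame_det a b c d"
  unfolding frame_det_expand by (simp add: algebra_simps)

text \<open>The vector \<open>z\<close> lies in the kernel of the matrix with these four
  rows.\<close>

lemma frame_det_orthogonal:
  assumes "z \<noteq> 0" "z \<bullet> a = 0" "z \<bullet> b = 0" "z \<bullet> c = 0" "z \<bullet> d = 0"
  shows "frame_det a b c d = 0"
proof -
  let ?M = "vector [real_coords a, real_coords b, real_coords c, real_coords d] :: real ^ 4 ^ 4"
  have inner: "x \<bullet> y = real_coords x \<bullet> real_coords y" for x y
    by (simp add: inner_vec_def sum_4 real_coords_def inner_prod_def inner_complex_def)
  have "real_coords z \<noteq> 0"
    using assms(1) inner[of z z] by (metis inner_eq_zero_iff)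
  moreover have "?M *v real_coords z = 0"
    using assms(2-) by (simp add: vec_eq_iff matrix_vector_mul_component forall_4 inner inner_commute)
  ultimately have "\<not> invertible ?M"
    by (metis invertible_def matrix_left_invertible_ker)
  then show ?thesis
    by (simp add: frame_det_def invertible_det_nz)
qed

subsection \<open>Real-linear maps of the plane\<close>

text \<open>\<open>Im (cnj h * k)\<close> is the area form of the plane, so this identifies
  \<open>(norm A)^2 - (norm B)^2\<close> as the real determinant of
  \<open>h \<mapsto> A * h + B * cnj h\<close>.\<close>

lemma wirtinger_Im:
  fixes A B h k :: complex
  shows "Im (cnj (A * h + B * cnj h) * (A * k + B * cnj k))
      = ((norm A)\<^sup>2 - (norm B)\<^sup>2) * Im (cnj h * k)"
  unfolding cmod_power2 by (simp add: algebra_simps power2_eq_square)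

lemma wirtinger_surj:
  fixes A B y :: complex
  assumes "norm A \<noteq> norm B"
  obtains h where "A * h + B * cnj h = y"
proof -
  define D where "D = (norm A)\<^sup>2 - (norm B)\<^sup>2"
  have D: "D \<noteq> 0"
    using assms by (simp add: D_def)
  have Dc: "complex_of_real D = A * cnj A - B * cnj B"
    by (simp add: D_def complex_norm_square[symmetric])
  \<comment> \<open>Cramer's rule: eliminate \<open>cnj h\<close> from the equation and its
    conjugate.\<close>
  define h where "h = (cnj A * y - B * cnj y) / complex_of_real D"
  have "A * h + B * cnj h = (A * cnj A - B * cnj B) * y / complex_of_real D"
    by (simp add: h_def add_divide_distrib[symmetric] algebra_simps)
  then have "A * h + B * cnj h = y"
    using D unfolding Dc[symmetric] by simp
  then show ?thesis using that by blast
qed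

text \<open>The determinant is zero, so images span no area, whereas \<open>1\<close> and
  \<open>\<i>\<close> span area 1.\<close>

lemma wirtinger_not_surj:
  fixes A B :: complex
  assumes "norm A = norm B"
  shows "range (\<lambda>h. A * h + B * cnj h) \<noteq> UNIV"
proof
  assume "range (\<lambda>h. A * h + B * cnj h) = UNIV"
  then have "1 \<in> range (\<lambda>h. A * h + B * cnj h)" "\<i> \<in> range (\<lambda>h. A * h + B * cnj h)"
    by auto
  then obtain h k where "1 = A * h + B * cnj h" "\<i> = A * k + B * cnj k"
    by blast
  then show False
    using wirtinger_Im[of A h B k] assms by (metis complex_cnj_one diff_self imaginary_unit.sel(2) mult_1 mult_zero_left zero_neq_one)
qed

text \<open>Reverse triangle inequality. It serves both for injectivity of the derivative and for
  isolation of its zeros.\<close>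

lemma wirtinger_lower_bound:
  fixes A B h :: complex
  shows "\<bar>norm A - norm B\<bar> * norm h \<le> norm (A * h + B * cnj h)"
proof -
  have "\<bar>norm A - norm B\<bar> * norm h = \<bar>norm (A * h) - norm (B * cnj h)\<bar>"
    by (simp add: norm_mult abs_mult flip: left_diff_distrib)
  also have "\<dots> \<le> norm (A * h - (- (B * cnj h)))"
    using norm_triangle_ineq3[of "A * h" "- (B * cnj h)"] by simp
  finally show ?thesis by simp
qed

subsection \<open>Orbits and tangent vectors\<close>

locale weights =
  fixes p q :: nat
  assumes p_pos: "p > 0" and q_pos: "q > 0" and coprime_pq: "coprime p q"
begin

lemma orbit_velocity_eq:
  "orbit_velocity p q z = (\<i> * of_nat p * fst z, \<i> * of_nat q * snd z)"
proof -
  have *: "((\<lambda>\<theta>. a * cis \<theta> ^ n) has_vector_derivative \<i> * of_nat n * a) (at 0)" for a and n :: nat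
  proof -
    have "((\<lambda>\<theta>. a * exp (\<i> * of_nat n * \<theta>)) has_field_derivative \<i> * of_nat n * a) (at 0)"
      by (auto intro!: derivative_eq_intros)
    then have "((\<lambda>\<theta>. a * exp (\<i> * of_nat n * of_real \<theta>)) has_vector_derivative \<i> * of_nat n * a) (at 0)"
      using has_vector_derivative_real_field[of "\<lambda>\<theta>. a * exp (\<i> * of_nat n * \<theta>)" _ 0] by simp
    then show ?thesis
      by (simp add: cis_conv_exp exp_of_nat_mult[symmetric] mult_ac)
  qed
  have "((\<lambda>\<theta>. circle_action p q (cis \<theta>) z) has_vector_derivative
      (\<i> * of_nat p * fst z, \<i> * of_nat q * snd z)) (at 0)"
    unfolding circle_action_def by (intro has_vector_derivative_Pair *)
  then show ?thesis
    unfolding orbit_velocity_def by (rule vector_derivative_at)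
qed

text \<open>The velocity at \<open>l = 1\<close> of the weighted scaling
  \<open>(l^p z1, l^q z2)\<close>; the orbit velocity is \<open>\<i>\<close> times it.\<close>

definition euler :: "c2 \<Rightarrow> c2" where
  "euler z = (of_nat p * fst z, of_nat q * snd z)"

text \<open>The complex determinant with the Euler field; its kernel is the complex line spanned by
  the orbit direction.\<close>

definition transverse_coord :: "c2 \<Rightarrow> c2 \<Rightarrow> complex" where
  "transverse_coord z w = of_nat q * snd z * fst w - of_nat p * fst z * snd w"

lemma transverse_coord_linear:
  "transverse_coord z (a + b) = transverse_coord z a + transverse_coord z b"
  "transverse_coord z (s *\<^sub>R a) = of_real s * transverse_coord z a"
  by (auto simp: transverse_coord_def algebra_simps scaleR_conv_of_real)

lemma euler_inner:
  "euler z \<bullet> z = real p * (norm (fst z))\<^sup>2 + real q * (norm (snd z))\<^sup>2"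
  unfolding cmod_power2
  by (simp add: euler_def inner_prod_def inner_complex_def power2_eq_square algebra_simps)

lemma euler_inner_pos:
  assumes "fst z \<noteq> 0"
  shows "euler z \<bullet> z > 0"
  using assms p_pos unfolding euler_inner by (simp add: add_pos_nonneg)

text \<open>The normal \<open>z\<close> can be traded for \<open>euler z\<close>: this is
  \<open>euler z \<bullet> z\<close> times \<open>z\<close> plus a vector tangent to the sphere, and
  four tangent vectors are dependent. Since \<open>euler z\<close> and the orbit velocity span a
  complex line, what remains is the area form on the quotient by that line, whose coordinate is
  \<open>transverse_coord z\<close>.\<close>

lemma frame_det_velocity:
  assumes "z \<in> S3" "z \<bullet> a = 0" "z \<bullet> b = 0"
  shows "(euler z \<bullet> z) * frame_det z (orbit_velocity p q z) a b
      = Im (cnj (transverse_coord z a) * transverse_coord z b)"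
proof -
  let ?v = "orbit_velocity p q z"
  have zz: "z \<bullet> z = 1"
    using assms(1) by (simp add: dot_square_norm)
  have v: "z \<bullet> ?v = 0"
    by (simp add: orbit_velocity_eq inner_prod_def inner_complex_def)
  define u where "u = euler z - (euler z \<bullet> z) *\<^sub>R z"
  have "z \<bullet> u = 0"
    using zz by (simp add: u_def inner_diff_right inner_commute)
  then have "frame_det u ?v a b = 0"
    using assms v zz by (intro frame_det_orthogonal[of z]) auto
  moreover have "frame_det (euler z) ?v a b = frame_det ((euler z \<bullet> z) *\<^sub>R z + 1 *\<^sub>R u) ?v a b"
    by (simp add: u_def)
  ultimately have "frame_det (euler z) ?v a b = (euler z \<bullet> z) * frame_det z ?v a b"
    unfolding frame_det_combine by simp
  moreover have "frame_det (euler z) ?v a b = Im (cnj (transverse_coord z a) * transverse_coord z b)"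
    unfolding frame_det_expand orbit_velocity_eq euler_def transverse_coord_def
    by (simp add: algebra_simps)
  ultimately show ?thesis by simp
qed

text \<open>The kernel consists of the complex multiples \<open>c\<close> of \<open>euler z\<close>,
  and tangency forces \<open>Re c = 0\<close> because
  \<open>euler z \<bullet> z > 0\<close>.\<close>

lemma tangent_kernel:
  assumes "fst z \<noteq> 0" "snd z \<noteq> 0" "z \<bullet> v = 0" "transverse_coord z v = 0"
  obtains s where "v = s *\<^sub>R orbit_velocity p q z"
proof -
  define c where "c = fst v / (of_nat p * fst z)"
  have 1: "fst v = c * (of_nat p * fst z)"
    using assms p_pos by (simp add: c_def)
  have 2: "snd v = c * (of_nat q * snd z)"
    using assms p_pos unfolding c_def transverse_coord_def by (simp add: field_simps)
  have "z \<bullet> v = Re c * (euler z \<bullet> z)"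
    by (simp add: euler_def inner_prod_def inner_complex_def 1 2 algebra_simps)
  then have "Re c = 0"
    using assms euler_inner_pos[of z] by simp
  then have "c = of_real (Im c) * \<i>"
    by (simp add: complex_eq_iff)
  then have "v = Im c *\<^sub>R orbit_velocity p q z"
    using 1 2 unfolding orbit_velocity_eq by (simp add: prod_eq_iff scaleR_conv_of_real)
  then show ?thesis using that by blast
qed

text \<open>Any lift becomes tangent after subtracting a multiple of \<open>euler z\<close>, which
  has transverse coordinate 0.\<close>

lemma tangent_lift:
  assumes "fst z \<noteq> 0" "snd z \<noteq> 0"
  obtains a where "z \<bullet> a = 0" "transverse_coord z a = h"
proof -
  define a0 :: c2 where "a0 = (h / (of_nat q * snd z), 0)"
  define m where "m = (z \<bullet> a0) / (euler z \<bullet> z)"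
  define a where "a = a0 + (- m) *\<^sub>R euler z"
  have "z \<bullet> a = 0"
    using euler_inner_pos[OF assms(1)] by (simp add: a_def m_def inner_diff_right inner_commute)
  moreover have "transverse_coord z (euler z) = 0" "transverse_coord z a0 = h"
    using assms q_pos by (auto simp: transverse_coord_def euler_def a0_def)
  then have "transverse_coord z a = h"
    unfolding a_def transverse_coord_linear by simp
  ultimately show ?thesis using that by blast
qed

lemma transverse_coord_velocity: "transverse_coord z (s *\<^sub>R orbit_velocity p q z) = 0"
  by (simp add: transverse_coord_def orbit_velocity_eq)

lemma inner_velocity: "z \<bullet> (s *\<^sub>R orbit_velocity p q z) = 0"
  by (simp add: orbit_velocity_eq inner_prod_def inner_complex_def)

text \<open>The derivative factors through \<open>transverse_coord z\<close>, so its kernel among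
  tangent vectors is the orbit direction, and by \<open>wirtinger_Im\<close> the sign of the frame
  is that of the Jacobian. Thus \<open>norm A > norm B\<close> means positive orientation.\<close>

lemma zero_link_fibre:
  assumes "z \<in> S3" "fst z \<noteq> 0" "snd z \<noteq> 0" "g z = 0"
    and der: "(g has_derivative
        (\<lambda>w. A * transverse_coord z w + B * cnj (transverse_coord z w))) (at z)"
    and ne: "norm A \<noteq> norm B"
  shows "(z, v) \<in> oriented_zero_link g \<longleftrightarrow>
    (\<exists>s. v = s *\<^sub>R orbit_velocity p q z \<and> s * (norm A - norm B) > 0)"
proof -
  define W where "W h = A * h + B * cnj h" for h
  have fd: "frechet_derivative g (at z) = (\<lambda>w. W (transverse_coord z w))"
    using frechet_derivative_at[OF der] by (simp add: W_def)
  have W0: "h = 0" if "W h = 0" for h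
    using wirtinger_lower_bound[of A B h] ne that unfolding W_def
    by (simp add: mult_le_0_iff)
  have key: "(euler z \<bullet> z) * ((norm A)\<^sup>2 - (norm B)\<^sup>2) * frame_det z (s *\<^sub>R orbit_velocity p q z) a b = s"
    if "z \<bullet> a = 0" "z \<bullet> b = 0" "W (transverse_coord z a) = 1" "W (transverse_coord z b) = \<i>" for a b s
  proof -
    have "(euler z \<bullet> z) * ((norm A)\<^sup>2 - (norm B)\<^sup>2) * frame_det z (s *\<^sub>R orbit_velocity p q z) a b
        = s * (((norm A)\<^sup>2 - (norm B)\<^sup>2) * ((euler z \<bullet> z) * frame_det z (orbit_velocity p q z) a b))"
      by (simp add: frame_det_scaleR2)
    also have "\<dots> = s * Im (cnj (W (transverse_coord z a)) * W (transverse_coord z b))"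
      by (simp only: frame_det_velocity[OF assms(1) that(1,2)] W_def wirtinger_Im)
    finally show ?thesis using that(3,4) by simp
  qed
  have pos: "euler z \<bullet> z > 0"
    using assms euler_inner_pos by blast
  have sq: "(norm A)\<^sup>2 - (norm B)\<^sup>2 = (norm A - norm B) * (norm A + norm B)"
    by (simp add: power2_eq_square algebra_simps)
  have sumpos: "norm A + norm B > 0"
    using ne norm_ge_zero[of A] norm_ge_zero[of B] by linarith
  \<comment> \<open>All lifts of \<open>1\<close> and \<open>\<i>\<close> give the same sign, so the
    existential quantifier in \<open>oriented_zero_link\<close> involves no choice.\<close>
  have sgn: "frame_det z (s *\<^sub>R orbit_velocity p q z) a b > 0 \<longleftrightarrow> s * (norm A - norm B) > 0"
    if "z \<bullet> a = 0" "z \<bullet> b = 0" "W (transverse_coord z a) = 1" "W (transverse_coord z b) = \<i>" for a b s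
  proof -
    define N where "N = (euler z \<bullet> z) * (norm A + norm B)"
    have "s = N * (norm A - norm B) * frame_det z (s *\<^sub>R orbit_velocity p q z) a b"
      using key[OF that, of s] unfolding sq N_def by (simp add: mult_ac)
    then have "s * (norm A - norm B)
        = (N * (norm A - norm B)\<^sup>2) * frame_det z (s *\<^sub>R orbit_velocity p q z) a b"
      by (metis (no_types, lifting) mult.assoc mult.commute power2_eq_square)
    moreover have "N * (norm A - norm B)\<^sup>2 > 0"
      using pos sumpos ne by (simp add: N_def)
    ultimately show ?thesis
      by (metis zero_less_mult_pos zero_less_mult_iff)
  qed
  obtain h1 h2 where h: "W h1 = 1" "W h2 = \<i>"
    using wirtinger_surj[OF ne] unfolding W_def by metis
  obtain a b where ab: "z \<bullet> a = 0" "transverse_coord z a = h1" "z \<bullet> b = 0" "transverse_coord z b = h2"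
    using tangent_lift[OF assms(2,3)] by metis
  show ?thesis
  proof
    assume "(z, v) \<in> oriented_zero_link g"
    then obtain w1 w2 where w: "W (transverse_coord z v) = 0" "W (transverse_coord z w1) = 1"
        "W (transverse_coord z w2) = \<i>" "positive_S3_frame z v w1 w2"
      by (auto simp: oriented_zero_link_def fd)
    then have "transverse_coord z v = 0" "z \<bullet> v = 0"
      using W0 by (auto simp: positive_S3_frame_def)
    then obtain s where s: "v = s *\<^sub>R orbit_velocity p q z"
      using tangent_kernel assms by metis
    show "\<exists>s. v = s *\<^sub>R orbit_velocity p q z \<and> s * (norm A - norm B) > 0"
      using w s sgn unfolding positive_S3_frame_def by blast
  next
    assume "\<exists>s. v = s *\<^sub>R orbit_velocity p q z \<and> s * (norm A - norm B) > 0"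
    then obtain s where s: "v = s *\<^sub>R orbit_velocity p q z" "s * (norm A - norm B) > 0" by blast
    have "positive_S3_frame z v a b"
      using s ab h sgn[of a b s] inner_velocity by (auto simp: positive_S3_frame_def)
    moreover have "W (transverse_coord z v) = 0"
      unfolding s(1) transverse_coord_velocity by (simp add: W_def)
    ultimately show "(z, v) \<in> oriented_zero_link g"
      unfolding oriented_zero_link_def sphere_zeros_def mem_Collect_eq case_prod_conv fd
      using assms(1,4) ab h by (intro conjI exI[of _ a] exI[of _ b]) auto
  qed
qed

lemma surj_tangent_iff:
  assumes "fst z \<noteq> 0" "snd z \<noteq> 0"
  shows "(\<lambda>w. A * transverse_coord z w + B * cnj (transverse_coord z w)) ` {w. z \<bullet> w = 0} = UNIV
    \<longleftrightarrow> norm A \<noteq> norm B"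
proof
  assume "(\<lambda>w. A * transverse_coord z w + B * cnj (transverse_coord z w)) ` {w. z \<bullet> w = 0} = UNIV"
  then have "range (\<lambda>h. A * h + B * cnj h) = UNIV"
    by (auto simp: image_def set_eq_iff)
  then show "norm A \<noteq> norm B"
    using wirtinger_not_surj by blast
next
  assume ne: "norm A \<noteq> norm B"
  show "(\<lambda>w. A * transverse_coord z w + B * cnj (transverse_coord z w)) ` {w. z \<bullet> w = 0} = UNIV"
  proof (intro equalityI subset_UNIV subsetI)
    fix y
    obtain h where "A * h + B * cnj h = y"
      using wirtinger_surj[OF ne] .
    moreover obtain a where "z \<bullet> a = 0" "transverse_coord z a = h"
      using tangent_lift[OF assms] .
    ultimately show "y \<in> (\<lambda>w. A * transverse_coord z w + B * cnj (transverse_coord z w)) ` {w. z \<bullet> w = 0}"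
      by auto
  qed
qed

text \<open>Non-degeneracy tests all vectors of \<open>c2\<close>, transversality only those tangent
  to the sphere. The two agree because \<open>transverse_coord z\<close> is already onto on tangent
  vectors.\<close>

lemma dim_range_iff:
  assumes "fst z \<noteq> 0" "snd z \<noteq> 0"
  shows "dim (range (\<lambda>w. A * transverse_coord z w + B * cnj (transverse_coord z w))) = 2
    \<longleftrightarrow> norm A \<noteq> norm B"
proof -
  let ?f = "\<lambda>w. A * transverse_coord z w + B * cnj (transverse_coord z w)"
  have "linear ?f"
    by (intro linearI) (auto simp: transverse_coord_linear algebra_simps scaleR_conv_of_real)
  then have "subspace (range ?f)"
    by (rule linear_subspace_image[OF _ subspace_UNIV])
  then have sp: "span (range ?f) = range ?f"
    by (rule span_eq_iff[THEN iffD2])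
  have "dim (range ?f) = 2 \<longleftrightarrow> range ?f = UNIV"
    using dim_eq_full[of "range ?f"] unfolding sp DIM_complex .
  also have "\<dots> \<longleftrightarrow> norm A \<noteq> norm B"
  proof
    assume "range ?f = UNIV"
    then have "range (\<lambda>h. A * h + B * cnj h) = UNIV"
      by (auto simp: image_def set_eq_iff)
    then show "norm A \<noteq> norm B"
      using wirtinger_not_surj by blast
  next
    assume "norm A \<noteq> norm B"
    then have "?f ` {w. z \<bullet> w = 0} = UNIV"
      using surj_tangent_iff[OF assms] by blast
    then show "range ?f = UNIV"
      by blast
  qed
  finally show ?thesis .
qed

end

subsection \<open>Topology of the orbits\<close>

context weights
begin

text \<open>Here \<open>w = 0\<close> gives the singular orbit \<open>fst z = 0\<close>; the other
  singular orbit, \<open>snd z = 0\<close>, lies over infinity and is not of this form.\<close>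

definition orbit :: "complex \<Rightarrow> c2 set" where
  "orbit w = {z \<in> S3. snd z \<noteq> 0 \<and> fst z ^ q = w * snd z ^ p}"

lemma orbit_fst_nonzero: "z \<in> orbit w \<Longrightarrow> w \<noteq> 0 \<Longrightarrow> fst z \<noteq> 0"
  using q_pos by (auto simp: orbit_def zero_power)

lemma orbit_param: "z \<in> orbit w \<longleftrightarrow> z \<in> S3 \<and> snd z \<noteq> 0 \<and> fst z ^ q / snd z ^ p = w"
  by (auto simp: orbit_def field_simps)

lemma orbit_disjoint: "w \<noteq> w' \<Longrightarrow> orbit w \<inter> orbit w' = {}"
  by (auto simp: orbit_param)

lemma norm_c2_eq_1: "norm (z :: c2) = 1 \<longleftrightarrow> (norm (fst z))\<^sup>2 + (norm (snd z))\<^sup>2 = 1"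
  by (cases z) (simp add: norm_Pair)

lemma S3_iff: "z \<in> S3 \<longleftrightarrow> (norm (fst z))\<^sup>2 + (norm (snd z))\<^sup>2 = 1"
  by (simp add: norm_c2_eq_1)

lemma orbit_nonempty: "orbit w \<noteq> {}"
proof -
  obtain u where u: "u ^ q = w"
  proof (cases "w = 0")
    case True
    then show ?thesis using that[of 0] q_pos by simp
  next
    case False
    have "exp (Ln w / of_nat q) ^ q = exp (of_nat q * (Ln w / of_nat q))"
      by (rule exp_of_nat_mult[symmetric])
    also have "\<dots> = w" using False q_pos by simp
    finally show ?thesis using that by blast
  qed
  \<comment> \<open>The weighted scaling \<open>(l^p u, l^q)\<close> stays in the fibre. Its squared
    norm \<open>h l\<close> is 0 at \<open>l = 0\<close> and at least 1 at
    \<open>l = 1\<close>.\<close>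
  define h where "h l = (l ^ p * norm u)\<^sup>2 + (l ^ q)\<^sup>2" for l :: real
  have "\<exists>l\<ge>0. l \<le> 1 \<and> h l = 1"
    by (rule IVT') (auto simp: h_def p_pos q_pos zero_power intro!: continuous_intros)
  then obtain l where l: "0 \<le> l" "h l = 1" by auto
  have "l \<noteq> 0"
    using l p_pos q_pos by (auto simp: h_def zero_power)
  define z :: c2 where "z = (of_real l ^ p * u, of_real l ^ q)"
  have "z \<in> S3"
    using l unfolding S3_iff by (simp add: z_def h_def norm_mult norm_power)
  moreover have "fst z ^ q = w * snd z ^ p" "snd z \<noteq> 0"
    using u \<open>l \<noteq> 0\<close> by (auto simp: z_def power_mult_distrib mult.commute simp flip: power_mult)
  ultimately have "z \<in> orbit w"
    by (simp add: orbit_def)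
  then show ?thesis by blast
qed

text \<open>On a fibre the modulus of the first coordinate cannot decrease when that of the second
  grows, while their squares always sum to 1.\<close>

lemma orbit_norm_unique:
  assumes "z \<in> orbit w" "z' \<in> orbit w"
  shows "norm (fst z) = norm (fst z')" "norm (snd z) = norm (snd z')"
proof -
  have *: False if "a \<in> orbit w" "b \<in> orbit w" "norm (snd a) < norm (snd b)" for a b
  proof -
    have a: "norm (fst a) ^ q = norm w * norm (snd a) ^ p" "(norm (fst a))\<^sup>2 + (norm (snd a))\<^sup>2 = 1"
      using that(1) unfolding orbit_def S3_iff by (auto simp flip: norm_power norm_mult)
    have b: "norm (fst b) ^ q = norm w * norm (snd b) ^ p" "(norm (fst b))\<^sup>2 + (norm (snd b))\<^sup>2 = 1"
      using that(2) unfolding orbit_def S3_iff by (auto simp flip: norm_power norm_mult)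
    have "norm w * norm (snd a) ^ p \<le> norm w * norm (snd b) ^ p"
      using that(3) by (intro mult_left_mono power_mono) auto
    then have "norm (fst a) \<le> norm (fst b)"
      unfolding a(1)[symmetric] b(1)[symmetric] using q_pos power_le_imp_le_base[of _ "q - 1"]
      by (metis Suc_diff_1 norm_ge_zero)
    then have "(norm (fst a))\<^sup>2 \<le> (norm (fst b))\<^sup>2"
      by (intro power_mono) auto
    moreover have "(norm (snd a))\<^sup>2 < (norm (snd b))\<^sup>2"
      using that(3) by (intro power_strict_mono) auto
    ultimately show False
      using a(2) b(2) by linarith
  qed
  show 2: "norm (snd z) = norm (snd z')"
    using *[OF assms] *[OF assms(2,1)] by (meson linorder_neqE)
  have "(norm (fst z))\<^sup>2 = (norm (fst z'))\<^sup>2"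
    using assms 2 unfolding orbit_def S3_iff by (smt (verit) mem_Collect_eq)
  then show "norm (fst z) = norm (fst z')"
    by simp
qed

lemma circle_action_norm: "norm \<rho> = 1 \<Longrightarrow> dist (circle_action p q \<rho> x) (circle_action p q \<rho> y) = dist x y"
  by (simp add: circle_action_def dist_prod_def dist_norm norm_mult norm_power flip: left_diff_distrib)

lemma circle_action_orbit:
  assumes "norm \<rho> = 1" "z \<in> orbit w"
  shows "circle_action p q \<rho> z \<in> orbit w"
proof -
  have "\<rho> \<noteq> 0" using assms(1) by auto
  then show ?thesis
    using assms unfolding orbit_def S3_iff by (auto simp: circle_action_def norm_mult norm_power
      power_mult_distrib mult.commute[of p q] simp flip: power_mult)
qed

text \<open>Coprimality enters here: if \<open>\<sigma>\<^sup>q = \<tau>\<^sup>p\<close> and \<open>x p + y q = 1\<close>, then \<open>\<rho> = \<sigma>\<^sup>x \<tau>\<^sup>y\<close> satisfies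
  \<open>\<rho>\<^sup>p = \<sigma>\<close> and \<open>\<rho>\<^sup>q = \<tau>\<close>.\<close>

lemma orbit_transitive:
  assumes "z \<in> orbit w" "z' \<in> orbit w" "w \<noteq> 0"
  obtains \<rho> where "norm \<rho> = 1" "z' = circle_action p q \<rho> z"
proof -
  have nz: "fst z \<noteq> 0" "snd z \<noteq> 0" "fst z' \<noteq> 0" "snd z' \<noteq> 0"
    using assms orbit_fst_nonzero by (auto simp: orbit_def)
  define \<sigma> where "\<sigma> = fst z' / fst z"
  define \<tau> where "\<tau> = snd z' / snd z"
  have n: "norm \<sigma> = 1" "norm \<tau> = 1"
    using orbit_norm_unique[OF assms(1,2)] nz by (auto simp: \<sigma>_def \<tau>_def norm_divide)
  then have st0: "\<sigma> \<noteq> 0" "\<tau> \<noteq> 0" by auto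
  have eq: "\<sigma> ^ q = \<tau> ^ p"
    using assms nz by (simp add: \<sigma>_def \<tau>_def orbit_def power_divide)
  obtain x y :: int where xy: "x * int p + y * int q = 1"
    using coprime_pq bezout_int[of "int p" "int q"] by (auto simp: coprime_iff_gcd_eq_1)
  define \<rho> where "\<rho> = \<sigma> powi x * \<tau> powi y"
  have eqi: "\<sigma> powi int q = \<tau> powi int p"
    using eq by simp
  have "\<rho> ^ p = \<sigma> powi (x * int p) * \<tau> powi (y * int p)"
    by (simp add: \<rho>_def power_mult_distrib power_int_mult)
  also have "\<tau> powi (y * int p) = \<sigma> powi (y * int q)"
    using eqi by (metis mult.commute power_int_mult)
  also have "\<sigma> powi (x * int p) * \<sigma> powi (y * int q) = \<sigma>"
    using xy st0 by (simp flip: power_int_add)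
  finally have 1: "\<rho> ^ p = \<sigma>" .
  have "\<rho> ^ q = \<sigma> powi (x * int q) * \<tau> powi (y * int q)"
    by (simp add: \<rho>_def power_mult_distrib power_int_mult)
  also have "\<sigma> powi (x * int q) = \<tau> powi (x * int p)"
    using eqi by (metis mult.commute power_int_mult)
  also have "\<tau> powi (x * int p) * \<tau> powi (y * int q) = \<tau>"
    using xy st0 by (simp flip: power_int_add)
  finally have 2: "\<rho> ^ q = \<tau>" .
  have "norm \<rho> = 1"
    using n by (simp add: \<rho>_def norm_mult norm_power_int)
  moreover have "z' = circle_action p q \<rho> z"
    using nz by (simp add: circle_action_def 1 2 \<sigma>_def \<tau>_def prod_eq_iff)
  ultimately show ?thesis using that by blast
qed

lemma orbit_eq_image:
  assumes "z \<in> orbit w" "w \<noteq> 0"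
  shows "orbit w = (\<lambda>\<rho>. circle_action p q \<rho> z) ` sphere 0 1"
proof (intro equalityI subsetI)
  fix z' assume "z' \<in> orbit w"
  then obtain \<rho> where "norm \<rho> = 1" "z' = circle_action p q \<rho> z"
    using orbit_transitive[OF assms(1) _ assms(2)] by blast
  then show "z' \<in> (\<lambda>\<rho>. circle_action p q \<rho> z) ` sphere 0 1" by simp
qed (use circle_action_orbit[OF _ assms(1)] in auto)

lemma
  assumes "w \<noteq> 0"
  shows compact_orbit: "compact (orbit w)" and connected_orbit: "connected (orbit w)"
proof -
  obtain z where z: "z \<in> orbit w"
    using orbit_nonempty by blast
  have c: "continuous_on (sphere 0 1) (\<lambda>\<rho>. circle_action p q \<rho> z)"
    unfolding circle_action_def by (intro continuous_intros)
  show "compact (orbit w)"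
    unfolding orbit_eq_image[OF z assms] by (intro compact_continuous_image c compact_sphere)
  show "connected (orbit w)"
    unfolding orbit_eq_image[OF z assms] by (intro connected_continuous_image c connected_sphere) simp
qed

text \<open>Each orbit is connected, and it is disjoint from the union of the others, both sets
  being closed.\<close>

lemma components_Union_orbits:
  assumes "finite R" "0 \<notin> R"
  shows "components (\<Union>w\<in>R. orbit w) = orbit ` R"
proof -
  let ?K = "\<Union>w\<in>R. orbit w"
  have comp: "orbit w \<in> components ?K" if w: "w \<in> R" for w
  proof -
    let ?O = "\<Union>v\<in>R - {w}. orbit v"
    have w0: "w \<noteq> 0" using w assms by auto
    have cl: "closed ?O" "closed (orbit w)"
      using assms w0 by (auto intro!: closed_UN compact_imp_closed compact_orbit)
    have K: "?K = orbit w \<union> ?O" "orbit w \<inter> ?O = {}"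
      using w orbit_disjoint by blast+
    show ?thesis
      unfolding in_components_maximal
    proof (intro conjI allI impI)
      show "orbit w \<noteq> {}" "orbit w \<subseteq> ?K" "connected (orbit w)"
        using orbit_nonempty w connected_orbit[OF w0] by auto
      fix D assume D: "D \<noteq> {} \<and> orbit w \<subseteq> D \<and> D \<subseteq> ?K \<and> connected D"
      then have "orbit w \<inter> D = {} \<or> ?O \<inter> D = {}"
        using K by (intro connected_closedD[of D]) (use cl in auto)
      then show "D = orbit w"
        using D K orbit_nonempty[of w] by blast
    qed
  qed
  show ?thesis
  proof (intro equalityI subsetI)
    fix C assume C: "C \<in> components ?K"
    then obtain x where x: "x \<in> C"
      using in_components_nonempty by blast
    then obtain w where w: "w \<in> R" "x \<in> orbit w"
      using in_components_subset[OF C] by blast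
    then have "C = orbit w"
      using components_eq[OF C comp[OF w(1)]] x by blast
    then show "C \<in> orbit ` R" using w by blast
  qed (use comp in blast)
qed

lemma inj_orbit: "inj orbit"
  using orbit_nonempty orbit_disjoint by (metis injI inf.idem)

text \<open>Outside an \<open>e\<close>-neighbourhood of \<open>orbit c\<close> the continuous
  function \<open>h\<close> has a positive minimum, whereas on \<open>orbit v\<close> it is at most
  \<open>norm (v - c)\<close>; so nearby orbits lie in the neighbourhood. For the converse inclusion
  one close pair of points is enough: the circle acts by isometries and transitively on
  \<open>orbit c\<close>.\<close>

lemma orbits_tendto:
  assumes w: "(w \<longlongrightarrow> c) F" and c: "c \<noteq> 0"
  shows "sets_tendto (\<lambda>t. orbit (w t)) (orbit c) F"
  unfolding sets_tendto_def
proof (intro allI impI)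
  fix e :: real assume e: "e > 0"
  define Q where "Q = S3 - (\<Union>y\<in>orbit c. ball y e)"
  have "compact Q"
    unfolding Q_def by (intro compact_diff) auto
  define h where "h z = norm (fst z ^ q - c * snd z ^ p)" for z :: c2
  have h0: "h z \<noteq> 0" if "z \<in> Q" for z
  proof
    assume "h z = 0"
    then have eq: "fst z ^ q = c * snd z ^ p" by (simp add: h_def)
    have "z \<in> S3" using that by (simp add: Q_def)
    moreover have "snd z \<noteq> 0"
    proof
      assume "snd z = 0"
      with eq \<open>z \<in> S3\<close> show False
        using p_pos q_pos by (simp add: norm_c2_eq_1 zero_power)
    qed
    ultimately have "z \<in> orbit c" using eq by (simp add: orbit_def)
    then show False using that e by (auto simp: Q_def)
  qed
  obtain \<eta> where \<eta>: "\<eta> > 0" "\<And>z. z \<in> Q \<Longrightarrow> \<eta> \<le> h z"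
  proof (cases "Q = {}")
    case True
    then show ?thesis using that[of 1] by simp
  next
    case False
    have "continuous_on Q h"
      unfolding h_def by (intro continuous_intros)
    then obtain z0 where "z0 \<in> Q" "\<And>z. z \<in> Q \<Longrightarrow> h z0 \<le> h z"
      using continuous_attains_inf[OF \<open>compact Q\<close> False] by blast
    then show ?thesis
      using that[of "h z0"] h0[of z0] by (simp add: h_def)
  qed
  have near: "\<exists>y\<in>orbit c. dist x y < e" if "x \<in> orbit v" "dist v c < \<eta>" for x v
  proof (rule ccontr)
    assume "\<not> ?thesis"
    then have "x \<in> Q"
      using that(1) by (auto simp: Q_def orbit_def dist_commute)
    have xn: "(norm (fst x))\<^sup>2 + (norm (snd x))\<^sup>2 = 1"
      using that(1) unfolding orbit_def S3_iff by blast
    have "norm (snd x) \<le> 1"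
    proof (rule power2_le_imp_le)
      show "(norm (snd x))\<^sup>2 \<le> 1\<^sup>2"
        using xn zero_le_power2[of "norm (fst x)"] unfolding power_one by linarith
    qed simp
    then have "norm (snd x) ^ p \<le> 1"
      by (simp add: power_le_one)
    have "h x = norm ((v - c) * snd x ^ p)"
      using that(1) by (simp add: h_def orbit_def algebra_simps)
    also have "\<dots> = norm (v - c) * norm (snd x) ^ p"
      by (simp add: norm_mult norm_power)
    also have "\<dots> \<le> norm (v - c)"
      using \<open>norm (snd x) ^ p \<le> 1\<close> by (simp add: mult_left_le)
    also have "\<dots> < \<eta>" using that(2) by (simp add: dist_norm)
    finally show False using \<eta>(2)[OF \<open>x \<in> Q\<close>] by simp
  qed
  have near': "\<exists>x\<in>orbit v. dist x y < e" if y: "y \<in> orbit c" "dist v c < \<eta>" for y v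
  proof -
    obtain x0 where x0: "x0 \<in> orbit v" using orbit_nonempty by blast
    then obtain y0 where y0: "y0 \<in> orbit c" "dist x0 y0 < e"
      using near[OF x0 y(2)] by blast
    obtain \<rho> where r: "norm \<rho> = 1" "y = circle_action p q \<rho> y0"
      using orbit_transitive[OF y0(1) y(1) c] .
    have "dist (circle_action p q \<rho> x0) y < e"
      using y0 r by (simp add: circle_action_norm)
    then show ?thesis
      using circle_action_orbit[OF r(1) x0] by blast
  qed
  have "\<forall>\<^sub>F t in F. dist (w t) c < \<eta>"
    using w \<eta>(1) by (simp add: tendsto_iff)
  then show "\<forall>\<^sub>F t in F. (\<forall>x\<in>orbit (w t). \<exists>y\<in>orbit c. dist x y < e) \<and>
      (\<forall>y\<in>orbit c. \<exists>x\<in>orbit (w t). dist x y < e)"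
    by eventually_elim (use near near' in blast)
qed

end

subsection \<open>Mixed polynomials as sections over the projective line\<close>

lemma mixed_eval_superset:
  assumes "finite S" "Poly_Mapping.keys f \<subseteq> S"
  shows "mixed_eval f z = (\<Sum>((n1, n2), (m1, m2)) \<in> S.
        Poly_Mapping.lookup f ((n1, n2), (m1, m2))
        * fst z ^ n1 * snd z ^ n2 * cnj (fst z) ^ m1 * cnj (snd z) ^ m2)"
  unfolding mixed_eval_def
  by (rule sum.mono_neutral_left) (use assms in \<open>auto simp: in_keys_iff\<close>)

definition sesqui :: "nat \<Rightarrow> nat \<Rightarrow> (nat \<Rightarrow> nat \<Rightarrow> complex) \<Rightarrow> complex \<Rightarrow> complex" where
  "sesqui n m c w = (\<Sum>(i, k) \<in> {..n} \<times> {..m}. c i k * w ^ i * cnj w ^ k)"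

text \<open>\<open>A\<close> and \<open>B\<close> are the derivatives with respect to
  \<open>w\<close> and \<open>cnj w\<close>.\<close>

definition wirtinger :: "(complex \<Rightarrow> complex) \<Rightarrow> complex \<Rightarrow> complex \<Rightarrow> complex \<Rightarrow> bool" where
  "wirtinger f w A B \<longleftrightarrow> (f has_derivative (\<lambda>h. A * h + B * cnj h)) (at w)"

lemma sesqui_0: "sesqui n m c 0 = c 0 0"
proof -
  have "sesqui n m c 0 = (\<Sum>x \<in> {..n} \<times> {..m}. if x = (0, 0) then c 0 0 else 0)"
    unfolding sesqui_def by (intro sum.cong) (auto simp: power_0_left split: if_splits)
  then show ?thesis by (simp add: sum.delta)
qed

lemma sesqui_wirtinger: "\<exists>A B. wirtinger (sesqui n m c) w A B"
proof -
  have *: "((\<lambda>w. c i k * w ^ i * cnj w ^ k) has_derivative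
     (\<lambda>h. (c i k * of_nat i * w ^ (i - Suc 0) * cnj w ^ k) * h
        + (c i k * of_nat k * w ^ i * cnj w ^ (k - Suc 0)) * cnj h)) (at w)" for i k
    by (auto intro!: derivative_eq_intros bounded_linear.has_derivative[OF bounded_linear_cnj]
        simp: algebra_simps)
  show ?thesis
    unfolding wirtinger_def sesqui_def
    by (rule exI[of _ "\<Sum>(i, k) \<in> {..n} \<times> {..m}. c i k * of_nat i * w ^ (i - Suc 0) * cnj w ^ k"],
        rule exI[of _ "\<Sum>(i, k) \<in> {..n} \<times> {..m}. c i k * of_nat k * w ^ i * cnj w ^ (k - Suc 0)"],
        rule has_derivative_eq_rhs, rule has_derivative_sum[where
          f' = "\<lambda>(i, k) h. (c i k * of_nat i * w ^ (i - Suc 0) * cnj w ^ k) * h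
        + (c i k * of_nat k * w ^ i * cnj w ^ (k - Suc 0)) * cnj h"])
      (auto simp: * sum_distrib_right sum.distrib case_prod_unfold)
qed

text \<open>The derivative grows at least like \<open>\<bar>norm A - norm B\<bar> * norm h\<close>,
  and near \<open>w\<close> the error of linear approximation is at most half of that.\<close>

lemma wirtinger_isolated_zero:
  assumes "wirtinger f w A B" "norm A \<noteq> norm B" "f w = 0"
  shows "\<not> w islimpt {v. f v = 0}"
proof -
  have der: "(f has_derivative (\<lambda>h. A * h + B * cnj h)) (at w)"
    using assms(1) by (simp add: wirtinger_def)
  define e where "e = \<bar>norm A - norm B\<bar> / 2"
  have e: "e > 0" using assms(2) by (simp add: e_def)
  obtain d where d: "d > 0" "\<And>v. norm (v - w) < d \<Longrightarrow>
      norm (f v - f w - (A * (v - w) + B * cnj (v - w))) \<le> e * norm (v - w)"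
    using der e unfolding has_derivative_at_alt by metis
  have "f v \<noteq> 0" if v: "v \<noteq> w" "norm (v - w) < d" for v
  proof
    assume "f v = 0"
    then have "norm (A * (v - w) + B * cnj (v - w)) \<le> e * norm (v - w)"
      using d(2)[OF v(2)] assms(3) by (simp only: diff_self diff_0 norm_minus_cancel)
    moreover have "2 * e * norm (v - w) \<le> norm (A * (v - w) + B * cnj (v - w))"
      using wirtinger_lower_bound[of A B "v - w"] unfolding e_def by (simp del: complex_cnj_diff)
    ultimately have "2 * e * norm (v - w) \<le> e * norm (v - w)"
      by (rule order_trans[rotated])
    then show False using e v(1) by simp
  qed
  then show ?thesis
    unfolding islimpt_approachable using d(1) by (auto simp: dist_norm)
qed

section \<open>Two-variable mixed polynomials built from one-variable coefficients, and the normal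
  form\<close>

context weights
begin

text \<open>The exponents left when \<open>w = z1^q / z2^p\<close> is substituted into
  \<open>w^i * cnj w^k\<close> and the denominators are cleared with \<open>z2^(p*n)\<close> and
  \<open>cnj z2^(p*m)\<close>.\<close>

definition hom_key :: "nat \<Rightarrow> nat \<Rightarrow> nat \<times> nat \<Rightarrow> (nat \<times> nat) \<times> (nat \<times> nat)" where
  "hom_key n m = (\<lambda>(i, k). ((q * i, p * (n - i)), (q * k, p * (m - k))))"

definition hom_poly :: "nat \<Rightarrow> nat \<Rightarrow> (nat \<Rightarrow> nat \<Rightarrow> complex) \<Rightarrow> mixed_poly" where
  "hom_poly n m c = (\<Sum>(i, k) \<in> {..n} \<times> {..m}. Poly_Mapping.single (hom_key n m (i, k)) (c i k))"

lemma inj_hom_key: "inj (hom_key n m)"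
  using q_pos by (auto simp: hom_key_def inj_on_def)

lemma lookup_hom_poly:
  "Poly_Mapping.lookup (hom_poly n m c) x
    = (\<Sum>(i, k) \<in> {..n} \<times> {..m}. if hom_key n m (i, k) = x then c i k else 0)"
  unfolding hom_poly_def by (simp add: lookup_sum lookup_single when_def case_prod_unfold)

lemma lookup_hom_poly_key:
  assumes "i \<le> n" "k \<le> m"
  shows "Poly_Mapping.lookup (hom_poly n m c) (hom_key n m (i, k)) = c i k"
proof -
  have "Poly_Mapping.lookup (hom_poly n m c) (hom_key n m (i, k))
      = (\<Sum>x \<in> {..n} \<times> {..m}. if x = (i, k) then c i k else 0)"
    unfolding lookup_hom_poly using inj_hom_key by (intro sum.cong) (auto simp: inj_eq split: if_splits)
  then show ?thesis using assms by (simp add: sum.delta)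
qed

lemma lookup_hom_poly_notin:
  "x \<notin> hom_key n m ` ({..n} \<times> {..m}) \<Longrightarrow> Poly_Mapping.lookup (hom_poly n m c) x = 0"
  unfolding lookup_hom_poly by (intro sum.neutral) auto

lemma keys_hom_poly: "Poly_Mapping.keys (hom_poly n m c) \<subseteq> hom_key n m ` ({..n} \<times> {..m})"
proof
  fix x assume "x \<in> Poly_Mapping.keys (hom_poly n m c)"
  then show "x \<in> hom_key n m ` ({..n} \<times> {..m})"
    using lookup_hom_poly_notin[of x n m c] in_keys_iff[of x] by metis
qed

lemma mixed_eval_hom_poly:
  "mixed_eval (hom_poly n m c) z = (\<Sum>(i, k) \<in> {..n} \<times> {..m}.
     c i k * fst z ^ (q * i) * snd z ^ (p * (n - i)) * cnj (fst z) ^ (q * k) * cnj (snd z) ^ (p * (m - k)))"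
proof -
  have "mixed_eval (hom_poly n m c) z = (\<Sum>((n1, n2), (m1, m2)) \<in> hom_key n m ` ({..n} \<times> {..m}).
        Poly_Mapping.lookup (hom_poly n m c) ((n1, n2), (m1, m2))
        * fst z ^ n1 * snd z ^ n2 * cnj (fst z) ^ m1 * cnj (snd z) ^ m2)"
    by (rule mixed_eval_superset) (use keys_hom_poly in auto)
  also have "\<dots> = (\<Sum>(i, k) \<in> {..n} \<times> {..m}. c i k * fst z ^ (q * i) * snd z ^ (p * (n - i))
      * cnj (fst z) ^ (q * k) * cnj (snd z) ^ (p * (m - k)))"
    by (subst sum.reindex[OF inj_on_subset[OF inj_hom_key subset_UNIV]])
       (auto intro!: sum.cong simp: lookup_hom_poly_key[unfolded hom_key_def, simplified] hom_key_def)
  finally show ?thesis .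
qed

lemma mixed_eval_hom_poly_slice:
  assumes "snd z \<noteq> 0"
  shows "mixed_eval (hom_poly n m c) z
    = snd z ^ (p * n) * cnj (snd z) ^ (p * m) * sesqui n m c (fst z ^ q / snd z ^ p)"
proof -
  have *: "c i k * fst z ^ (q * i) * snd z ^ (p * (n - i)) * cnj (fst z) ^ (q * k) * cnj (snd z) ^ (p * (m - k))
    = snd z ^ (p * n) * cnj (snd z) ^ (p * m) *
      (c i k * (fst z ^ q / snd z ^ p) ^ i * cnj (fst z ^ q / snd z ^ p) ^ k)"
    if ik: "i \<le> n" "k \<le> m" for i k
  proof -
    have "p * n = p * (n - i) + p * i" "p * m = p * (m - k) + p * k"
      using ik by (simp_all flip: distrib_left)
    then have "snd z ^ (p * n) = snd z ^ (p * (n - i)) * (snd z ^ p) ^ i"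
      "cnj (snd z) ^ (p * m) = cnj (snd z) ^ (p * (m - k)) * (cnj (snd z) ^ p) ^ k"
      by (metis power_add power_mult)+
    then show ?thesis
      using assms by (simp add: power_divide power_mult)
  qed
  show ?thesis
    unfolding mixed_eval_hom_poly sesqui_def sum_distrib_left
  proof (rule sum.cong[OF refl], goal_cases)
    case (1 x)
    then obtain i k where "x = (i, k)" "i \<le> n" "k \<le> m" by auto
    then show ?case using *[of i k] by (simp only: case_prod_conv)
  qed
qed

text \<open>This is the value over infinity: only the term with neither \<open>snd z\<close> nor its
  conjugate survives. Hence \<open>c n m \<noteq> 0\<close> keeps that orbit off the link.\<close>

lemma mixed_eval_hom_poly_axis:
  assumes "snd z = 0"
  shows "mixed_eval (hom_poly n m c) z = c n m * fst z ^ (q * n) * cnj (fst z) ^ (q * m)"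
proof -
  have "mixed_eval (hom_poly n m c) z = (\<Sum>x \<in> {..n} \<times> {..m}.
      if x = (n, m) then c n m * fst z ^ (q * n) * cnj (fst z) ^ (q * m) else 0)"
    unfolding mixed_eval_hom_poly using assms p_pos by (intro sum.cong) (auto simp: power_0_left split: if_splits)
  then show ?thesis by (simp add: sum.delta)
qed

lemma strongly_polar_hom_poly:
  assumes "n = m + d"
  shows "strongly_polar_wh p q (int (p * q * (n + m))) (int (d * p * q)) (hom_poly n m c)"
proof -
  have "int p * (int (q * i) + int (q * k)) + int q * (int (p * (n - i)) + int (p * (m - k))) = int (p * q * (n + m)) \<and>
      int p * (int (q * i) - int (q * k)) + int q * (int (p * (n - i)) - int (p * (m - k))) = int (d * p * q)"
    if ik: "i \<le> n" "k \<le> m" for i k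
  proof -
    obtain i' where i': "n = i + i'"
      using le_Suc_ex[OF ik(1)] by blast
    obtain k' where k': "m = k + k'"
      using le_Suc_ex[OF ik(2)] by blast
    then have i: "int i = int k + int k' + int d - int i'"
      using assms i' k' by linarith
    show ?thesis
      unfolding i' k' by (simp add: i algebra_simps)
  qed
  moreover have "\<exists>i k. i \<le> n \<and> k \<le> m \<and> n1 = q * i \<and> n2 = p * (n - i) \<and> m1 = q * k \<and> m2 = p * (m - k)"
    if "((n1, n2), (m1, m2)) \<in> Poly_Mapping.keys (hom_poly n m c)" for n1 n2 m1 m2
    using subsetD[OF keys_hom_poly that] by (auto simp: hom_key_def)
  ultimately show ?thesis
    unfolding strongly_polar_wh_def by blast
qed

lemma convenient_hom_poly:
  assumes "c n m \<noteq> 0" "c 0 0 \<noteq> 0"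
  shows "convenient (hom_poly n m c)"
proof -
  have "hom_key n m (n, m) \<in> Poly_Mapping.keys (hom_poly n m c)"
       "hom_key n m (0, 0) \<in> Poly_Mapping.keys (hom_poly n m c)"
    using assms by (auto simp: in_keys_iff lookup_hom_poly_key)
  then show ?thesis
    unfolding convenient_def hom_key_def by auto
qed

text \<open>Coprimality turns \<open>q dvd p * x\<close> into \<open>q dvd x\<close>.\<close>

lemma weighted_degree_split:
  assumes "p * x + q * y = p * q * n"
  obtains i where "i \<le> n" "x = q * i" "y = p * (n - i)"
proof -
  have "q dvd p * x"
    using assms by (metis dvd_add_left_iff dvd_mult dvd_mult2 dvd_triv_left dvd_triv_right)
  then have "q dvd x"
    using coprime_pq by (simp add: coprime_commute coprime_dvd_mult_right_iff)
  then obtain i where i: "x = q * i" by blast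
  have "q * (p * i + y) = q * (p * n)"
    using assms i by (simp add: algebra_simps)
  then have y: "p * i + y = p * n" using q_pos by simp
  then have "p * i \<le> p * n" by linarith
  then have "i \<le> n" using p_pos by simp
  moreover have "y = p * (n - i)"
    using y by (simp add: right_diff_distrib')
  ultimately show ?thesis using that i by blast
qed

text \<open>Half the sum and half the difference of the two degree equations fix the weight in
  \<open>z\<close> and the weight in the conjugates separately. Convenience supplies a pure power of
  each variable, which makes both weights multiples of \<open>p * q\<close>;
  \<open>weighted_degree_split\<close> then lists all possible monomials.\<close>

lemma polar_poly_normal_form:
  assumes polar: "strongly_polar_wh p q dr (int (d * p * q)) f" and conv: "convenient f"
  obtains n m c where "f = hom_poly n m c" "n = m + d" "c n m \<noteq> 0" "c 0 0 \<noteq> 0"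
proof -
  obtain a b a' b' where k: "((a, 0), (b, 0)) \<in> Poly_Mapping.keys f" "((0, a'), (0, b')) \<in> Poly_Mapping.keys f"
    using conv unfolding convenient_def by blast
  have e: "int p * (int n1 + int m1) + int q * (int n2 + int m2) = dr"
      "int p * (int n1 - int m1) + int q * (int n2 - int m2) = int (d * p * q)"
    if "((n1, n2), (m1, m2)) \<in> Poly_Mapping.keys f" for n1 n2 m1 m2
    using polar that unfolding strongly_polar_wh_def by blast+
  have h: "2 * int (p * n1 + q * n2) = dr + int (d * p * q)" "2 * int (p * m1 + q * m2) = dr - int (d * p * q)"
    if "((n1, n2), (m1, m2)) \<in> Poly_Mapping.keys f" for n1 n2 m1 m2
    using e[OF that] by (simp_all add: algebra_simps)
  \<comment> \<open>The pure monomials in \<open>z1\<close> and in \<open>z2\<close> have equal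
    weights, in the variables and in their conjugates.\<close>
  have ab: "int (p * a) = int (q * a')" "int (p * b) = int (q * b')"
    using h[OF k(1)] h[OF k(2)] by simp_all
  have "q dvd p * a" "q dvd p * b"
    using ab by (metis dvd_triv_left of_nat_eq_iff)+
  then have "q dvd a" "q dvd b"
    using coprime_pq by (simp_all add: coprime_commute coprime_dvd_mult_right_iff)
  then obtain n m where nm: "a = q * n" "b = q * m" by blast
  have keys: "p * n1 + q * n2 = p * q * n \<and> p * m1 + q * m2 = p * q * m"
    if "((n1, n2), (m1, m2)) \<in> Poly_Mapping.keys f" for n1 n2 m1 m2
  proof -
    have "int (p * n1 + q * n2) = int (p * q * n)" "int (p * m1 + q * m2) = int (p * q * m)"
      using h[OF that] h[OF k(1)] nm by (simp_all add: mult.assoc)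
    then show ?thesis by (metis of_nat_eq_iff)
  qed
  have "int (p * q) * (int n - int m) = int (p * q) * int d"
    using e(2)[OF k(1)] nm by (simp add: algebra_simps)
  then have "int n - int m = int d" using p_pos q_pos by simp
  then have nmd: "n = m + d" by linarith
  have im: "x \<in> hom_key n m ` ({..n} \<times> {..m})" if "x \<in> Poly_Mapping.keys f" for x
  proof -
    obtain n1 n2 m1 m2 where x: "x = ((n1, n2), (m1, m2))" by (metis surj_pair)
    from keys that x have s: "p * n1 + q * n2 = p * q * n" "p * m1 + q * m2 = p * q * m" by auto
    obtain i where i: "i \<le> n" "n1 = q * i" "n2 = p * (n - i)" using weighted_degree_split[OF s(1)] .
    obtain j where j: "j \<le> m" "m1 = q * j" "m2 = p * (m - j)" using weighted_degree_split[OF s(2)] .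
    show ?thesis using x i j by (force simp: hom_key_def)
  qed
  define c where "c i k = Poly_Mapping.lookup f (hom_key n m (i, k))" for i k
  have "f = hom_poly n m c"
  proof (rule poly_mapping_eqI)
    fix x
    show "Poly_Mapping.lookup f x = Poly_Mapping.lookup (hom_poly n m c) x"
    proof (cases "x \<in> hom_key n m ` ({..n} \<times> {..m})")
      case True
      then show ?thesis by (auto simp: lookup_hom_poly_key c_def)
    next
      case False
      then show ?thesis
        using im[of x] by (metis in_keys_iff lookup_hom_poly_notin)
    qed
  qed
  moreover have "c n m \<noteq> 0"
    using k(1) nm by (simp add: c_def hom_key_def in_keys_iff)
  moreover have "c 0 0 \<noteq> 0"
  proof -
    from keys[OF k(2)] have "q * a' = q * (p * n)" "q * b' = q * (p * m)"
      by (simp_all add: mult_ac)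
    then show ?thesis
      using k(2) q_pos by (simp add: c_def hom_key_def in_keys_iff)
  qed
  ultimately show ?thesis using that nmd by blast
qed

text \<open>At a zero of \<Phi> the derivative of the prefactor drops out of the product rule,
  leaving the chain rule up to the unit \<open>u\<close>. The time variable is carried along so that
  the same computation serves single links and total spaces of families.\<close>

lemma slice_derivative:
  fixes g :: "c2 \<times> real \<Rightarrow> complex" and \<Phi> :: "complex \<times> real \<Rightarrow> complex"
  assumes g: "\<And>z t. snd z \<noteq> 0 \<Longrightarrow> g (z, t) = snd z ^ N * cnj (snd z) ^ M * \<Phi> (fst z ^ q / snd z ^ p, t)"
    and nz: "fst z \<noteq> 0" "snd z \<noteq> 0" and zero: "\<Phi> (fst z ^ q / snd z ^ p, t) = 0"
    and der: "(\<Phi> has_derivative (\<lambda>(h, s). A * h + B * cnj h + of_real s * D)) (at (fst z ^ q / snd z ^ p, t))"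
  obtains u \<kappa> where "u \<noteq> 0" "\<kappa> \<noteq> 0"
    "(g has_derivative (\<lambda>(v, s). u * (A * (\<kappa> * transverse_coord z v) + B * cnj (\<kappa> * transverse_coord z v)
        + of_real s * D))) (at (z, t))"
proof -
  define w where "w = fst z ^ q / snd z ^ p"
  \<comment> \<open>From the logarithmic derivative
    \<open>dw / w = q dz1 / z1 - p dz2 / z2\<close>.\<close>
  define \<kappa> where "\<kappa> = w / (fst z * snd z)"
  define u where "u = snd z ^ N * cnj (snd z) ^ M"
  define U where "U x = snd (fst x) ^ N * cnj (snd (fst x)) ^ M" for x :: "c2 \<times> real"
  have d1: "((\<lambda>x. snd (fst x)) has_derivative (\<lambda>x. snd (fst x))) (at (z, t))"
    by (intro has_derivative_snd has_derivative_fst has_derivative_ident)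
  have d2: "((\<lambda>x. cnj (snd (fst x))) has_derivative (\<lambda>x. cnj (snd (fst x)))) (at (z, t))"
    by (rule bounded_linear.has_derivative[OF bounded_linear_cnj d1])
  obtain U' where U': "(U has_derivative U') (at (z, t))"
    using has_derivative_mult[OF has_derivative_power[OF d1] has_derivative_power[OF d2]]
    unfolding U_def by blast
  have q1: "fst z ^ q = fst z ^ (q - 1) * fst z" and p1: "snd z ^ p = snd z ^ (p - 1) * snd z"
    using p_pos q_pos by (metis power_minus_mult)+
  have "((\<lambda>x. fst (fst x) ^ q / snd (fst x) ^ p) has_derivative
      (\<lambda>x. \<kappa> * transverse_coord z (fst x))) (at (z, t))"
    using nz
    by (auto intro!: derivative_eq_intros simp: fun_eq_iff \<kappa>_def w_def transverse_coord_def q1 p1 field_simps)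
  then have "((\<lambda>x. (fst (fst x) ^ q / snd (fst x) ^ p, snd x)) has_derivative
      (\<lambda>x. (\<kappa> * transverse_coord z (fst x), snd x))) (at (z, t))"
    by (intro has_derivative_Pair has_derivative_snd has_derivative_ident)
  moreover have "(\<Phi> has_derivative (\<lambda>(h, s). A * h + B * cnj h + of_real s * D))
      (at ((\<lambda>x. (fst (fst x) ^ q / snd (fst x) ^ p, snd x)) (z, t)))"
    using der by simp
  ultimately have "((\<lambda>x. \<Phi> (fst (fst x) ^ q / snd (fst x) ^ p, snd x)) has_derivative
      (\<lambda>x. A * (\<kappa> * transverse_coord z (fst x)) + B * cnj (\<kappa> * transverse_coord z (fst x)) + of_real (snd x) * D)) (at (z, t))"
    by (auto dest: diff_chain_at simp: o_def case_prod_unfold)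
  from has_derivative_mult[OF U' this]
  have "((\<lambda>x. U x * \<Phi> (fst (fst x) ^ q / snd (fst x) ^ p, snd x)) has_derivative
      (\<lambda>(v, s). u * (A * (\<kappa> * transverse_coord z v) + B * cnj (\<kappa> * transverse_coord z v)
        + of_real s * D))) (at (z, t))"
    using zero by (simp add: case_prod_unfold U_def u_def)
  then have "(g has_derivative (\<lambda>(v, s). u * (A * (\<kappa> * transverse_coord z v) + B * cnj (\<kappa> * transverse_coord z v)
        + of_real s * D))) (at (z, t))"
  proof (rule has_derivative_transform_within_open)
    show "open {x :: c2 \<times> real. snd (fst x) \<noteq> 0}"
      by (intro open_Collect_neq continuous_intros)
  qed (use nz g in \<open>auto simp: U_def\<close>)
  moreover have "u \<noteq> 0" "\<kappa> \<noteq> 0"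
    using nz by (auto simp: u_def \<kappa>_def w_def)
  ultimately show ?thesis using that by blast
qed

end

subsection \<open>Links of signed orbits\<close>

context weights
begin

text \<open>The factor \<open>s\<close> is present because \<open>oriented_zero_link\<close>
  contains every positive multiple of an admissible tangent vector.\<close>

definition orbit_link :: "complex set \<Rightarrow> complex set \<Rightarrow> oriented_link" where
  "orbit_link P N = {(z, s *\<^sub>R orbit_velocity p q z) | z s w.
     z \<in> orbit w \<and> (w \<in> P \<and> s > 0 \<or> w \<in> N \<and> s < 0)}"

lemma velocity_nonzero: "z \<in> S3 \<Longrightarrow> orbit_velocity p q z \<noteq> 0"
  using p_pos q_pos by (auto simp: orbit_velocity_eq norm_c2_eq_1 prod_eq_iff)

lemma orbit_link_mem:
  assumes "P \<inter> N = {}" "z \<in> orbit w" "s \<noteq> 0"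
  shows "(z, s *\<^sub>R orbit_velocity p q z) \<in> orbit_link P N \<longleftrightarrow> (w \<in> P \<and> s > 0 \<or> w \<in> N \<and> s < 0)"
proof
  assume "(z, s *\<^sub>R orbit_velocity p q z) \<in> orbit_link P N"
  then obtain s' w' where w': "s *\<^sub>R orbit_velocity p q z = s' *\<^sub>R orbit_velocity p q z"
      "z \<in> orbit w'" "w' \<in> P \<and> s' > 0 \<or> w' \<in> N \<and> s' < 0"
    unfolding orbit_link_def by blast
  have "z \<in> S3" using assms(2) by (simp add: orbit_def)
  then have "s = s'" using w'(1) velocity_nonzero by (metis scaleR_right_imp_eq)
  moreover have "w = w'" using w'(2) assms(2) orbit_disjoint by blast
  ultimately show "w \<in> P \<and> s > 0 \<or> w \<in> N \<and> s < 0" using w' by blast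
next
  assume "w \<in> P \<and> s > 0 \<or> w \<in> N \<and> s < 0"
  then show "(z, s *\<^sub>R orbit_velocity p q z) \<in> orbit_link P N"
    unfolding orbit_link_def using assms(2) by blast
qed

lemma positively_oriented_orbit:
  assumes "P \<inter> N = {}" shows "positively_oriented p q (orbit_link P N) (orbit w) \<longleftrightarrow> w \<in> P"
  using orbit_nonempty[of w] orbit_link_mem[OF assms, of _ w 1]
  unfolding positively_oriented_def by auto

lemma negatively_oriented_orbit:
  assumes "P \<inter> N = {}" shows "negatively_oriented p q (orbit_link P N) (orbit w) \<longleftrightarrow> w \<in> N"
  using orbit_nonempty[of w] orbit_link_mem[OF assms, of _ w "-1"]
  unfolding negatively_oriented_def by auto

lemma fst_orbit_link: "fst ` orbit_link P N = (\<Union>w\<in>P \<union> N. orbit w)"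
proof (intro equalityI subsetI)
  fix z assume "z \<in> (\<Union>w\<in>P \<union> N. orbit w)"
  then obtain w where w: "z \<in> orbit w" "w \<in> P \<union> N" by blast
  then have "(z, (if w \<in> P then 1 else -1) *\<^sub>R orbit_velocity p q z) \<in> orbit_link P N"
    unfolding orbit_link_def by (intro CollectI exI[of _ w] exI[of _ z] exI[of _ "if w \<in> P then 1 else -1"]) auto
  then show "z \<in> fst ` orbit_link P N"
    by (metis fst_conv image_eqI)
qed (auto simp: orbit_link_def)

section \<open>Signs of one-variable zeros and orientations of link components\<close>

definition signed_zeros :: "(complex \<Rightarrow> complex) \<Rightarrow> complex set \<Rightarrow> complex set \<Rightarrow> bool" where
  "signed_zeros f P N \<longleftrightarrow> {w. f w = 0} = P \<union> N \<and>
     (\<forall>w\<in>P. \<exists>A B. wirtinger f w A B \<and> norm A > norm B) \<and>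
     (\<forall>w\<in>N. \<exists>A B. wirtinger f w A B \<and> norm A < norm B)"

lemma wirtinger_unique:
  assumes "wirtinger f w A B" "wirtinger f w A' B'"
  shows "A = A'" "B = B'"
proof -
  have eq: "A * h + B * cnj h = A' * h + B' * cnj h" for h
    by (rule fun_cong[OF has_derivative_unique[OF assms[unfolded wirtinger_def]]])
  have s: "A + B = A' + B'"
    using eq[of 1] by simp
  have "(A - B) * \<i> = (A' - B') * \<i>"
    using eq[of \<i>] by (simp add: algebra_simps)
  then have d: "A - B = A' - B'"
    by simp
  have "2 * A = (A + B) + (A - B)"
    by simp
  also have "\<dots> = 2 * A'"
    unfolding s d by simp
  finally show "A = A'" by simp
  with s show "B = B'" by simp
qed

lemma signed_zeros_disjoint: "signed_zeros f P N \<Longrightarrow> P \<inter> N = {}"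
proof (rule ccontr)
  assume sz: "signed_zeros f P N" and "P \<inter> N \<noteq> {}"
  then obtain w where w: "w \<in> P" "w \<in> N" by blast
  obtain A B where AB: "wirtinger f w A B" "norm A > norm B"
    using sz w(1) unfolding signed_zeros_def by blast
  obtain A' B' where AB': "wirtinger f w A' B'" "norm A' < norm B'"
    using sz w(2) unfolding signed_zeros_def by blast
  show False
    using wirtinger_unique[OF AB(1) AB'(1)] AB(2) AB'(2) by simp
qed

lemma signed_zeros_norm:
  assumes "signed_zeros f P N" "f w = 0"
  shows "\<exists>A B. wirtinger f w A B \<and> norm A \<noteq> norm B"
proof -
  have "w \<in> P \<union> N" using assms unfolding signed_zeros_def by blast
  then obtain A B where "wirtinger f w A B" "norm A > norm B \<or> norm A < norm B"
    using assms(1) unfolding signed_zeros_def by blast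
  then show ?thesis by (intro exI[of _ A] exI[of _ B]) auto
qed

text \<open>The factors \<open>u\<close> and \<kappa> scale both moduli by the same positive number,
  so the sign of \<open>norm A - norm B\<close> carries over from one variable to two. The proof
  uses \<open>slice_derivative\<close> with a function constant in time.\<close>

lemma mixed_eval_derivative:
  assumes "wirtinger (sesqui n m c) (fst z ^ q / snd z ^ p) A B"
    and "fst z \<noteq> 0" "snd z \<noteq> 0" "sesqui n m c (fst z ^ q / snd z ^ p) = 0"
  shows "\<exists>A' B' l. l > 0 \<and> norm A' = l * norm A \<and> norm B' = l * norm B \<and>
    (mixed_eval (hom_poly n m c) has_derivative
       (\<lambda>v. A' * transverse_coord z v + B' * cnj (transverse_coord z v))) (at z)"
proof -
  define g :: "c2 \<times> real \<Rightarrow> complex" where "g x = mixed_eval (hom_poly n m c) (fst x)" for x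
  define \<Phi> :: "complex \<times> real \<Rightarrow> complex" where "\<Phi> x = sesqui n m c (fst x)" for x
  have der: "(\<Phi> has_derivative (\<lambda>(h, s). A * h + B * cnj h + of_real s * 0)) (at (fst z ^ q / snd z ^ p, 0))"
  proof -
    have "(fst has_derivative fst) (at (fst z ^ q / snd z ^ p, 0 :: real))"
      by (intro has_derivative_fst has_derivative_ident)
    moreover have "(sesqui n m c has_derivative (\<lambda>h. A * h + B * cnj h))
        (at (fst (fst z ^ q / snd z ^ p, 0 :: real)))"
      using assms(1) by (simp add: wirtinger_def)
    ultimately show ?thesis
      unfolding \<Phi>_def case_prod_unfold mult_zero_right add_0_right
      by (rule has_derivative_compose)
  qed
  have slice: "g (x, t) = snd x ^ (p * n) * cnj (snd x) ^ (p * m) * \<Phi> (fst x ^ q / snd x ^ p, t)"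
    if "snd x \<noteq> 0" for x t
    using mixed_eval_hom_poly_slice[OF that] by (simp add: g_def \<Phi>_def)
  have zero: "\<Phi> (fst z ^ q / snd z ^ p, 0) = 0"
    using assms(4) by (simp add: \<Phi>_def)
  obtain u \<kappa> where u: "u \<noteq> 0" "\<kappa> \<noteq> 0" and dg:
    "(g has_derivative (\<lambda>(v, s). u * (A * (\<kappa> * transverse_coord z v) + B * cnj (\<kappa> * transverse_coord z v)
        + of_real s * 0))) (at (z, 0))"
    using slice_derivative[of g, OF slice assms(2,3) zero der] by blast
  have "((\<lambda>z. g (z, 0)) has_derivative (\<lambda>v. u * (A * (\<kappa> * transverse_coord z v) + B * cnj (\<kappa> * transverse_coord z v)))) (at z)"
    using has_derivative_compose[OF has_derivative_Pair[OF has_derivative_ident has_derivative_const] dg]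
    by simp
  then have "(mixed_eval (hom_poly n m c) has_derivative
       (\<lambda>v. (u * A * \<kappa>) * transverse_coord z v + (u * B * cnj \<kappa>) * cnj (transverse_coord z v))) (at z)"
    unfolding g_def fst_conv complex_cnj_mult distrib_left mult.assoc .
  then show ?thesis
    using u by (intro exI[of _ "u * A * \<kappa>"] exI[of _ "u * B * cnj \<kappa>"] exI[of _ "norm u * norm \<kappa>"])
      (simp add: norm_mult)
qed

lemma sphere_zeros_hom_poly:
  assumes "c n m \<noteq> 0"
  shows "sphere_zeros (mixed_eval (hom_poly n m c)) = (\<Union>w\<in>{w. sesqui n m c w = 0}. orbit w)"
proof -
  have axis: "mixed_eval (hom_poly n m c) z \<noteq> 0" if "z \<in> S3" "snd z = 0" for z
    using that assms mixed_eval_hom_poly_axis[of z] q_pos by (auto simp: norm_c2_eq_1)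
  have "mixed_eval (hom_poly n m c) z = 0 \<longleftrightarrow> snd z \<noteq> 0 \<and> sesqui n m c (fst z ^ q / snd z ^ p) = 0"
    if "z \<in> S3" for z
    using axis[OF that] mixed_eval_hom_poly_slice[of z n m c] by (cases "snd z = 0") auto
  then show ?thesis
    unfolding sphere_zeros_def by (auto simp only: orbit_param)
qed

text \<open>The two coefficient conditions exclude infinity and 0 as zeros. So both coordinates are
  nonzero at every point of the link, and \<open>zero_link_fibre\<close> reads the orientation off
  the sign of the zero.\<close>

lemma link_of_signed_zeros:
  assumes c: "c n m \<noteq> 0" "c 0 0 \<noteq> 0" and sz: "signed_zeros (sesqui n m c) P N"
  shows "oriented_zero_link (mixed_eval (hom_poly n m c)) = orbit_link P N"
    and "transverse_on_S3 (mixed_eval (hom_poly n m c))"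
    and "non_degenerate (hom_poly n m c)"
proof -
  let ?g = "mixed_eval (hom_poly n m c)"
  have der: "\<exists>A B. (?g has_derivative (\<lambda>v. A * transverse_coord z v + B * cnj (transverse_coord z v))) (at z)
      \<and> norm A \<noteq> norm B \<and> (norm A - norm B > 0 \<longleftrightarrow> w \<in> P) \<and> (norm A - norm B < 0 \<longleftrightarrow> w \<in> N)"
    if z: "fst z \<noteq> 0" "snd z \<noteq> 0" "w = fst z ^ q / snd z ^ p" "sesqui n m c w = 0" for z w
  proof -
    have "w \<in> P \<union> N" "P \<inter> N = {}"
      using sz z signed_zeros_disjoint unfolding signed_zeros_def by blast+
    then obtain A B where AB: "wirtinger (sesqui n m c) w A B" "norm A \<noteq> norm B"
        "norm A > norm B \<longleftrightarrow> w \<in> P" "norm A < norm B \<longleftrightarrow> w \<in> N"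
      using sz unfolding signed_zeros_def by (metis Int_iff UnE empty_iff less_irrefl not_less_iff_gr_or_eq)
    obtain A' B' l where l: "l > 0" "norm A' = l * norm A" "norm B' = l * norm B"
      "(?g has_derivative (\<lambda>v. A' * transverse_coord z v + B' * cnj (transverse_coord z v))) (at z)"
      using mixed_eval_derivative[OF AB(1)[unfolded z(3)] z(1,2) z(4)[unfolded z(3)]] by blast
    then have "norm A' - norm B' = l * (norm A - norm B)"
      by (simp add: algebra_simps)
    then have "norm A' \<noteq> norm B' \<and> (norm A' - norm B' > 0 \<longleftrightarrow> w \<in> P) \<and> (norm A' - norm B' < 0 \<longleftrightarrow> w \<in> N)"
      using AB l(1) by (auto simp: zero_less_mult_iff mult_less_0_iff)
    then show ?thesis using l(4) by blast
  qed
  have nz: "w \<noteq> 0" if "sesqui n m c w = 0" for w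
    using that c(2) sesqui_0 by metis
  have K: "z \<in> sphere_zeros ?g \<longleftrightarrow> z \<in> S3 \<and> fst z \<noteq> 0 \<and> snd z \<noteq> 0 \<and> sesqui n m c (fst z ^ q / snd z ^ p) = 0" for z
  proof -
    have "fst z \<noteq> 0" if "sesqui n m c (fst z ^ q / snd z ^ p) = 0"
    proof
      assume "fst z = 0"
      then have "fst z ^ q / snd z ^ p = 0"
        using q_pos by (simp add: zero_power)
      then show False using nz[OF that] by blast
    qed
    then show ?thesis
      unfolding sphere_zeros_hom_poly[of c n m, OF c(1)] UN_iff mem_Collect_eq orbit_param by blast
  qed
  have fibre: "(z, v) \<in> oriented_zero_link ?g \<longleftrightarrow>
      (\<exists>s. v = s *\<^sub>R orbit_velocity p q z \<and> (w \<in> P \<and> s > 0 \<or> w \<in> N \<and> s < 0))"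
    if zw: "z \<in> sphere_zeros ?g" "w = fst z ^ q / snd z ^ p" for z v w
  proof -
    have z: "z \<in> S3" "fst z \<noteq> 0" "snd z \<noteq> 0" "sesqui n m c w = 0" "?g z = 0"
      using zw(1) K[of z] unfolding zw(2) sphere_zeros_def by blast+
    obtain A B where AB: "(?g has_derivative (\<lambda>v. A * transverse_coord z v + B * cnj (transverse_coord z v))) (at z)"
      "norm A \<noteq> norm B" "norm A - norm B > 0 \<longleftrightarrow> w \<in> P" "norm A - norm B < 0 \<longleftrightarrow> w \<in> N"
      using der[OF z(2,3) zw(2) z(4)] by blast
    show ?thesis
      unfolding zero_link_fibre[OF z(1-3) z(5) AB(1,2)] zero_less_mult_iff AB(3,4) by blast
  qed
  show "oriented_zero_link ?g = orbit_link P N"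
  proof (intro set_eqI, clarify)
    fix z v
    show "(z, v) \<in> oriented_zero_link ?g \<longleftrightarrow> (z, v) \<in> orbit_link P N"
    proof
      assume a: "(z, v) \<in> oriented_zero_link ?g"
      then have z: "z \<in> sphere_zeros ?g" by (auto simp: oriented_zero_link_def)
      then have "z \<in> orbit (fst z ^ q / snd z ^ p)"
        using K by (auto simp: orbit_param)
      then show "(z, v) \<in> orbit_link P N"
        using fibre[OF z refl] a unfolding orbit_link_def by blast
    next
      assume "(z, v) \<in> orbit_link P N"
      then obtain s w where w: "v = s *\<^sub>R orbit_velocity p q z" "z \<in> orbit w" "w \<in> P \<and> s > 0 \<or> w \<in> N \<and> s < 0"
        unfolding orbit_link_def by blast
      then have "sesqui n m c w = 0" using sz by (auto simp: signed_zeros_def)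
      then have "z \<in> sphere_zeros ?g"
        using w(2) unfolding sphere_zeros_hom_poly[of c n m, OF c(1)] by blast
      moreover have "w = fst z ^ q / snd z ^ p"
        using w(2) by (simp add: orbit_param)
      ultimately show "(z, v) \<in> oriented_zero_link ?g"
        using fibre w by blast
    qed
  qed
  show "transverse_on_S3 ?g"
    unfolding transverse_on_S3_def
  proof
    fix z assume "z \<in> sphere_zeros ?g"
    then have z: "fst z \<noteq> 0" "snd z \<noteq> 0" "sesqui n m c (fst z ^ q / snd z ^ p) = 0"
      using K by blast+
    obtain A B where AB: "(?g has_derivative (\<lambda>v. A * transverse_coord z v + B * cnj (transverse_coord z v))) (at z)"
      "norm A \<noteq> norm B"
      using der[OF z(1,2) refl z(3)] by blast
    show "frechet_derivative ?g (at z) ` {w. z \<bullet> w = 0} = UNIV"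
      unfolding frechet_derivative_at[OF AB(1), symmetric] surj_tangent_iff[OF z(1,2)] by (rule AB)
  qed
  show "non_degenerate (hom_poly n m c)"
    unfolding non_degenerate_def
  proof (intro allI impI, elim conjE)
    fix z assume z: "fst z \<noteq> 0" "snd z \<noteq> 0" "?g z = 0"
    then have "sesqui n m c (fst z ^ q / snd z ^ p) = 0"
      using mixed_eval_hom_poly_slice[OF z(2), of n m c] by simp
    then obtain A B where AB: "(?g has_derivative (\<lambda>v. A * transverse_coord z v + B * cnj (transverse_coord z v))) (at z)"
      "norm A \<noteq> norm B"
      using der[OF z(1,2) refl] by blast
    show "dim (range (frechet_derivative ?g (at z))) = 2"
      unfolding frechet_derivative_at[OF AB(1), symmetric] dim_range_iff[OF z(1,2)] by (rule AB)
  qed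
qed

lemma orbit_link_components:
  assumes "finite P" "finite N" "P \<inter> N = {}" "0 \<notin> P \<union> N"
  shows "components (fst ` orbit_link P N) = orbit ` (P \<union> N)"
    and "card (components (fst ` orbit_link P N)) = card P + card N"
    and "{C \<in> components (fst ` orbit_link P N). negatively_oriented p q (orbit_link P N) C} = orbit ` N"
    and "card {C \<in> components (fst ` orbit_link P N). negatively_oriented p q (orbit_link P N) C} = card N"
proof -
  show 1: "components (fst ` orbit_link P N) = orbit ` (P \<union> N)"
    unfolding fst_orbit_link using assms by (intro components_Union_orbits) auto
  show "card (components (fst ` orbit_link P N)) = card P + card N"
    unfolding 1 using assms by (simp add: card_image inj_on_subset[OF inj_orbit] card_Un_disjoint)
  show 2: "{C \<in> components (fst ` orbit_link P N). negatively_oriented p q (orbit_link P N) C} = orbit ` N"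
    unfolding 1 using negatively_oriented_orbit[OF assms(3)] by auto
  show "card {C \<in> components (fst ` orbit_link P N). negatively_oriented p q (orbit_link P N) C} = card N"
    unfolding 2 by (simp add: card_image inj_on_subset[OF inj_orbit])
qed

lemma signed_zeros_polar_link:
  assumes c: "c n m \<noteq> 0" "c 0 0 \<noteq> 0" and sz: "signed_zeros (sesqui n m c) P N"
    and fin: "finite P" "finite N" and card: "card P = d + j" "card N = j" and nm: "n = m + d"
  shows "orbit_link P N \<in> polar_links_neg p q d j"
proof -
  have 0: "0 \<notin> P \<union> N"
    using sz c(2) sesqui_0[of n m c] unfolding signed_zeros_def by (metis mem_Collect_eq)
  note oc = orbit_link_components[OF fin signed_zeros_disjoint[OF sz] 0]
  have "orbit_link P N \<in> polar_links p q (int (d * p * q))"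
    unfolding polar_links_def using link_of_signed_zeros[of c n m, OF c sz] strongly_polar_hom_poly[OF nm]
      convenient_hom_poly[of c n m, OF c] by (metis (mono_tags, lifting) mem_Collect_eq)
  moreover have "finite (components (fst ` orbit_link P N))"
    unfolding oc(1) using fin by simp
  ultimately show ?thesis
    unfolding polar_links_neg_def using card oc(2,4) by simp
qed

text \<open>Non-degeneracy gives every zero of the one-variable function a sign and makes it
  isolated. The zeros form a compact set, the image of the link under \<open>z1^q / z2^p\<close>, so
  they are finite in number, and the component counts determine how many there are of each
  sign.\<close>

lemma polar_link_normal_form:
  assumes "L \<in> polar_links_neg p q d j"
  obtains P N where "L = orbit_link P N" "finite P" "finite N" "P \<inter> N = {}" "0 \<notin> P \<union> N"
    "card P = d + j" "card N = j"
proof -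
  obtain f dr where L: "L = oriented_zero_link (mixed_eval f)" and f: "strongly_polar_wh p q dr (int (d * p * q)) f"
      "convenient f" "non_degenerate f"
    and comps: "card (components (fst ` L)) = d + 2 * j"
      "card {C \<in> components (fst ` L). negatively_oriented p q L C} = j"
    using assms unfolding polar_links_neg_def polar_links_def by auto
  obtain n m c where nf: "f = hom_poly n m c" "n = m + d" "c n m \<noteq> 0" "c 0 0 \<noteq> 0"
    using polar_poly_normal_form[OF f(1,2)] .
  let ?f = "sesqui n m c"
  let ?R = "{w. ?f w = 0}"
  have w0: "w \<noteq> 0" if "w \<in> ?R" for w
    using that nf(4) sesqui_0[of n m c] by auto
  have nd: "norm A \<noteq> norm B" if w: "w \<in> ?R" and AB: "wirtinger ?f w A B" for w A B
  proof -
    obtain z where z: "z \<in> orbit w" using orbit_nonempty by blast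
    have nz: "fst z \<noteq> 0" "snd z \<noteq> 0" "fst z ^ q / snd z ^ p = w"
      using orbit_fst_nonzero[OF z w0[OF w]] z unfolding orbit_param by blast+
    obtain A' B' l where l: "l > 0" "norm A' = l * norm A" "norm B' = l * norm B"
      "(mixed_eval f has_derivative (\<lambda>v. A' * transverse_coord z v + B' * cnj (transverse_coord z v))) (at z)"
      using mixed_eval_derivative[OF AB[folded nz(3)] nz(1,2)] w nz(3) nf(1) by blast
    have "mixed_eval f z = 0"
      using nf(1) mixed_eval_hom_poly_slice[OF nz(2)] nz w by simp
    then have "dim (range (frechet_derivative (mixed_eval f) (at z))) = 2"
      using f(3) nz unfolding non_degenerate_def by blast
    then have "norm A' \<noteq> norm B'"
      unfolding frechet_derivative_at[OF l(4), symmetric] dim_range_iff[OF nz(1,2)] .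
    then show ?thesis using l by auto
  qed
  define P where "P = {w \<in> ?R. \<exists>A B. wirtinger ?f w A B \<and> norm A > norm B}"
  define N where "N = {w \<in> ?R. \<exists>A B. wirtinger ?f w A B \<and> norm A < norm B}"
  have PN: "P \<union> N = ?R"
  proof -
    have "w \<in> P \<union> N" if w: "w \<in> ?R" for w
    proof -
      obtain A B where AB: "wirtinger ?f w A B" using sesqui_wirtinger by blast
      then have "norm A < norm B \<or> norm B < norm A" using nd[OF w] by (simp add: neq_iff)
      then show ?thesis using AB w unfolding P_def N_def by blast
    qed
    then show ?thesis by (auto simp: P_def N_def)
  qed
  have sz: "signed_zeros ?f P N"
    unfolding signed_zeros_def PN by (auto simp: P_def N_def)
  let ?K = "sphere_zeros (mixed_eval f)"
  have K: "?K = (\<Union>w\<in>?R. orbit w)"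
    unfolding nf(1) by (rule sphere_zeros_hom_poly[of c n m, OF nf(3)])
  have "continuous_on UNIV (mixed_eval f)"
    unfolding mixed_eval_def case_prod_unfold by (intro continuous_intros)
  then have "closed {z. mixed_eval f z = 0}"
    by (rule closed_Collect_eq) (intro continuous_intros)
  then have "compact ?K"
    unfolding sphere_zeros_def by (metis Collect_conj_eq Collect_mem_eq compact_Int_closed compact_sphere)
  moreover have "continuous_on ?K (\<lambda>z. fst z ^ q / snd z ^ p)"
    unfolding K by (intro continuous_intros) (auto simp: orbit_def)
  ultimately have "compact ((\<lambda>z. fst z ^ q / snd z ^ p) ` ?K)"
    by (rule compact_continuous_image[rotated])
  also have "(\<lambda>z. fst z ^ q / snd z ^ p) ` ?K = ?R"
  proof (intro equalityI subsetI)
    fix w assume w: "w \<in> ?R"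
    obtain z where "z \<in> orbit w" using orbit_nonempty by blast
    then show "w \<in> (\<lambda>z. fst z ^ q / snd z ^ p) ` ?K"
      unfolding K using w by (intro image_eqI[of _ _ z]) (auto simp: orbit_param)
  qed (auto simp: K orbit_param)
  finally have "compact ?R" .
  then have "finite (?R \<inter> ?R)"
    using wirtinger_isolated_zero nd sesqui_wirtinger[of n m c]
    by (intro finite_not_islimpt_in_compact) (auto, metis mem_Collect_eq)
  then have fin: "finite P" "finite N"
    using PN by (metis finite_Un inf.idem)+
  have 0: "0 \<notin> P \<union> N" unfolding PN using w0 by blast
  have L': "L = orbit_link P N"
    unfolding L nf(1) by (rule link_of_signed_zeros[of c n m, OF nf(3,4) sz])
  note oc = orbit_link_components[OF fin signed_zeros_disjoint[OF sz] 0]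
  have "card P + card N = d + 2 * j" "card N = j"
    using comps oc(2,4) unfolding L' by simp_all
  then show ?thesis
    using that L' fin 0 signed_zeros_disjoint[OF sz] by simp
qed

end

subsection \<open>Pencils of polynomials\<close>

definition root_poly :: "complex set \<Rightarrow> complex poly" where
  "root_poly S = (\<Prod>a\<in>S. [:- a, 1:])"

lemma poly_root_poly: "finite S \<Longrightarrow> poly (root_poly S) w = 0 \<longleftrightarrow> w \<in> S"
  by (auto simp: root_poly_def poly_prod)

lemma root_poly_nonzero: "root_poly S \<noteq> 0"
  unfolding root_poly_def by (cases "finite S") auto

lemma degree_root_poly: "degree (root_poly S) = card S"
  unfolding root_poly_def by (subst degree_prod_eq_sum_degree) auto

lemma lead_coeff_root_poly: "lead_coeff (root_poly S) = 1"
  unfolding root_poly_def by (simp add: lead_coeff_prod)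

lemma pderiv_root_poly:
  assumes "finite S" "w \<in> S"
  shows "poly (pderiv (root_poly S)) w \<noteq> 0"
proof -
  have "root_poly S = [:- w, 1:] * root_poly (S - {w})"
    unfolding root_poly_def using assms by (rule prod.remove)
  moreover have "pderiv [:- w, 1:] = 1"
    by (simp add: pderiv_pCons)
  ultimately have "poly (pderiv (root_poly S)) w = poly (root_poly (S - {w})) w"
    by (simp only: pderiv_mult poly_add poly_mult) simp
  then show ?thesis
    using assms by (simp add: poly_root_poly)
qed

lemma card_simple_roots:
  fixes g :: "complex poly"
  assumes "g \<noteq> 0" "\<And>w. poly g w = 0 \<Longrightarrow> poly (pderiv g) w \<noteq> 0"
  shows "card {w. poly g w = 0} = degree g"
proof -
  have "rsquarefree g"
    using assms by (auto simp: rsquarefree_roots)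
  then have "smult (lead_coeff g) (root_poly {w. poly g w = 0}) = g"
    unfolding root_poly_def by (rule complex_poly_decompose_rsquarefree)
  then have "degree g = degree (root_poly {w. poly g w = 0})"
    using assms(1) by (metis degree_smult_eq leading_coeff_0_iff)
  then show ?thesis by (simp add: degree_root_poly)
qed

text \<open>For sets of equal size every member is monic of the same degree, so no root escapes to
  infinity. A complex \<tau> leaves room to go around bad values.\<close>

definition pencil :: "complex set \<Rightarrow> complex set \<Rightarrow> complex \<Rightarrow> complex poly" where
  "pencil S0 S1 \<tau> = root_poly S0 + smult \<tau> (root_poly S1 - root_poly S0)"

lemma pencil_0 [simp]: "pencil S0 S1 0 = root_poly S0"
  and pencil_1 [simp]: "pencil S0 S1 1 = root_poly S1"
  by (simp_all add: pencil_def)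

lemma degree_root_poly_diff:
  assumes "card S1 = card S0" "root_poly S1 \<noteq> root_poly S0"
  shows "degree (root_poly S1 - root_poly S0) < card S0"
proof -
  have n: "card S0 \<noteq> 0"
  proof
    assume "card S0 = 0"
    then have "root_poly S0 = 1" "root_poly S1 = 1"
      using assms(1) by (auto simp: root_poly_def card_eq_0_iff)
    then show False
      using assms(2) by simp
  qed
  have "coeff (root_poly S1 - root_poly S0) (card S0) = 0"
    using lead_coeff_root_poly[of S0] lead_coeff_root_poly[of S1] assms(1)
    by (simp add: degree_root_poly)
  moreover have "degree (root_poly S1 - root_poly S0) \<le> card S0"
    using assms(1) by (intro degree_diff_le) (simp_all add: degree_root_poly)
  ultimately show ?thesis
    using n assms(2) by (metis eq_zero_or_degree_less right_minus_eq bot_nat_0.not_eq_extremum degree_0)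
qed

lemma pencil_degree:
  assumes "card S1 = card S0"
  shows "degree (pencil S0 S1 \<tau>) = card S0" "coeff (pencil S0 S1 \<tau>) (card S0) = 1"
proof -
  have c: "coeff (root_poly S0) (card S0) = 1" "coeff (root_poly S1) (card S0) = 1"
    using lead_coeff_root_poly[of S0] lead_coeff_root_poly[of S1] assms by (simp_all add: degree_root_poly)
  show 1: "coeff (pencil S0 S1 \<tau>) (card S0) = 1"
    by (simp add: pencil_def c)
  have "degree (pencil S0 S1 \<tau>) \<le> card S0"
    unfolding pencil_def using assms
    by (intro degree_add_le degree_diff_le order_trans[OF degree_smult_le]) (simp_all add: degree_root_poly)
  then show "degree (pencil S0 S1 \<tau>) = card S0"
    using 1 le_degree[of "pencil S0 S1 \<tau>" "card S0"] by simp
qed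

text \<open>A double root of \<open>g + \<tau> h\<close> is a zero of the Wronskian \<open>g h' - g' h\<close>, which does not involve
  \<open>\<tau>\<close>; the Wronskian is not zero because \<open>g\<close> has simple roots and \<open>h\<close> has smaller degree.\<close>

lemma finite_bad_pencil:
  assumes fin: "finite S0" "finite S1" "finite T" and card: "card S1 = card S0" and T: "T \<inter> S0 = {}"
  shows "finite {\<tau>. \<exists>w. poly (pencil S0 S1 \<tau>) w = 0 \<and>
     (w \<in> T \<or> poly (pderiv (pencil S0 S1 \<tau>)) w = 0)}" (is "finite ?Bad")
proof -
  define g where "g = root_poly S0"
  define h where "h = root_poly S1 - root_poly S0"
  have pencil: "pencil S0 S1 \<tau> = g + smult \<tau> h" for \<tau>
    by (simp add: pencil_def g_def h_def)
  have g0: "poly g w = 0 \<longleftrightarrow> w \<in> S0" "w \<in> S0 \<Longrightarrow> poly (pderiv g) w \<noteq> 0" for w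
    using fin by (simp_all add: g_def poly_root_poly pderiv_root_poly)
  define B where "B w = {\<tau>. poly g w + \<tau> * poly h w = 0 \<and>
      (w \<in> T \<or> poly (pderiv g) w + \<tau> * poly (pderiv h) w = 0)}" for w
  \<comment> \<open>For fixed \<open>w\<close> the first condition is linear in \<tau>. It leaves
    more than one value only if \<open>g\<close> and \<open>h\<close> both vanish at
    \<open>w\<close>; then \<open>w\<close> is a simple root of \<open>g\<close> outside
    \<open>T\<close>, and the derivative condition leaves at most one value.\<close>
  have finB: "finite (B w)" for w
  proof (cases "poly h w = 0")
    case False
    then have "B w \<subseteq> {- poly g w / poly h w}"
      by (auto simp: B_def field_simps add_eq_0_iff)
    then show ?thesis by (rule finite_subset) simp
  next
    case True
    show ?thesis
    proof (cases "w \<in> S0")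
      case False
      then have "B w = {}" using True g0 by (auto simp: B_def)
      then show ?thesis by simp
    next
      case w: True
      have "B w \<subseteq> {- poly (pderiv g) w / poly (pderiv h) w}"
      proof
        fix \<tau> assume "\<tau> \<in> B w"
        then have e: "poly (pderiv g) w + \<tau> * poly (pderiv h) w = 0"
          using w T by (auto simp: B_def)
        then have "poly (pderiv h) w \<noteq> 0" using g0(2)[OF w] by auto
        then show "\<tau> \<in> {- poly (pderiv g) w / poly (pderiv h) w}"
          using e by (simp add: field_simps add_eq_0_iff)
      qed
      then show ?thesis by (rule finite_subset) simp
    qed
  qed
  define W where "W = g * pderiv h - pderiv g * h"
  have W: "W \<noteq> 0" if "h \<noteq> 0"
  proof
    assume "W = 0"
    have "poly h w = 0" if "w \<in> S0" for w
    proof -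
      have "poly W w = - (poly (pderiv g) w * poly h w)"
        using that g0 by (simp add: W_def)
      then show ?thesis using \<open>W = 0\<close> g0(2)[OF that] by simp
    qed
    then have "S0 \<subseteq> {w. poly h w = 0}" by blast
    then have "card S0 \<le> card {w. poly h w = 0}"
      using that by (intro card_mono poly_roots_finite)
    also have "\<dots> \<le> degree h"
      using that by (rule card_poly_roots_bound)
    also have "\<dots> < card S0"
      using that card unfolding h_def by (intro degree_root_poly_diff) auto
    finally show False by simp
  qed
  show ?thesis
  proof (cases "h = 0")
    case True
    then have "?Bad = {}"
      using g0 T by (auto simp: pencil)
    then show ?thesis by (simp only: finite.emptyI)
  next
    case False
    have "?Bad \<subseteq> (\<Union>w\<in>{w. poly W w = 0} \<union> T. B w)"
    proof
      fix \<tau> assume "\<tau> \<in> ?Bad"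
      then obtain w where w: "poly g w + \<tau> * poly h w = 0"
         "w \<in> T \<or> poly (pderiv g) w + \<tau> * poly (pderiv h) w = 0"
        by (auto simp: pencil pderiv_add pderiv_smult)
      have "poly W w = 0" if "poly (pderiv g) w + \<tau> * poly (pderiv h) w = 0"
      proof -
        have "poly g w = - \<tau> * poly h w" "poly (pderiv g) w = - \<tau> * poly (pderiv h) w"
          using w(1) that by (simp_all add: add_eq_0_iff)
        then show ?thesis by (simp add: W_def)
      qed
      then show "\<tau> \<in> (\<Union>w\<in>{w. poly W w = 0} \<union> T. B w)"
        using w unfolding B_def by blast
    qed
    then show ?thesis
      by (rule finite_subset) (use finB W[OF False] fin in \<open>auto intro: poly_roots_finite\<close>)
  qed
qed

section \<open>Parameter paths around finitely many values\<close>

definition bent_path :: "real \<Rightarrow> real \<Rightarrow> complex" where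
  "bent_path k t = Complex t (k * (t * (1 - t)))"

text \<open>The parabolas for different \<open>k\<close> meet only at 0 and 1: any other point on
  one of them determines \<open>k\<close> as \<open>Im x / (Re x * (1 - Re x))\<close>. So each
  element of \<open>X\<close> spoils at most one \<open>k\<close>.\<close>

lemma bent_path_avoids:
  assumes "finite X" "0 \<notin> X" "1 \<notin> X"
  obtains k where "\<And>t. bent_path k t \<notin> X"
proof -
  define bad where "bad = (\<lambda>x. Im x / (Re x * (1 - Re x))) ` X"
  have "finite bad" using assms by (simp add: bad_def)
  then obtain k where k: "k \<notin> bad"
    using ex_new_if_finite[OF infinite_UNIV_char_0] by blast
  have "bent_path k t \<notin> X" for t
  proof
    assume x: "bent_path k t \<in> X"
    have "t * (1 - t) \<noteq> 0"
    proof
      assume "t * (1 - t) = 0"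
      then have "bent_path k t = 0 \<or> bent_path k t = 1"
        by (auto simp: bent_path_def complex_eq_iff)
      then show False using x assms by auto
    qed
    then have "k = Im (bent_path k t) / (Re (bent_path k t) * (1 - Re (bent_path k t)))"
      by (simp add: bent_path_def)
    then show False using x k unfolding bad_def by blast
  qed
  then show ?thesis using that by blast
qed

lemma norm_bent_path_le:
  assumes "0 \<le> t" "t \<le> 1"
  shows "norm (bent_path k t) \<le> (1 + \<bar>k\<bar>) * t"
proof -
  have "norm (bent_path k t) \<le> \<bar>t\<bar> + \<bar>k * (t * (1 - t))\<bar>"
    using cmod_le[of "bent_path k t"] by (simp add: bent_path_def)
  also have "\<bar>k * (t * (1 - t))\<bar> = \<bar>k\<bar> * t * (1 - t)"
    using assms by (simp add: abs_mult)
  also have "\<dots> \<le> \<bar>k\<bar> * t * 1"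
    using assms by (intro mult_left_mono) auto
  finally show ?thesis using assms by (simp add: algebra_simps)
qed

subsection \<open>Cancelling a pair of zeros of opposite sign\<close>

text \<open>In the coordinate \<open>x + i y\<close> with \<open>a\<close> at \<open>-1\<close> and \<open>b\<close> at \<open>1\<close> this is, up to a positive factor,
  \<open>x\<^sup>2 + y\<^sup>2 - 1 + T - 2 i (y - k T)\<close> with \<open>T = C t\<close>: both zeros lie on \<open>y = k T\<close>, and they
  merge and disappear as \<open>1 - T - k\<^sup>2 T\<^sup>2\<close> decreases through 0. A generic \<open>k\<close> bends the paths of
  the zeros around any given finite set.\<close>

definition pair_rate :: "complex \<Rightarrow> complex \<Rightarrow> real \<Rightarrow> real \<Rightarrow> complex" where
  "pair_rate a b k C = of_real ((norm ((b - a) / 2))\<^sup>2 * C) * Complex 1 (2 * k)"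

definition pair_fun :: "complex \<Rightarrow> complex \<Rightarrow> real \<Rightarrow> real \<Rightarrow> real \<Rightarrow> complex \<Rightarrow> complex" where
  "pair_fun a b k C t w = (w - a) * cnj (w - b) + of_real t * pair_rate a b k C"

definition pair_coord :: "complex \<Rightarrow> complex \<Rightarrow> complex \<Rightarrow> complex" where
  "pair_coord a b w = (w - (a + b) / 2) / ((b - a) / 2)"

definition pair_point :: "complex \<Rightarrow> complex \<Rightarrow> complex \<Rightarrow> complex" where
  "pair_point a b u = (a + b) / 2 + (b - a) / 2 * u"

lemma pair_coord_point:
  assumes "a \<noteq> b"
  shows "pair_coord a b (pair_point a b u) = u" "pair_point a b (pair_coord a b w) = w"
proof -
  have *: "(m + s * u - m) / s = u" "m + s * ((w - m) / s) = w" if "s \<noteq> 0" for m s :: complex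
    using that by simp_all
  show "pair_coord a b (pair_point a b u) = u" "pair_point a b (pair_coord a b w) = w"
    unfolding pair_coord_def pair_point_def by (rule *, use assms in simp)+
qed

lemma pair_diff:
  assumes "a \<noteq> b"
  shows "w - a = (b - a) / 2 * (pair_coord a b w + 1)" "w - b = (b - a) / 2 * (pair_coord a b w - 1)"
  using assms by (simp_all add: pair_coord_def field_simps)

lemma pair_fun_coord:
  assumes "a \<noteq> b"
  shows "pair_fun a b k C t w = of_real ((norm ((b - a) / 2))\<^sup>2) *
    Complex ((norm (pair_coord a b w))\<^sup>2 - 1 + C * t) (2 * (k * (C * t) - Im (pair_coord a b w)))"
proof -
  define s where "s = (b - a) / 2"
  define u where "u = pair_coord a b w"
  have "(w - a) * cnj (w - b) = (s * cnj s) * ((u + 1) * cnj (u - 1))"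
    unfolding pair_diff[OF assms, of w] s_def u_def by (simp add: mult_ac)
  also have "s * cnj s = of_real ((norm s)\<^sup>2)"
    by (simp add: complex_norm_square[symmetric])
  also have "(u + 1) * cnj (u - 1) = Complex ((norm u)\<^sup>2 - 1) (- 2 * Im u)"
    unfolding cmod_power2 by (simp add: complex_eq_iff power2_eq_square algebra_simps)
  finally have "pair_fun a b k C t w
      = of_real ((norm s)\<^sup>2) * (Complex ((norm u)\<^sup>2 - 1) (- 2 * Im u) + of_real (t * C) * Complex 1 (2 * k))"
    by (simp add: pair_fun_def pair_rate_def s_def[symmetric] algebra_simps)
  also have "Complex ((norm u)\<^sup>2 - 1) (- 2 * Im u) + of_real (t * C) * Complex 1 (2 * k)
      = Complex ((norm u)\<^sup>2 - 1 + C * t) (2 * (k * (C * t) - Im u))"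
    by (simp add: complex_eq_iff algebra_simps)
  finally show ?thesis by (simp add: s_def u_def)
qed

lemma pair_fun_zero_iff:
  assumes "a \<noteq> b"
  shows "pair_fun a b k C t w = 0 \<longleftrightarrow>
    (norm (pair_coord a b w))\<^sup>2 = 1 - C * t \<and> Im (pair_coord a b w) = k * (C * t)"
  unfolding pair_fun_coord[OF assms] using assms by (auto simp: complex_eq_iff)

lemma pair_fun_zero_disc:
  assumes "a \<noteq> b"
  shows "pair_fun a b k C t w = 0 \<longleftrightarrow>
    (Re (pair_coord a b w))\<^sup>2 = 1 - C * t - k\<^sup>2 * (C * t)\<^sup>2 \<and> Im (pair_coord a b w) = k * (C * t)"
  unfolding pair_fun_zero_iff[OF assms] cmod_power2 by (auto simp: power_mult_distrib)

text \<open>Eliminating \<open>C * t\<close> from the two equations in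
  \<open>pair_fun_zero_iff\<close> leaves this time-free curve, which contains all positions of the
  pair. A point other than \<open>a\<close> and \<open>b\<close> lies on it for at most one
  \<open>k\<close>: on the unit circle the equation forces \<open>Im u = 0\<close>, hence
  \<open>u = 1\<close> or \<open>u = -1\<close>.\<close>

lemma pair_curve_avoids:
  assumes "a \<noteq> b" "finite X" "a \<notin> X" "b \<notin> X"
  obtains k where "\<And>w. w \<in> X \<Longrightarrow> Im (pair_coord a b w) \<noteq> k * (1 - (norm (pair_coord a b w))\<^sup>2)"
proof -
  let ?u = "pair_coord a b"
  define bad where "bad = (\<lambda>w. Im (?u w) / (1 - (norm (?u w))\<^sup>2)) ` X"
  have "finite bad" using assms by (simp add: bad_def)
  then obtain k where k: "k \<notin> bad"
    using ex_new_if_finite[OF infinite_UNIV_char_0] by blast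
  have "Im (?u w) \<noteq> k * (1 - (norm (?u w))\<^sup>2)" if w: "w \<in> X" for w
  proof
    assume e: "Im (?u w) = k * (1 - (norm (?u w))\<^sup>2)"
    show False
    proof (cases "1 - (norm (?u w))\<^sup>2 = 0")
      case True
      then have i: "Im (?u w) = 0" and n: "(norm (?u w))\<^sup>2 = 1"
        using e by simp_all
      have "(Re (?u w))\<^sup>2 = 1"
        using n i unfolding cmod_power2 by simp
      then have "?u w = 1 \<or> ?u w = - 1"
        using i by (auto simp: complex_eq_iff power2_eq_1_iff)
      then have "w = a \<or> w = b"
        using pair_diff[OF assms(1), of w] by auto
      then show False using w assms by auto
    next
      case False
      then have "k = Im (?u w) / (1 - (norm (?u w))\<^sup>2)"
        using e by simp
      then show False using k w unfolding bad_def by blast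
    qed
  qed
  then show ?thesis using that by blast
qed

text \<open>Large \<open>C\<close> makes the pair disappear before the remaining positive zeros have moved noticeably.\<close>

lemma elimination_parameters:
  assumes ab: "a \<noteq> b" and fin: "finite S0" "finite S1" "finite T" and card: "card S1 = card S0"
    and T0: "T \<inter> S0 = {}" and T1: "T \<inter> S1 = {}" and a: "a \<notin> S0 \<union> T" and b: "b \<notin> S0 \<union> T"
  obtains l k C where "C \<ge> 2"
    "\<forall>t w. poly (pencil S0 S1 (bent_path l t)) w = 0 \<longrightarrow>
       w \<notin> T \<and> poly (pderiv (pencil S0 S1 (bent_path l t))) w \<noteq> 0"
    "\<forall>t. \<forall>w\<in>T. pair_fun a b k C t w \<noteq> 0"
    "\<forall>t\<in>{0..1}. \<forall>w. pair_fun a b k C t w = 0 \<longrightarrow> poly (pencil S0 S1 (bent_path l t)) w \<noteq> 0"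
proof -
  let ?Bad = "{\<tau>. \<exists>w. poly (pencil S0 S1 \<tau>) w = 0 \<and>
     (w \<in> T \<or> poly (pderiv (pencil S0 S1 \<tau>)) w = 0)}"
  let ?u = "pair_coord a b"
  have "finite ?Bad" by (rule finite_bad_pencil[OF fin card T0])
  moreover have "0 \<notin> ?Bad"
    using T0 pderiv_root_poly[OF fin(1)] by (auto simp: poly_root_poly fin)
  moreover have "1 \<notin> ?Bad"
    using T1 pderiv_root_poly[OF fin(2)] by (auto simp: poly_root_poly fin)
  ultimately obtain l where l: "\<And>t. bent_path l t \<notin> ?Bad"
    using bent_path_avoids by blast
  obtain k where k: "\<And>w. w \<in> S0 \<union> T \<Longrightarrow> Im (?u w) \<noteq> k * (1 - (norm (?u w))\<^sup>2)"
    using pair_curve_avoids[OF ab, of "S0 \<union> T"] fin a b by blast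
  \<comment> \<open>A compact set holding every zero of the pair factor at nonnegative times. It
    depends on \<open>k\<close> but not on \<open>C\<close>, so \<open>C\<close> can still be chosen
    from bounds on \<open>K\<close>.\<close>
  define K where "K = cball ((a + b) / 2) (norm ((b - a) / 2)) \<inter> {w. Im (?u w) = k * (1 - (norm (?u w))\<^sup>2)}"
  have "continuous_on UNIV ?u"
    unfolding pair_coord_def by (intro continuous_intros) (use ab in auto)
  then have "closed {w. Im (?u w) = k * (1 - (norm (?u w))\<^sup>2)}"
    by (intro closed_Collect_eq continuous_intros)
  then have "compact K"
    unfolding K_def by (intro compact_Int_closed) auto
  have zeroK: "w \<in> K \<and> C * t \<le> 1" if "pair_fun a b k C t w = 0" "0 \<le> C * t" for C t w
  proof -
    have z: "(norm (?u w))\<^sup>2 = 1 - C * t" "Im (?u w) = k * (C * t)"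
      using that(1) unfolding pair_fun_zero_iff[OF ab] by blast+
    then have "(norm (?u w))\<^sup>2 \<le> 1\<^sup>2" using that(2) by simp
    then have "norm (?u w) \<le> 1" by (rule power2_le_imp_le) simp
    then have "norm ((b - a) / 2) * norm (?u w) \<le> norm ((b - a) / 2)"
      by (intro mult_left_le) auto
    moreover have "w - (a + b) / 2 = (b - a) / 2 * ?u w"
      using pair_coord_point(2)[OF ab, of w] unfolding pair_point_def by (metis add_diff_cancel_left')
    ultimately have "w \<in> cball ((a + b) / 2) (norm ((b - a) / 2))"
      by (metis dist_commute dist_norm mem_cball norm_mult)
    moreover have "Im (?u w) = k * (1 - (norm (?u w))\<^sup>2)" using z by simp
    moreover have "C * t \<le> 1" using z(1) zero_le_power2[of "norm (?u w)"] by linarith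
    ultimately show ?thesis unfolding K_def by blast
  qed
  define h where "h = root_poly S1 - root_poly S0"
  have "compact (poly h ` K)"
    by (intro compact_continuous_image \<open>compact K\<close> continuous_intros)
  then obtain M where M: "M > 0" "\<And>w. w \<in> K \<Longrightarrow> norm (poly h w) \<le> M"
    using bounded_pos[of "poly h ` K"] compact_imp_bounded by blast
  obtain \<delta> where \<delta>: "\<delta> > 0" "\<And>w. w \<in> K \<Longrightarrow> \<delta> \<le> norm (poly (root_poly S0) w)"
  proof (cases "K = {}")
    case True
    then show ?thesis using that[of 1] by simp
  next
    case False
    have "continuous_on K (\<lambda>w. norm (poly (root_poly S0) w))"
      by (intro continuous_intros)
    then obtain w0 where w0: "w0 \<in> K" "\<And>w. w \<in> K \<Longrightarrow> norm (poly (root_poly S0) w0) \<le> norm (poly (root_poly S0) w)"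
      using continuous_attains_inf[OF \<open>compact K\<close> False] by blast
    have "w0 \<notin> S0" using w0(1) k unfolding K_def by blast
    then show ?thesis
      using that[of "norm (poly (root_poly S0) w0)"] w0 fin by (simp add: poly_root_poly)
  qed
  \<comment> \<open>The pair exists only while \<open>C * t \<le> 1\<close>. On \<open>K\<close> the
    pencil differs from \<open>root_poly S0\<close>, of modulus at least \<delta>, by at most
    \<open>(1 + \<bar>l\<bar>) * t * M\<close>, which for such \<open>t\<close> is less than
    \<delta>. The bound 2 puts the merging before time 1.\<close>
  define C where "C = max 2 ((1 + \<bar>l\<bar>) * M / \<delta> + 1)"
  have C: "C \<ge> 2" "(1 + \<bar>l\<bar>) * M / \<delta> < C"
    by (auto simp: C_def)
  have "pair_fun a b k C t w \<noteq> 0" if "w \<in> T" for t w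
  proof
    assume "pair_fun a b k C t w = 0"
    then have "Im (?u w) = k * (1 - (norm (?u w))\<^sup>2)"
      unfolding pair_fun_zero_iff[OF ab] by simp
    then show False using k that by blast
  qed
  moreover have "poly (pencil S0 S1 (bent_path l t)) w \<noteq> 0"
    if t: "0 \<le> t" "t \<le> 1" and z: "pair_fun a b k C t w = 0" for t w
  proof
    assume "poly (pencil S0 S1 (bent_path l t)) w = 0"
    then have "poly (root_poly S0) w = - (bent_path l t * poly h w)"
      by (simp add: pencil_def h_def add_eq_0_iff2)
    moreover have wK: "w \<in> K" "C * t \<le> 1"
      using zeroK[OF z] t C by auto
    ultimately have "\<delta> \<le> norm (bent_path l t) * norm (poly h w)"
      using \<delta>(2)[of w] by (simp add: norm_mult)
    also have "\<dots> \<le> ((1 + \<bar>l\<bar>) * t) * M"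
      using norm_bent_path_le[OF t, of l] M(2)[OF wK(1)] t by (intro mult_mono) auto
    also have "\<dots> = (1 + \<bar>l\<bar>) * M * t" by simp
    finally have "1 \<le> (1 + \<bar>l\<bar>) * M / \<delta> * t"
      using \<delta>(1) by (simp add: field_simps)
    moreover have "t \<noteq> 0" using \<open>1 \<le> (1 + \<bar>l\<bar>) * M / \<delta> * t\<close> by auto
    then have "(1 + \<bar>l\<bar>) * M / \<delta> * t < C * t"
      using C(2) t by (intro mult_strict_right_mono) auto
    ultimately show False using wK(2) by linarith
  qed
  moreover have "w \<notin> T \<and> poly (pderiv (pencil S0 S1 (bent_path l t))) w \<noteq> 0"
    if "poly (pencil S0 S1 (bent_path l t)) w = 0" for t w
    using l[of t] that by blast
  ultimately show ?thesis using that[of C l k] C(1) by simp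
qed

subsection \<open>The elimination family\<close>

lemma poly_sum_atMost:
  fixes P :: "'a::comm_semiring_1 poly"
  assumes "degree P \<le> n"
  shows "poly P w = (\<Sum>i\<le>n. coeff P i * w ^ i)"
  unfolding poly_altdef
  by (rule sum.mono_neutral_left) (use assms in \<open>auto simp: coeff_eq_0\<close>)

lemma sesqui_poly:
  assumes "degree P \<le> n" "degree Q \<le> m"
  shows "sesqui n m (\<lambda>i j. coeff P i * cnj (coeff Q j)) w = poly P w * cnj (poly Q w)"
  unfolding sesqui_def poly_sum_atMost[OF assms(1)] poly_sum_atMost[OF assms(2)] cnj_sum sum_product
    sum.cartesian_product
  by (intro sum.cong) (auto simp: mult_ac)

lemma sesqui_add_scaled:
  "sesqui n m (\<lambda>i j. c i j + s * c' i j) w = sesqui n m c w + s * sesqui n m c' w"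
  by (simp add: sesqui_def algebra_simps sum.distrib sum_distrib_left case_prod_unfold)

lemma bent_path_eq: "bent_path l t = of_real t + \<i> * of_real l * (of_real t * (1 + (- 1) * of_real t))"
  by (simp add: bent_path_def complex_eq_iff)

lemma Ck_on_bent_path:
  assumes "bounded_linear r"
  shows "Ck_on K (\<lambda>x. bent_path l (r x)) UNIV"
proof -
  have "Ck_on K (\<lambda>x. of_real (r x) :: complex) UNIV"
    by (intro Ck_on_linear bounded_linear_compose[OF bounded_linear_of_real assms])
  then show ?thesis
    unfolding bent_path_eq by (intro Ck_on_intros)
qed

text \<open>The pair to be cancelled is \<open>a\<close>, \<open>b\<close>. The other positive zeros
  move from \<open>S0\<close> to \<open>S1\<close>, the other negative zeros \<open>N\<close> stay
  fixed. Listing 0 together with \<open>N\<close> keeps the moving zeros off the singular orbit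
  \<open>w = 0\<close>.\<close>

locale elimination = weights +
  fixes S0 S1 N :: "complex set" and a b :: complex and l k C :: real and d :: nat
  assumes finite_S0: "finite S0" and finite_S1: "finite S1" and finite_N: "finite N"
    and card_S1: "card S1 = card S0" and card_S0: "card S0 = d + card N"
    and zero_notin: "0 \<notin> N" and ab: "a \<noteq> b" and C: "C \<ge> 2"
    and pencil_simple: "\<And>t w. poly (pencil S0 S1 (bent_path l t)) w = 0 \<Longrightarrow>
       w \<notin> insert 0 N \<and> poly (pderiv (pencil S0 S1 (bent_path l t))) w \<noteq> 0"
    and pair_avoids: "\<And>t w. w \<in> insert 0 N \<Longrightarrow> pair_fun a b k C t w \<noteq> 0"
    and pair_apart: "\<And>t w. 0 \<le> t \<Longrightarrow> t \<le> 1 \<Longrightarrow> pair_fun a b k C t w = 0 \<Longrightarrow>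
       poly (pencil S0 S1 (bent_path l t)) w \<noteq> 0"
begin

abbreviation "G t \<equiv> pencil S0 S1 (bent_path l t)"
abbreviation "E t \<equiv> pair_fun a b k C t"
abbreviation "R \<equiv> root_poly N"
abbreviation "n \<equiv> Suc (card S0)"
abbreviation "m \<equiv> Suc (card N)"

definition f :: "real \<Rightarrow> complex \<Rightarrow> complex" where
  "f t w = poly (G t) w * cnj (poly R w) * E t w"

text \<open>The pair factor is not a product of a polynomial in \<open>w\<close> and one in
  \<open>cnj w\<close>, so \<open>f t\<close> is expanded as a sum of two such products. The
  bidegree \<open>(n, m)\<close> is one above the cardinalities on account of this factor.\<close>

definition coef :: "real \<Rightarrow> nat \<Rightarrow> nat \<Rightarrow> complex" where
  "coef t i j = coeff (G t * [:- a, 1:]) i * cnj (coeff (R * [:- b, 1:]) j)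
     + of_real t * pair_rate a b k C * (coeff (G t) i * cnj (coeff R j))"

lemma R_zero_iff: "poly R w = 0 \<longleftrightarrow> w \<in> N"
  by (rule poly_root_poly[OF finite_N])

lemma sesqui_coef: "sesqui n m (coef t) = f t"
proof
  fix w
  have "degree (G t * [:- a, 1:]) \<le> n" "degree (R * [:- b, 1:]) \<le> m" "degree (G t) \<le> n" "degree R \<le> m"
    using degree_mult_le[of "G t" "[:- a, 1:]"] degree_mult_le[of R "[:- b, 1:]"] pencil_degree(1)[OF card_S1]
    by (simp_all add: degree_root_poly)
  then have "sesqui n m (coef t) w = poly (G t * [:- a, 1:]) w * cnj (poly (R * [:- b, 1:]) w)
      + of_real t * pair_rate a b k C * (poly (G t) w * cnj (poly R w))"
    unfolding coef_def sesqui_add_scaled by (simp only: sesqui_poly)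
  then show "sesqui n m (coef t) w = f t w"
    by (simp add: f_def pair_fun_def algebra_simps)
qed

text \<open>The time term has degree only \<open>card S0\<close> in \<open>w\<close> and does not
  reach the top coefficient; hence no zero runs off to infinity.\<close>

lemma coef_top: "coef t n m = 1"
proof -
  have "lead_coeff (G t) = 1" "lead_coeff R = 1"
    using pencil_degree[OF card_S1] lead_coeff_root_poly by simp_all
  then have "lead_coeff (G t * [:- a, 1:]) = 1" "lead_coeff (R * [:- b, 1:]) = 1"
    unfolding lead_coeff_mult by simp_all
  moreover have "degree (G t * [:- a, 1:]) = n" "degree (R * [:- b, 1:]) = m"
  proof -
    have "G t \<noteq> 0" using \<open>lead_coeff (G t) = 1\<close> by auto
    then show "degree (G t * [:- a, 1:]) = n"
      using pencil_degree(1)[OF card_S1] by (subst degree_mult_eq) auto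
    show "degree (R * [:- b, 1:]) = m"
      using root_poly_nonzero by (subst degree_mult_eq) (auto simp: degree_root_poly)
  qed
  moreover have "coeff (G t) n = 0"
    using pencil_degree(1)[OF card_S1] by (intro coeff_eq_0) simp
  ultimately show ?thesis by (simp add: coef_def)
qed

lemma f_zero_cases:
  assumes "f t w = 0" "0 \<le> t" "t \<le> 1"
  obtains "poly (G t) w = 0" "poly R w \<noteq> 0" "E t w \<noteq> 0"
  | "poly (G t) w \<noteq> 0" "poly R w = 0" "E t w \<noteq> 0"
  | "poly (G t) w \<noteq> 0" "poly R w \<noteq> 0" "E t w = 0"
proof -
  have "poly (G t) w = 0 \<or> poly R w = 0 \<or> E t w = 0"
    using assms(1) by (auto simp: f_def)
  moreover have "poly (G t) w = 0 \<Longrightarrow> poly R w \<noteq> 0"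
    using pencil_simple[of t w] by (simp add: R_zero_iff)
  moreover have "poly R w = 0 \<Longrightarrow> E t w \<noteq> 0"
    using pair_avoids[of w t] by (simp add: R_zero_iff)
  moreover have "E t w = 0 \<Longrightarrow> poly (G t) w \<noteq> 0"
    using pair_apart[of t w] assms by blast
  ultimately show ?thesis using that by blast
qed

lemma f_0_nonzero: "f t 0 \<noteq> 0"
  using pencil_simple[of t 0] pair_avoids[of 0 t] zero_notin R_zero_iff[of 0] by (auto simp: f_def)

lemma coef_0: "coef t 0 0 \<noteq> 0"
  using f_0_nonzero[of t] sesqui_0[of n m "coef t"] by (simp add: sesqui_coef)

text \<open>The time derivative of \<open>poly (G t) w\<close>; its first factor is the velocity of
  \<open>bent_path l\<close>.\<close>

definition dG :: "real \<Rightarrow> complex \<Rightarrow> complex" where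
  "dG t w = Complex 1 (l * (1 - 2 * t)) * poly (root_poly S1 - root_poly S0) w"

lemma f_derivative:
  "((\<lambda>x. f (snd x) (fst x)) has_derivative (\<lambda>(h, s).
     (poly (pderiv (G t)) w * cnj (poly R w) * E t w + poly (G t) w * cnj (poly R w) * cnj (w - b)) * h
   + (poly (G t) w * cnj (poly (pderiv R) w) * E t w + poly (G t) w * cnj (poly R w) * (w - a)) * cnj h
   + of_real s * (dG t w * cnj (poly R w) * E t w + poly (G t) w * cnj (poly R w) * pair_rate a b k C)))
   (at (w, t))"
proof -
  have fst': "(fst has_derivative fst) (at (w, t))" and snd': "(snd has_derivative snd) (at (w, t))"
    by (auto intro: has_derivative_fst has_derivative_snd has_derivative_ident)
  have poly': "((\<lambda>x. poly P (fst x)) has_derivative (\<lambda>x. poly (pderiv P) w * fst x)) (at (w, t))" for P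
    using has_derivative_compose[OF fst', of "poly P" "\<lambda>h. poly (pderiv P) w * h"]
      poly_DERIV[of P w] by (simp add: has_field_derivative_def)
  have bent': "((\<lambda>x. bent_path l (snd x)) has_derivative (\<lambda>x. of_real (snd x) * Complex 1 (l * (1 - 2 * t)))) (at (w, t))"
  proof -
    have "((\<lambda>x. of_real (snd x) :: complex) has_derivative (\<lambda>x. of_real (snd x))) (at (w, t))"
      by (rule bounded_linear.has_derivative[OF bounded_linear_of_real snd'])
    then show ?thesis
      unfolding bent_path_eq
      by (auto intro!: derivative_eq_intros simp: fun_eq_iff complex_eq_iff algebra_simps)
  qed
  have G': "((\<lambda>x. poly (G (snd x)) (fst x)) has_derivative
      (\<lambda>x. poly (pderiv (G t)) w * fst x + of_real (snd x) * dG t w)) (at (w, t))"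
    unfolding pencil_def poly_add poly_smult
    by (rule has_derivative_eq_rhs, rule has_derivative_add[OF poly' has_derivative_mult[OF bent' poly']])
       (simp add: fun_eq_iff dG_def pderiv_add pderiv_smult algebra_simps)
  have R': "((\<lambda>x. cnj (poly R (fst x))) has_derivative (\<lambda>x. cnj (poly (pderiv R) w) * cnj (fst x))) (at (w, t))"
    using bounded_linear.has_derivative[OF bounded_linear_cnj poly'[of R]] by simp
  have 1: "((\<lambda>x. fst x - a) has_derivative fst) (at (w, t))"
    by (rule has_derivative_eq_rhs, rule has_derivative_diff[OF fst' has_derivative_const]) simp
  have 2: "((\<lambda>x. cnj (fst x - b)) has_derivative (\<lambda>x. cnj (fst x))) (at (w, t))"
    by (rule bounded_linear.has_derivative[OF bounded_linear_cnj],
        rule has_derivative_eq_rhs, rule has_derivative_diff[OF fst' has_derivative_const]) simp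
  have 3: "((\<lambda>x. of_real (snd x) * pair_rate a b k C) has_derivative (\<lambda>x. of_real (snd x) * pair_rate a b k C)) (at (w, t))"
    by (intro has_derivative_mult_left bounded_linear.has_derivative[OF bounded_linear_of_real snd'])
  have E': "((\<lambda>x. E (snd x) (fst x)) has_derivative
      (\<lambda>x. (w - a) * cnj (fst x) + fst x * cnj (w - b) + of_real (snd x) * pair_rate a b k C)) (at (w, t))"
    unfolding pair_fun_def
    using has_derivative_add[OF has_derivative_mult[OF 1 2] 3] by simp
  show ?thesis
    unfolding f_def
    by (rule has_derivative_eq_rhs, rule has_derivative_mult[OF has_derivative_mult[OF G' R'] E'])
       (simp add: fun_eq_iff case_prod_unfold algebra_simps)
qed

lemma f_wirtinger:
  "wirtinger (f t) w
     (poly (pderiv (G t)) w * cnj (poly R w) * E t w + poly (G t) w * cnj (poly R w) * cnj (w - b))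
     (poly (G t) w * cnj (poly (pderiv R) w) * E t w + poly (G t) w * cnj (poly R w) * (w - a))"
proof -
  have "((\<lambda>x. (x, t)) has_derivative (\<lambda>h. (h, 0))) (at w)"
    by (intro has_derivative_Pair has_derivative_ident has_derivative_const)
  from has_derivative_compose[OF this f_derivative] show ?thesis
    by (simp add: wirtinger_def)
qed

section \<open>Position and sign of the zeros at each time\<close>

definition disc :: "real \<Rightarrow> real" where
  "disc t = 1 - C * t - k\<^sup>2 * (C * t)\<^sup>2"

definition pos_zero :: "real \<Rightarrow> complex" where
  "pos_zero t = pair_point a b (Complex (- sqrt (disc t)) (k * (C * t)))"

definition neg_zero :: "real \<Rightarrow> complex" where
  "neg_zero t = pair_point a b (Complex (sqrt (disc t)) (k * (C * t)))"

lemma E_zero_disc: "E t w = 0 \<Longrightarrow> disc t \<ge> 0"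
  unfolding pair_fun_zero_disc[OF ab] disc_def[symmetric] by (metis zero_le_power2)

text \<open>In the pair coordinate the imaginary part of a zero is prescribed and
  \<open>disc t\<close> is the square of its real part. So the sign of \<open>disc t\<close> decides
  between two zeros, one and none.\<close>

lemma E_zero_iff:
  assumes "disc t \<ge> 0"
  shows "E t w = 0 \<longleftrightarrow> w = pos_zero t \<or> w = neg_zero t"
proof -
  let ?u = "pair_coord a b w"
  have eq: "w = pair_point a b v \<longleftrightarrow> ?u = v" for v
    using pair_coord_point[OF ab] by metis
  have "(Re ?u)\<^sup>2 = disc t \<longleftrightarrow> Re ?u = - sqrt (disc t) \<or> Re ?u = sqrt (disc t)"
    using assms by (metis power2_eq_iff real_sqrt_pow2)
  then show ?thesis
    unfolding pair_fun_zero_disc[OF ab] disc_def[symmetric] pos_zero_def neg_zero_def eq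
    by (auto simp: complex_eq_iff)
qed

text \<open>\<open>Re u = 0\<close> is the perpendicular bisector of \<open>a\<close> and
  \<open>b\<close>. At a zero of \<open>E t\<close> the two Wirtinger derivatives have moduli
  proportional to the distances from \<open>b\<close> and from \<open>a\<close>, so the side of the
  bisector is the sign of the zero.\<close>

lemma pair_sign:
  shows "norm (w - a) < norm (w - b) \<longleftrightarrow> Re (pair_coord a b w) < 0"
    and "norm (w - b) < norm (w - a) \<longleftrightarrow> Re (pair_coord a b w) > 0"
proof -
  let ?u = "pair_coord a b w"
  have s: "norm ((b - a) / 2) > 0" using ab by simp
  have n: "norm (w - a) = norm ((b - a) / 2) * norm (?u + 1)" "norm (w - b) = norm ((b - a) / 2) * norm (?u - 1)"
    by (metis pair_diff[OF ab] norm_mult)+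
  have sq: "(norm (?u + 1))\<^sup>2 - (norm (?u - 1))\<^sup>2 = 4 * Re ?u"
    unfolding cmod_power2 by (simp add: power2_eq_square algebra_simps)
  have iff: "x < y \<longleftrightarrow> x\<^sup>2 < y\<^sup>2" if "x \<ge> 0" "y \<ge> 0" for x y :: real
    using that by (metis abs_of_nonneg power2_strict_mono abs_le_square_iff not_less)
  show "norm (w - a) < norm (w - b) \<longleftrightarrow> Re ?u < 0"
    unfolding n mult_less_cancel_left_pos[OF s] using iff[of "norm (?u + 1)" "norm (?u - 1)"] sq by auto
  show "norm (w - b) < norm (w - a) \<longleftrightarrow> Re ?u > 0"
    unfolding n mult_less_cancel_left_pos[OF s] using iff[of "norm (?u - 1)" "norm (?u + 1)"] sq by auto
qed

abbreviation "roots t \<equiv> {w. poly (G t) w = 0}"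

lemma G_nonzero: "G t \<noteq> 0"
  using pencil_degree(2)[OF card_S1, of "bent_path l t"] by auto

lemma finite_roots: "finite (roots t)"
  by (rule poly_roots_finite[OF G_nonzero])

lemma card_roots: "card (roots t) = card S0"
  using card_simple_roots[OF G_nonzero] pencil_simple pencil_degree(1)[OF card_S1] by metis

text \<open>\<open>G t\<close> enters holomorphically, so at a simple root of it \<open>B\<close>
  vanishes and \<open>A\<close> does not. At a point of \<open>N\<close> the conjugated factor
  \<open>R\<close> has the opposite effect.\<close>

lemma wirtinger_at_roots:
  assumes "w \<in> roots t" "0 \<le> t" "t \<le> 1"
  shows "\<exists>A B. wirtinger (f t) w A B \<and> norm A > norm B"
proof -
  have "f t w = 0" using assms by (simp add: f_def)
  then have "poly R w \<noteq> 0" "E t w \<noteq> 0"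
    using assms by (auto elim: f_zero_cases)
  moreover have "poly (pderiv (G t)) w \<noteq> 0" using pencil_simple[of t w] assms by simp
  ultimately show ?thesis
    using f_wirtinger[of t w] assms(1) by (intro exI conjI) (assumption, simp)
qed

lemma wirtinger_at_N:
  assumes "w \<in> N" "0 \<le> t" "t \<le> 1"
  shows "\<exists>A B. wirtinger (f t) w A B \<and> norm A < norm B"
proof -
  have r: "poly R w = 0" using assms by (simp add: R_zero_iff)
  then have "f t w = 0" by (simp add: f_def)
  then have "poly (G t) w \<noteq> 0" "E t w \<noteq> 0"
    using assms r by (auto elim: f_zero_cases)
  moreover have "poly (pderiv R) w \<noteq> 0" using pderiv_root_poly[OF finite_N assms(1)] .
  ultimately show ?thesis
    using f_wirtinger[of t w] r by (intro exI conjI) (assumption, simp)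
qed

lemma wirtinger_at_pair:
  assumes "E t w = 0" "0 \<le> t" "t \<le> 1"
  obtains r where "r \<noteq> 0" "wirtinger (f t) w (r * cnj (w - b)) (r * (w - a))"
proof -
  have "f t w = 0" using assms by (simp add: f_def)
  then have "poly R w \<noteq> 0" "poly (G t) w \<noteq> 0"
    using assms by (auto elim: f_zero_cases)
  then show ?thesis
    using that[of "poly (G t) w * cnj (poly R w)"] f_wirtinger[of t w] assms(1) by simp
qed

lemma signed_zeros_before:
  assumes "disc t > 0" "0 \<le> t" "t \<le> 1"
  shows "signed_zeros (f t) (insert (pos_zero t) (roots t)) (insert (neg_zero t) N)"
proof -
  have z: "{w. f t w = 0} = insert (pos_zero t) (roots t) \<union> insert (neg_zero t) N"
    using E_zero_iff[of t] assms(1) by (auto simp: f_def R_zero_iff)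
  have E: "E t (pos_zero t) = 0" "E t (neg_zero t) = 0"
    using E_zero_iff[of t] assms(1) by auto
  obtain r where r: "r \<noteq> 0" "wirtinger (f t) (pos_zero t) (r * cnj (pos_zero t - b)) (r * (pos_zero t - a))"
    using wirtinger_at_pair[OF E(1) assms(2,3)] .
  have "norm (pos_zero t - a) < norm (pos_zero t - b)"
    unfolding pair_sign by (simp add: pos_zero_def pair_coord_point[OF ab] assms)
  then have "norm r * norm (pos_zero t - a) < norm r * norm (pos_zero t - b)"
    using r(1) by simp
  then have p: "\<exists>A B. wirtinger (f t) (pos_zero t) A B \<and> norm A > norm B"
    using r(2) by (intro exI conjI) (assumption, simp only: norm_mult complex_mod_cnj)
  obtain r' where r': "r' \<noteq> 0" "wirtinger (f t) (neg_zero t) (r' * cnj (neg_zero t - b)) (r' * (neg_zero t - a))"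
    using wirtinger_at_pair[OF E(2) assms(2,3)] .
  have "norm (neg_zero t - b) < norm (neg_zero t - a)"
    unfolding pair_sign by (simp add: neg_zero_def pair_coord_point[OF ab] assms)
  then have "norm r' * norm (neg_zero t - b) < norm r' * norm (neg_zero t - a)"
    using r'(1) by simp
  then have n: "\<exists>A B. wirtinger (f t) (neg_zero t) A B \<and> norm A < norm B"
    using r'(2) by (intro exI conjI) (assumption, simp only: norm_mult complex_mod_cnj)
  show ?thesis
    unfolding signed_zeros_def z using p n wirtinger_at_roots wirtinger_at_N assms by blast
qed

lemma signed_zeros_after:
  assumes "disc t < 0" "0 \<le> t" "t \<le> 1"
  shows "signed_zeros (f t) (roots t) N"
proof -
  have z: "{w. f t w = 0} = roots t \<union> N"
    using E_zero_disc[of t] assms(1) by (force simp: f_def R_zero_iff)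
  show ?thesis
    unfolding signed_zeros_def z using wirtinger_at_roots wirtinger_at_N assms by blast
qed

text \<open>\<open>disc\<close> strictly decreases on nonnegative times, from 1 at time 0 to a
  negative value at time 1 because \<open>C \<ge> 2\<close>.\<close>

lemma merge_time:
  obtains t0 where "0 < t0" "t0 < 1" "disc t0 = 0"
    "\<forall>t. 0 \<le> t \<longrightarrow> t < t0 \<longrightarrow> disc t > 0" "\<forall>t. t0 < t \<longrightarrow> disc t < 0"
proof -
  have mono: "disc t < disc s" if "0 \<le> s" "s < t" for s t
  proof -
    have "C * s < C * t" using that C by simp
    moreover have "0 \<le> C * s" using that C by simp
    ultimately have "(C * s)\<^sup>2 \<le> (C * t)\<^sup>2" by (intro power_mono) auto
    then have "k\<^sup>2 * (C * s)\<^sup>2 \<le> k\<^sup>2 * (C * t)\<^sup>2" by (intro mult_left_mono) auto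
    then show ?thesis using \<open>C * s < C * t\<close> by (simp add: disc_def)
  qed
  have 0: "disc 0 = 1" by (simp add: disc_def)
  have "disc 1 = 1 - C - k\<^sup>2 * C\<^sup>2" "0 \<le> k\<^sup>2 * C\<^sup>2"
    by (simp_all add: disc_def)
  then have 1: "disc 1 < 0" using C by linarith
  have "continuous_on {0..1} disc"
    unfolding disc_def by (intro continuous_intros)
  then obtain t0 where t0: "0 \<le> t0" "t0 \<le> 1" "disc t0 = 0"
    using IVT2'[of disc 1 0 0] 0 1 by auto
  have "t0 \<noteq> 0" "t0 \<noteq> 1" using t0 0 1 by auto
  then show ?thesis
    using that[of t0] t0 mono by force
qed


section \<open>Smoothness of the family and of its total space\<close>

abbreviation "F t \<equiv> hom_poly n m (coef t)"

text \<open>The map \<open>r\<close> is the identity for the family of coefficients and the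
  projection to time for \<open>total_fun\<close>.\<close>

lemma Ck_on_coef:
  assumes "bounded_linear r"
  shows "Ck_on K (\<lambda>x. coef (r x) i j) UNIV"
proof -
  have 1: "Ck_on K (\<lambda>x. of_real (r x) :: complex) UNIV"
    by (intro Ck_on_linear bounded_linear_compose[OF bounded_linear_of_real assms])
  have eq: "coef t i j = (coeff (root_poly S0 * [:- a, 1:]) i
        + bent_path l t * coeff ((root_poly S1 - root_poly S0) * [:- a, 1:]) i) * cnj (coeff (R * [:- b, 1:]) j)
     + of_real t * pair_rate a b k C * ((coeff (root_poly S0) i
        + bent_path l t * coeff (root_poly S1 - root_poly S0) i) * cnj (coeff R j))" for t
    by (simp only: coef_def pencil_def distrib_right mult_smult_left coeff_add coeff_smult)
  show ?thesis
    unfolding eq by (intro Ck_on_intros Ck_on_bent_path[OF assms] 1)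
qed

lemma smooth_poly_family_F: "smooth_poly_family F"
  unfolding smooth_poly_family_def
proof (intro conjI allI)
  have "(\<Union>t\<in>{0..1}. Poly_Mapping.keys (F t)) \<subseteq> hom_key n m ` ({..n} \<times> {..m})"
    using keys_hom_poly by blast
  then show "finite (\<Union>t\<in>{0..1}. Poly_Mapping.keys (F t))"
    by (rule finite_subset) simp
  fix x
  show "smooth_on_set (\<lambda>t. Poly_Mapping.lookup (F t) x) {0..1}"
  proof (rule smooth_on_set_UNIV)
    fix K
    show "Ck_on K (\<lambda>t. Poly_Mapping.lookup (F t) x) UNIV"
      unfolding lookup_hom_poly case_prod_unfold
    proof (rule Ck_on_sum)
      fix y :: "nat \<times> nat"
      show "Ck_on K (\<lambda>t. if hom_key n m (fst y, snd y) = x then coef t (fst y) (snd y) else 0) UNIV"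
        using Ck_on_coef[OF bounded_linear_ident] Ck_on_const by (cases "hom_key n m (fst y, snd y) = x") auto
    qed
  qed
qed

text \<open>A single global defining function: with \<open>U = UNIV\<close> it serves at every point
  of the total space.\<close>

definition total_fun :: "c2 \<times> real \<Rightarrow> complex" where
  "total_fun x = mixed_eval (F (snd x)) (fst x)"

lemma smooth_total_fun: "smooth_on_open total_fun UNIV"
proof -
  have l: "bounded_linear (\<lambda>x :: c2 \<times> real. fst (fst x))" "bounded_linear (\<lambda>x :: c2 \<times> real. snd (fst x))"
    by (intro bounded_linear_fst_comp bounded_linear_snd_comp bounded_linear_fst)+
  have "Ck_on K total_fun UNIV" for K
    unfolding total_fun_def[abs_def] mixed_eval_hom_poly case_prod_unfold
    by (intro Ck_on_sum Ck_on_mult Ck_on_power Ck_on_coef bounded_linear_snd Ck_on_linear l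
        bounded_linear_compose[OF bounded_linear_cnj])
  then show ?thesis by (simp add: smooth_on_open_def)
qed

lemma F_zeros: "sphere_zeros (mixed_eval (F t)) = (\<Union>w\<in>{w. f t w = 0}. orbit w)"
  using sphere_zeros_hom_poly[of "coef t" n m] coef_top[of t] by (simp add: sesqui_coef)

lemma F_zero_point:
  assumes "z \<in> sphere_zeros (mixed_eval (F t))"
  shows "fst z \<noteq> 0" "snd z \<noteq> 0" "f t (fst z ^ q / snd z ^ p) = 0"
proof -
  obtain w where w: "f t w = 0" "z \<in> orbit w"
    using assms unfolding F_zeros by blast
  then have "w \<noteq> 0" using f_0_nonzero by metis
  with w show "fst z \<noteq> 0" "snd z \<noteq> 0" "f t (fst z ^ q / snd z ^ p) = 0"
    using orbit_fst_nonzero[OF w(2)] unfolding orbit_param by blast+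
qed

lemma total_fun_derivative:
  assumes "z \<in> sphere_zeros (mixed_eval (F t))"
    and der: "((\<lambda>x. f (snd x) (fst x)) has_derivative (\<lambda>(h, s). A * h + B * cnj h + of_real s * D))
      (at (fst z ^ q / snd z ^ p, t))"
  obtains u \<kappa> where "u \<noteq> 0" "\<kappa> \<noteq> 0"
    "(total_fun has_derivative (\<lambda>(v, s). u * (A * (\<kappa> * transverse_coord z v) + B * cnj (\<kappa> * transverse_coord z v)
        + of_real s * D))) (at (z, t))"
proof -
  have "total_fun (x, s) = snd x ^ (p * n) * cnj (snd x) ^ (p * m) * (\<lambda>x. f (snd x) (fst x)) (fst x ^ q / snd x ^ p, s)"
    if "snd x \<noteq> 0" for x s
    unfolding total_fun_def fst_conv snd_conv mixed_eval_hom_poly_slice[OF that] sesqui_coef ..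
  from slice_derivative[of total_fun, OF this F_zero_point(1,2)[OF assms(1)] _ der]
  show ?thesis using that F_zero_point(3)[OF assms(1)] by auto
qed

lemma merged_point:
  assumes "disc t = 0"
  shows "pos_zero t = neg_zero t" "E t (pos_zero t) = 0" "norm (pos_zero t - a) = norm (pos_zero t - b)"
proof -
  show "pos_zero t = neg_zero t" by (simp add: pos_zero_def neg_zero_def assms)
  show "E t (pos_zero t) = 0" using E_zero_iff[of t] assms by simp
  have "Re (pair_coord a b (pos_zero t)) = 0"
    by (simp add: pos_zero_def pair_coord_point[OF ab] assms)
  then show "norm (pos_zero t - a) = norm (pos_zero t - b)"
    using pair_sign[of "pos_zero t"] by simp
qed

text \<open>Away from the merging orbit the spatial directions already suffice, with
  \<open>s = 0\<close>, which also settles the boundary times. On the merging orbit the spatial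
  image is a real line and the time direction supplies the rest; this happens strictly between times
  0 and 1, so \<open>s\<close> is unrestricted there.\<close>

lemma total_fun_surj:
  assumes z: "z \<in> sphere_zeros (mixed_eval (F t))" and t: "0 \<le> t" "t \<le> 1"
  shows "frechet_derivative total_fun (at (z, t)) `
     {(v, s). z \<bullet> v = 0 \<and> (t \<in> {0, 1} \<longrightarrow> s = 0)} = UNIV"
proof -
  define w where "w = fst z ^ q / snd z ^ p"
  note nz = F_zero_point[OF z, folded w_def]
  define A where "A = poly (pderiv (G t)) w * cnj (poly R w) * E t w + poly (G t) w * cnj (poly R w) * cnj (w - b)"
  define B where "B = poly (G t) w * cnj (poly (pderiv R) w) * E t w + poly (G t) w * cnj (poly R w) * (w - a)"
  define D where "D = dG t w * cnj (poly R w) * E t w + poly (G t) w * cnj (poly R w) * pair_rate a b k C"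
  have "((\<lambda>x. f (snd x) (fst x)) has_derivative (\<lambda>(h, s). A * h + B * cnj h + of_real s * D)) (at (w, t))"
    unfolding A_def B_def D_def by (rule f_derivative)
  then obtain u \<kappa> where u: "u \<noteq> 0" "\<kappa> \<noteq> 0" and der: "(total_fun has_derivative
      (\<lambda>(v, s). u * (A * (\<kappa> * transverse_coord z v) + B * cnj (\<kappa> * transverse_coord z v) + of_real s * D))) (at (z, t))"
    unfolding w_def by (rule total_fun_derivative[OF z])
  have onto: "\<exists>h s. A * h + B * cnj h + of_real s * D = y \<and> (t \<in> {0, 1} \<longrightarrow> s = 0)" for y
  proof (cases "norm A = norm B")
    case False
    then obtain h where "A * h + B * cnj h = y"
      by (rule wirtinger_surj)
    then show ?thesis by (intro exI[of _ h] exI[of _ 0]) simp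
  next
    case True
    have wir: "wirtinger (f t) w A B" unfolding A_def B_def by (rule f_wirtinger)
    \<comment> \<open>Whenever \<open>disc t \<noteq> 0\<close> every zero has a sign, so equal
      moduli occur only at the merging time.\<close>
    have disc0: "disc t = 0"
    proof (rule ccontr)
      assume "disc t \<noteq> 0"
      then consider "disc t > 0" | "disc t < 0" by linarith
      then obtain P N' where "signed_zeros (f t) P N'"
        using signed_zeros_before[OF _ t] signed_zeros_after[OF _ t] by blast
      then have "\<exists>A B. wirtinger (f t) w A B \<and> norm A \<noteq> norm B"
        using nz(3) by (rule signed_zeros_norm)
      then show False
        using wirtinger_unique[OF wir] True by metis
    qed
    have t01: "t \<notin> {0, 1}"
    proof -
      have "disc 0 = 1" by (simp add: disc_def)
      moreover have "disc 1 = 1 - C - k\<^sup>2 * C\<^sup>2" "0 \<le> k\<^sup>2 * C\<^sup>2" by (simp_all add: disc_def)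
      then have "disc 1 < 0" using C by linarith
      ultimately show ?thesis using disc0 by auto
    qed
    have Ez: "E t w = 0"
    proof (rule ccontr)
      assume "E t w \<noteq> 0"
      then consider "w \<in> roots t" | "w \<in> N"
        using nz(3) by (auto simp: f_def R_zero_iff)
      then obtain A' B' where "wirtinger (f t) w A' B'" "norm A' > norm B' \<or> norm A' < norm B'"
        using wirtinger_at_roots[OF _ t] wirtinger_at_N[OF _ t] by cases blast+
      then show False
        using wirtinger_unique[OF wir] True by auto
    qed
    then have w: "w = pos_zero t" using E_zero_iff[of t w] disc0 merged_point(1)[OF disc0] by simp
    define r where "r = poly (G t) w * cnj (poly R w)"
    have r: "r \<noteq> 0"
      using nz(3) Ez t by (auto simp: r_def elim: f_zero_cases)
    define y0 where "y0 = k * (C * t)"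
    define \<sigma> where "\<sigma> = (b - a) / 2"
    have \<sigma>: "\<sigma> \<noteq> 0" using ab by (simp add: \<sigma>_def)
    have u: "pair_coord a b w = \<i> * of_real y0"
      unfolding w pos_zero_def pair_coord_point[OF ab] disc0 y0_def by (simp add: complex_eq_iff)
    have ABD: "A = r * cnj (\<sigma> * (\<i> * of_real y0 - 1))" "B = r * (\<sigma> * (\<i> * of_real y0 + 1))"
        "D = r * (of_real ((norm \<sigma>)\<^sup>2 * C) * Complex 1 (2 * k))"
      unfolding A_def B_def D_def pair_diff[OF ab, of w] u Ez
      by (simp_all add: r_def \<sigma>_def pair_rate_def)
    define Y where "Y = y / (r * of_real ((norm \<sigma>)\<^sup>2))"
    text \<open>After dividing by \<open>r |\<sigma>|\<^sup>2\<close>, the vector \<open>h = i x \<sigma>\<close> is mapped to \<open>2 x (y0 - i)\<close> and the time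
      direction to \<open>C (1 + 2 i k)\<close>; these are independent because \<open>1 + 2 k y0 > 0\<close>.\<close>
    have det: "1 + 2 * k * y0 > 0"
    proof -
      have "k * y0 = k\<^sup>2 * C * t" by (simp add: y0_def power2_eq_square)
      moreover have "0 \<le> k\<^sup>2 * C * t" using C t by (intro mult_nonneg_nonneg) auto
      ultimately show ?thesis by simp
    qed
    \<comment> \<open>\<open>s\<close> and \<open>x\<close> solve the real system
      \<open>C * s + 2 * x * y0 = Re Y\<close>, \<open>2 * k * C * s - 2 * x = Im Y\<close>.\<close>
    define s where "s = (Re Y + y0 * Im Y) / (C * (1 + 2 * k * y0))"
    define x where "x = (C * s * (2 * k) - Im Y) / 2"
    have "A * (\<sigma> * (\<i> * of_real x)) + B * cnj (\<sigma> * (\<i> * of_real x)) + of_real s * D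
        = r * (\<sigma> * cnj \<sigma>) * (2 * of_real x * (of_real y0 - \<i>)) + of_real s * D"
      unfolding ABD by (simp add: algebra_simps)
    also have "\<sigma> * cnj \<sigma> = of_real ((norm \<sigma>)\<^sup>2)"
      by (simp add: complex_norm_square[symmetric])
    also have "r * of_real ((norm \<sigma>)\<^sup>2) * (2 * of_real x * (of_real y0 - \<i>)) + of_real s * D
        = r * of_real ((norm \<sigma>)\<^sup>2) * (2 * of_real x * (of_real y0 - \<i>) + of_real (C * s) * Complex 1 (2 * k))"
      unfolding ABD by (simp add: algebra_simps)
    also have "2 * of_real x * (of_real y0 - \<i>) + of_real (C * s) * Complex 1 (2 * k) = Y"
    proof -
      have "C * s * (1 + 2 * k * y0) = Re Y + y0 * Im Y"
        using C det by (simp add: s_def)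
      moreover have "2 * x * y0 + C * s = C * s * (1 + 2 * k * y0) - y0 * Im Y"
        unfolding x_def by (simp add: field_simps)
      ultimately have "2 * x * y0 + C * s = Re Y"
        by simp
      moreover have "- (2 * x) + C * s * (2 * k) = Im Y"
        unfolding x_def by (simp add: field_simps)
      ultimately show ?thesis by (simp add: complex_eq_iff)
    qed
    also have "r * of_real ((norm \<sigma>)\<^sup>2) * Y = y"
      using r \<sigma> by (simp add: Y_def)
    finally show ?thesis using t01 by blast
  qed
  show ?thesis
    unfolding frechet_derivative_at[OF der, symmetric]
  proof (intro equalityI subset_UNIV subsetI)
    fix y
    obtain h s where hs: "A * h + B * cnj h + of_real s * D = y / u" "t \<in> {0, 1} \<longrightarrow> s = 0"
      using onto by blast
    obtain v where v: "z \<bullet> v = 0" "transverse_coord z v = h / \<kappa>"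
      using tangent_lift[OF nz(1,2)] .
    show "y \<in> (\<lambda>(v, s). u * (A * (\<kappa> * transverse_coord z v) + B * cnj (\<kappa> * transverse_coord z v) + of_real s * D))
        ` {(v, s). z \<bullet> v = 0 \<and> (t \<in> {0, 1} \<longrightarrow> s = 0)}"
      by (rule image_eqI[of _ _ "(v, s)"]) (use u v hs in \<open>simp_all del: complex_cnj_mult complex_cnj_divide\<close>)
  qed
qed

lemma smooth_codim2_F: "smooth_codim2 {(z, t). t \<in> {0..1} \<and> z \<in> sphere_zeros (mixed_eval (F t))}"
  (is "smooth_codim2 ?W")
  unfolding smooth_codim2_def
proof (intro conjI ballI)
  show "?W \<subseteq> S3 \<times> {0..1}" by (auto simp: sphere_zeros_def)
  fix x assume "x \<in> ?W"
  show "\<exists>U (g :: c2 \<times> real \<Rightarrow> complex). x \<in> U \<and> smooth_on_open g U \<and> ?W \<inter> U = {y \<in> (S3 \<times> {0..1}) \<inter> U. g y = 0} \<and>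
      (\<forall>(z, t) \<in> ?W \<inter> U. frechet_derivative g (at (z, t)) `
         {(w, s). z \<bullet> w = 0 \<and> (t \<in> {0, 1} \<longrightarrow> s = 0)} = UNIV)"
  proof (intro exI[of _ UNIV] exI[of _ total_fun] conjI)
    show "?W \<inter> UNIV = {y \<in> S3 \<times> {0..1} \<inter> UNIV. total_fun y = 0}"
      by (auto simp: sphere_zeros_def total_fun_def)
    show "\<forall>(z, t) \<in> ?W \<inter> UNIV. frechet_derivative total_fun (at (z, t)) `
         {(w, s). z \<bullet> w = 0 \<and> (t \<in> {0, 1} \<longrightarrow> s = 0)} = UNIV"
      using total_fun_surj by auto
  qed (use smooth_total_fun in auto)
qed

section \<open>The links before, at and after the merging\<close>

lemma pos_zero_cont: "isCont pos_zero t"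
  \<comment> \<open>Real \<open>sqrt\<close> is continuous on the whole line, in particular at the
    merging time, where its argument is 0.\<close>
  unfolding pos_zero_def[abs_def] pair_point_def disc_def Complex_eq by (intro continuous_intros) auto

lemma neg_zero_cont: "isCont neg_zero t"
  unfolding neg_zero_def[abs_def] pair_point_def disc_def Complex_eq by (intro continuous_intros) auto

text \<open>The merged zero lies on the bisector of \<open>a\<close> and \<open>b\<close>, where the
  two Wirtinger derivatives have equal moduli.\<close>

lemma not_transverse_merge:
  assumes "disc t = 0" "0 \<le> t" "t \<le> 1"
  shows "\<not> transverse_on_S3 (mixed_eval (F t))"
proof
  assume tr: "transverse_on_S3 (mixed_eval (F t))"
  define w where "w = pos_zero t"
  obtain z where z: "z \<in> orbit w" using orbit_nonempty by blast
  have Ew: "E t w = 0" unfolding w_def by (rule merged_point(2)[OF assms(1)])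
  then have fw: "f t w = 0" by (simp add: f_def)
  then have zK: "z \<in> sphere_zeros (mixed_eval (F t))" using z unfolding F_zeros by blast
  note nz = F_zero_point[OF zK]
  have pz: "fst z ^ q / snd z ^ p = w" using z by (simp add: orbit_param)
  obtain r where r: "r \<noteq> 0" "wirtinger (f t) w (r * cnj (w - b)) (r * (w - a))"
    using wirtinger_at_pair[OF Ew assms(2,3)] .
  have "wirtinger (sesqui n m (coef t)) (fst z ^ q / snd z ^ p) (r * cnj (w - b)) (r * (w - a))"
    unfolding sesqui_coef pz by (rule r)
  from mixed_eval_derivative[OF this nz(1,2)] nz(3)
  obtain A B L where AB: "norm A = L * norm (r * cnj (w - b))" "norm B = L * norm (r * (w - a))"
    "(mixed_eval (F t) has_derivative (\<lambda>v. A * transverse_coord z v + B * cnj (transverse_coord z v))) (at z)"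
    unfolding sesqui_coef by blast
  have "norm A = norm B"
    using AB(1,2) merged_point(3)[OF assms(1)] unfolding norm_mult complex_mod_cnj w_def by simp
  moreover have "frechet_derivative (mixed_eval (F t)) (at z) ` {w. z \<bullet> w = 0} = UNIV"
    using tr zK unfolding transverse_on_S3_def by blast
  then have "norm A \<noteq> norm B"
    unfolding frechet_derivative_at[OF AB(3), symmetric] surj_tangent_iff[OF nz(1,2)] .
  ultimately show False by blast
qed

lemma components_F:
  assumes "disc t \<ge> 0"
  shows "components (sphere_zeros (mixed_eval (F t))) = orbit ` {w. f t w = 0}"
proof -
  have "{w. f t w = 0} \<subseteq> roots t \<union> N \<union> {pos_zero t, neg_zero t}"
    using E_zero_iff[OF assms] by (auto simp: f_def R_zero_iff)
  then have "finite {w. f t w = 0}"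
    using finite_roots finite_N by (meson finite.emptyI finite_UnI finite_insert finite_subset)
  then show ?thesis
    unfolding F_zeros using f_0_nonzero by (intro components_Union_orbits) auto
qed

lemma link_before:
  assumes "disc t > 0" "0 \<le> t" "t \<le> 1"
  shows "oriented_zero_link (mixed_eval (F t)) = orbit_link (insert (pos_zero t) (roots t)) (insert (neg_zero t) N)"
    and "transverse_on_S3 (mixed_eval (F t))"
    and "oriented_zero_link (mixed_eval (F t)) \<in> polar_links_neg p q d (Suc (card N))"
proof -
  have sz: "signed_zeros (sesqui n m (coef t)) (insert (pos_zero t) (roots t)) (insert (neg_zero t) N)"
    unfolding sesqui_coef by (rule signed_zeros_before[OF assms])
  have c: "coef t n m \<noteq> 0" using coef_top by simp
  note L = link_of_signed_zeros[of "coef t", OF c coef_0 sz]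
  show "oriented_zero_link (mixed_eval (F t)) = orbit_link (insert (pos_zero t) (roots t)) (insert (neg_zero t) N)"
    "transverse_on_S3 (mixed_eval (F t))"
    by (rule L)+
  have E: "E t (pos_zero t) = 0" "E t (neg_zero t) = 0"
    using E_zero_iff[of t] assms(1) by auto
  have "pos_zero t \<notin> roots t" "neg_zero t \<notin> N"
    using pair_apart[OF assms(2,3) E(1)] pair_avoids[of "neg_zero t" t] E(2) by auto
  then have "card (insert (pos_zero t) (roots t)) = d + Suc (card N)" "card (insert (neg_zero t) N) = Suc (card N)"
    using finite_roots finite_N card_roots card_S0 by simp_all
  then have "orbit_link (insert (pos_zero t) (roots t)) (insert (neg_zero t) N) \<in> polar_links_neg p q d (Suc (card N))"
    using finite_roots finite_N card_S0
    by (intro signed_zeros_polar_link[of "coef t", OF c coef_0 sz]) auto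
  then show "oriented_zero_link (mixed_eval (F t)) \<in> polar_links_neg p q d (Suc (card N))"
    unfolding L(1) .
qed

lemma link_after:
  assumes "disc t < 0" "0 \<le> t" "t \<le> 1"
  shows "oriented_zero_link (mixed_eval (F t)) = orbit_link (roots t) N"
    and "transverse_on_S3 (mixed_eval (F t))"
    and "oriented_zero_link (mixed_eval (F t)) \<in> polar_links_neg p q d (card N)"
proof -
  have sz: "signed_zeros (sesqui n m (coef t)) (roots t) N"
    unfolding sesqui_coef by (rule signed_zeros_after[OF assms])
  have c: "coef t n m \<noteq> 0" using coef_top by simp
  note L = link_of_signed_zeros[of "coef t", OF c coef_0 sz]
  show "oriented_zero_link (mixed_eval (F t)) = orbit_link (roots t) N"
    "transverse_on_S3 (mixed_eval (F t))"
    by (rule L)+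
  have "orbit_link (roots t) N \<in> polar_links_neg p q d (card N)"
    using finite_roots finite_N card_S0 card_roots
    by (intro signed_zeros_polar_link[of "coef t", OF c coef_0 sz]) auto
  then show "oriented_zero_link (mixed_eval (F t)) \<in> polar_links_neg p q d (card N)"
    unfolding L(1) .
qed

lemma family_start: "oriented_zero_link (mixed_eval (F 0)) = orbit_link (insert a S0) (insert b N)"
proof -
  have "disc 0 = 1" by (simp add: disc_def)
  moreover have "bent_path l 0 = 0" by (simp add: bent_path_def complex_eq_iff)
  then have "roots 0 = S0" by (simp add: poly_root_poly finite_S0)
  moreover have "pos_zero 0 = a" "neg_zero 0 = b"
    using \<open>disc 0 = 1\<close> by (simp_all add: pos_zero_def neg_zero_def pair_point_def complex_eq_iff field_simps)
  ultimately show ?thesis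
    using link_before(1)[of 0] by simp
qed

lemma family_end: "oriented_zero_link (mixed_eval (F 1)) = orbit_link S1 N"
proof -
  have "bent_path l 1 = 1" by (simp add: bent_path_def complex_eq_iff)
  then have "roots 1 = S1" by (simp add: poly_root_poly finite_S1)
  moreover have "disc 1 = 1 - C - k\<^sup>2 * C\<^sup>2" "0 \<le> k\<^sup>2 * C\<^sup>2" by (simp_all add: disc_def)
  then have "disc 1 < 0" using C by linarith
  ultimately show ?thesis
    using link_after(1)[of 1] by simp
qed

lemma elimination_family_F:
  "elimination_family p q d (Suc (card N)) (orbit_link (insert a S0) (insert b N)) (orbit_link S1 N) F"
proof -
  obtain t0 where t0: "0 < t0" "t0 < 1" "disc t0 = 0"
    "\<forall>t. 0 \<le> t \<longrightarrow> t < t0 \<longrightarrow> disc t > 0" "\<forall>t. t0 < t \<longrightarrow> disc t < 0"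
    using merge_time .
  let ?A = "\<lambda>t. orbit (pos_zero t)" and ?B = "\<lambda>t. orbit (neg_zero t)" and ?C = "orbit (pos_zero t0)"
  have before: "transverse_on_S3 (mixed_eval (F t)) \<and>
      oriented_zero_link (mixed_eval (F t)) \<in> polar_links_neg p q d (Suc (card N))" if "t \<in> {0..<t0}" for t
    using link_before[of t] t0 that by simp
  have after: "transverse_on_S3 (mixed_eval (F t)) \<and>
      oriented_zero_link (mixed_eval (F t)) \<in> polar_links_neg p q d (card N)" if "t \<in> {t0<..1}" for t
    using link_after[of t] t0 that by simp
  have nz: "pos_zero t0 \<noteq> 0"
    using pair_avoids[of 0 t0] merged_point(2)[OF t0(3)] by auto
  have C: "?C \<in> components (sphere_zeros (mixed_eval (F t0)))"
    using components_F[of t0] t0(3) merged_point(2)[OF t0(3)] by (simp add: f_def)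
  have AB: "?A t \<in> components (sphere_zeros (mixed_eval (F t))) \<and>
      positively_oriented p q (oriented_zero_link (mixed_eval (F t))) (?A t) \<and>
      ?B t \<in> components (sphere_zeros (mixed_eval (F t))) \<and>
      negatively_oriented p q (oriented_zero_link (mixed_eval (F t))) (?B t)" if "t \<in> {0..<t0}" for t
  proof -
    have d: "disc t > 0" "0 \<le> t" "t \<le> 1" using t0 that by auto
    have "E t (pos_zero t) = 0" "E t (neg_zero t) = 0"
      using E_zero_iff[of t] d by auto
    then have "f t (pos_zero t) = 0" "f t (neg_zero t) = 0"
      by (simp_all add: f_def)
    then show ?thesis
      using components_F[of t] d positively_oriented_orbit[OF signed_zeros_disjoint[OF signed_zeros_before[OF d]]]
        negatively_oriented_orbit[OF signed_zeros_disjoint[OF signed_zeros_before[OF d]]]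
      unfolding link_before(1)[OF d] by simp
  qed
  have "(pos_zero \<longlongrightarrow> pos_zero t0) (at_left t0)" "(neg_zero \<longlongrightarrow> neg_zero t0) (at_left t0)"
    using pos_zero_cont[of t0] neg_zero_cont[of t0] unfolding isCont_def
    by (auto intro: tendsto_within_subset)
  then have lim: "sets_tendto ?A ?C (at_left t0)" "sets_tendto ?B ?C (at_left t0)"
    using orbits_tendto[of _ "pos_zero t0"] nz merged_point(1)[OF t0(3)] by auto
  have ends: "orbit_link (insert a S0) (insert b N) \<in> polar_links_neg p q d (Suc (card N))"
      "orbit_link S1 N \<in> polar_links_neg p q d (card N)"
    using before[of 0] after[of 1] t0 by (simp_all add: family_start family_end)
  have wh: "\<exists>dr. strongly_polar_wh p q dr (int (d * p * q)) (F t)" for t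
    using strongly_polar_hom_poly[of n m d "coef t"] card_S0 by auto
  have ex: "\<exists>C \<in> components (sphere_zeros (mixed_eval (F t0))). \<exists>A B.
      (\<forall>t\<in>{0..<t0}. A t \<in> components (sphere_zeros (mixed_eval (F t))) \<and>
         positively_oriented p q (oriented_zero_link (mixed_eval (F t))) (A t) \<and>
         B t \<in> components (sphere_zeros (mixed_eval (F t))) \<and>
         negatively_oriented p q (oriented_zero_link (mixed_eval (F t))) (B t)) \<and>
      sets_tendto A C (at_left t0) \<and> sets_tendto B C (at_left t0)"
    by (rule bexI[OF _ C], rule exI[of _ ?A], rule exI[of _ ?B]) (use AB lim in blast)
  have nt: "\<not> transverse_on_S3 (mixed_eval (F t0))"
    using not_transverse_merge[OF t0(3)] t0(1,2) by simp
  show ?thesis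
    unfolding elimination_family_def Let_def diff_Suc_1
    by (intro conjI exI[of _ t0])
       (use t0(1,2) before after nt ex ends wh smooth_poly_family_F smooth_codim2_F family_start family_end
        in \<open>blast | simp\<close>)+
qed

end

subsection \<open>Eliminating all pairs\<close>

context weights
begin

text \<open>The target \<open>P'\<close> is left free for two uses: with \<open>P' = P - {a}\<close>
  the pencil is constant and the other positive zeros rest, while at the last pair \<open>P'\<close>
  is the prescribed final configuration.\<close>

lemma elimination_step:
  assumes P: "finite P" "card P = d + Suc j" and N: "finite N" "card N = Suc j"
    and disj: "P \<inter> N = {}" "0 \<notin> P \<union> N" and a: "a \<in> P" and b: "b \<in> N"
    and P': "finite P'" "card P' = d + j" "0 \<notin> P'" "P' \<inter> (N - {b}) = {}"
  shows "\<exists>F. elimination_family p q d (Suc j) (orbit_link P N) (orbit_link P' (N - {b})) F"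
proof -
  let ?S0 = "P - {a}" and ?N = "N - {b}"
  have card: "card P' = card ?S0" "card ?S0 = d + card ?N" "card ?N = j"
    using P N P' a b by simp_all
  have ab: "a \<noteq> b"
    using disj a b by auto
  have fin: "finite ?S0" "finite P'" "finite (insert 0 ?N)"
    using P N P' by simp_all
  \<comment> \<open>0 is added to the points to be avoided because it stands for the singular orbit
    \<open>fst z = 0\<close>.\<close>
  have av: "insert 0 ?N \<inter> ?S0 = {}" "insert 0 ?N \<inter> P' = {}" "a \<notin> ?S0 \<union> insert 0 ?N" "b \<notin> ?S0 \<union> insert 0 ?N"
    using disj P' a b by auto
  obtain l k C where lkC: "C \<ge> 2"
    "\<forall>t w. poly (pencil ?S0 P' (bent_path l t)) w = 0 \<longrightarrow>
       w \<notin> insert 0 ?N \<and> poly (pderiv (pencil ?S0 P' (bent_path l t))) w \<noteq> 0"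
    "\<forall>t. \<forall>w\<in>insert 0 ?N. pair_fun a b k C t w \<noteq> 0"
    "\<forall>t\<in>{0..1}. \<forall>w. pair_fun a b k C t w = 0 \<longrightarrow> poly (pencil ?S0 P' (bent_path l t)) w \<noteq> 0"
    using elimination_parameters[OF ab fin card(1) av] .
  interpret elimination p q ?S0 P' ?N a b l k C d
  proof unfold_locales
    show "finite ?S0" "finite P'" "finite ?N" "card P' = card ?S0" "card ?S0 = d + card ?N" "0 \<notin> ?N" "a \<noteq> b" "2 \<le> C"
      using fin card disj ab lkC(1) by auto
    show "w \<notin> insert 0 ?N \<and> poly (pderiv (pencil ?S0 P' (bent_path l t))) w \<noteq> 0"
      if "poly (pencil ?S0 P' (bent_path l t)) w = 0" for t w
      using lkC(2) that by blast
    show "pair_fun a b k C t w \<noteq> 0" if "w \<in> insert 0 ?N" for t w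
      using lkC(3) that by blast
    show "poly (pencil ?S0 P' (bent_path l t)) w \<noteq> 0"
      if "0 \<le> t" "t \<le> 1" "pair_fun a b k C t w = 0" for t w
      using lkC(4) that by simp
  qed
  show ?thesis
    using elimination_family_F unfolding card(3) insert_Diff[OF a] insert_Diff[OF b] by blast
qed

text \<open>The move to \<open>Q\<close> waits for the last pair because earlier \<open>Q\<close>
  might contain one of the remaining negative zeros; at the last step none remain.\<close>

lemma elimination_chain:
  assumes "finite P" "card P = d + Suc j" "finite N" "card N = Suc j"
    and "P \<inter> N = {}" "0 \<notin> P \<union> N" and Q: "finite Q" "card Q = d" "0 \<notin> Q"
  shows "\<exists>Ls. Ls (Suc j) = orbit_link P N \<and> Ls 0 = orbit_link Q {} \<and>
    (\<forall>i\<in>{1..Suc j}. \<exists>F. elimination_family p q d i (Ls i) (Ls (i - 1)) F)"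
  using assms(1-6)
proof (induction j arbitrary: P N)
  case 0
  then obtain a b where ab: "a \<in> P" "N = {b}"
    by (metis One_nat_def add_is_0 all_not_in_conv card.empty card_1_singletonE nat.distinct(1))
  obtain F where "elimination_family p q d (Suc 0) (orbit_link P N) (orbit_link Q (N - {b})) F"
    using elimination_step[OF 0(1-6) ab(1), of b Q] ab Q by auto
  then show ?case
    using ab by (intro exI[of _ "\<lambda>i. if i = 0 then orbit_link Q {} else orbit_link P N"]) auto
next
  case (Suc j)
  obtain a where a: "a \<in> P" using Suc.prems(2) by fastforce
  obtain b where b: "b \<in> N" using Suc.prems(4) by fastforce
  have c: "card (P - {a}) = d + Suc j" "card (N - {b}) = Suc j"
    using Suc.prems a b by simp_all
  obtain F where F: "elimination_family p q d (Suc (Suc j)) (orbit_link P N) (orbit_link (P - {a}) (N - {b})) F"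
    using elimination_step[OF Suc.prems a b, of "P - {a}"] Suc.prems c by auto
  obtain Ls where Ls: "Ls (Suc j) = orbit_link (P - {a}) (N - {b})" "Ls 0 = orbit_link Q {}"
    "\<forall>i\<in>{1..Suc j}. \<exists>F. elimination_family p q d i (Ls i) (Ls (i - 1)) F"
  proof -
    have "finite (P - {a})" "finite (N - {b})" "(P - {a}) \<inter> (N - {b}) = {}" "0 \<notin> (P - {a}) \<union> (N - {b})"
      using Suc.prems by auto
    then show ?thesis
      using Suc.IH[of "P - {a}" "N - {b}"] c that by blast
  qed
  show ?case
  proof (intro exI[of _ "Ls(Suc (Suc j) := orbit_link P N)"] conjI ballI)
    fix i assume i: "i \<in> {1..Suc (Suc j)}"
    show "\<exists>F. elimination_family p q d i ((Ls(Suc (Suc j) := orbit_link P N)) i)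
        ((Ls(Suc (Suc j) := orbit_link P N)) (i - 1)) F"
    proof (cases "i = Suc (Suc j)")
      case True
      then show ?thesis using F Ls(1) by auto
    next
      case False
      then show ?thesis using Ls(3) i by auto
    qed
  qed (use Ls in auto)
qed

text \<open>The case \<open>m = 0\<close>, with one-variable polynomial \<open>w^d - 1\<close>. It
  is holomorphic with simple roots, so \<open>B = 0\<close> and every zero is positive.\<close>

lemma torus_link:
  assumes "d \<ge> 1"
  shows "oriented_zero_link (\<lambda>z. fst z ^ (q * d) - snd z ^ (p * d)) = orbit_link {w. w ^ d = 1} {}"
proof -
  define c :: "nat \<Rightarrow> nat \<Rightarrow> complex" where
    "c i j = (if i = d then 1 else 0) - (if i = 0 then 1 else 0)" for i j
  have c: "c d 0 \<noteq> 0" "c 0 0 \<noteq> 0" using assms by (auto simp: c_def)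
  have ev: "(\<Sum>(i, j)\<in>{..d} \<times> {..0}. c i j * g i j) = g d 0 - g 0 0" for g :: "nat \<Rightarrow> nat \<Rightarrow> complex"
  proof -
    have "(\<Sum>(i, j)\<in>{..d} \<times> {..0}. c i j * g i j) = (\<Sum>i\<le>d. c i 0 * g i 0)"
      by (simp add: sum.cartesian_product[symmetric])
    also have "\<dots> = (\<Sum>i\<le>d. if i = d then g d 0 else 0) - (\<Sum>i\<le>d. if i = 0 then g 0 0 else 0)"
      unfolding sum_subtractf[symmetric] by (intro sum.cong) (auto simp: c_def)
    also have "\<dots> = g d 0 - g 0 0" by simp
    finally show ?thesis .
  qed
  have "mixed_eval (hom_poly d 0 c) = (\<lambda>z. fst z ^ (q * d) - snd z ^ (p * d))"
    unfolding fun_eq_iff mixed_eval_hom_poly mult.assoc[of "c _ _"] ev by simp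
  moreover have s: "sesqui d 0 c = (\<lambda>w. w ^ d - 1)"
    unfolding fun_eq_iff sesqui_def mult.assoc[of "c _ _"] ev by simp
  moreover have "signed_zeros (sesqui d 0 c) {w. w ^ d = 1} {}"
    unfolding signed_zeros_def s
  proof (intro conjI ballI)
    fix w :: complex assume "w \<in> {w. w ^ d = 1}"
    then have "w \<noteq> 0" using assms by (auto simp: power_0_left)
    have "wirtinger (\<lambda>w. w ^ d - 1) w (of_nat d * w ^ (d - 1)) 0"
      unfolding wirtinger_def by (auto intro!: derivative_eq_intros)
    then show "\<exists>A B. wirtinger (\<lambda>w. w ^ d - 1) w A B \<and> norm B < norm A"
      using \<open>w \<noteq> 0\<close> assms by (intro exI conjI) (assumption, simp)
  qed auto
  ultimately show ?thesis
    using link_of_signed_zeros(1)[of c d 0, OF c] by metis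
qed

end

theorem corollary7:
  fixes p q d r :: nat and L :: oriented_link
  assumes "p > 0" and "q > 0" and "coprime p q" and "d \<ge> 1" and "r > 0"
    and "L \<in> polar_links_neg p q d r"
  shows "\<exists>Ls :: nat \<Rightarrow> oriented_link.
           Ls r = L \<and>
           (\<forall>j\<le>r. Ls j \<in> polar_links_neg p q d j) \<and>
           (\<forall>j\<in>{1..r}. \<exists>F. elimination_family p q d j (Ls j) (Ls (j - 1)) F) \<and>
           link_isomorphic (Ls 0)
             (oriented_zero_link (\<lambda>z. fst z ^ (q * d) - snd z ^ (p * d)))"
proof -
  interpret weights p q
    by unfold_locales (use assms in auto)
  obtain P N where PN: "L = orbit_link P N" "finite P" "finite N" "P \<inter> N = {}" "0 \<notin> P \<union> N"
    "card P = d + r" "card N = r"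
    using polar_link_normal_form[OF assms(6)] .
  define Q where "Q = {w :: complex. w ^ d = 1}"
  obtain j where r: "r = Suc j" using assms(5) gr0_implies_Suc by blast
  have "finite Q" "card Q = d" "0 \<notin> Q"
    using assms(4) card_roots_unity_eq[of d] finite_roots_unity[of d] by (auto simp: Q_def power_0_left)
  then obtain Ls where Ls: "Ls r = L" "Ls 0 = orbit_link Q {}"
    "\<forall>i\<in>{1..r}. \<exists>F. elimination_family p q d i (Ls i) (Ls (i - 1)) F"
    using elimination_chain[of P d j N Q] PN unfolding r by auto
  have "Ls i \<in> polar_links_neg p q d i" if "i \<le> r" for i
  proof (cases "i = r")
    case True
    then show ?thesis using Ls(1) assms(6) by simp
  next
    case False
    \<comment> \<open>\<open>Ls i\<close> is where the family numbered \<open>Suc i\<close> ends,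
      and membership of the end link is one of the clauses of
      \<open>elimination_family\<close>.\<close>
    then have "Suc i \<in> {1..r}" using that by simp
    then show ?thesis
      using Ls(3) unfolding elimination_family_def Let_def by fastforce
  qed
  moreover have "link_isomorphic (Ls 0) (oriented_zero_link (\<lambda>z. fst z ^ (q * d) - snd z ^ (p * d)))"
    unfolding Ls(2) torus_link[OF assms(4)] Q_def by (rule link_isomorphic_refl)
  ultimately show ?thesis using Ls by blast
qed

end
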